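(* Assume the Model Assumption and fix $z\in\mathbb R$. Then $\mathbb E[\operatorname{proj}(\mathcal L_j(z)|C_1)^2]=0$ for all $j$, and $$\lim_{j\to\infty}\mathbb E[\operatorname{proj}(\mathcal L_j(z)|C_2)^2]=\pi^3\phi(z)^2M_a\frac{1}{\left(\int_{1/2}^2 b^2(x)x^{1-a}dx\right)^2}\int_{1/2}^2 b^4(x)x^{1-2a}\big(x^2M_a^{-1}+z^2-1\big)^2dx,$$ with $M_a=\int_{1/2}^2 b^2(x)x^{3-a}dx\big/\int_{1/2}^2 b^2(x)x^{1-a}dx$. This limit is nonzero for every $z$.
   Context: Let $\{f(x):x\in\mathbb S^2\}$ be a centered isotropic Gaussian random field, $f=\sum_{\ell\ge1}f_\ell$, $f_\ell=\sum_{m=-\ell}^{\ell}a_{\ell m}Y_{\ell m}$ ($Y_{\ell m}$ spherical harmonics, $a_{\ell m}$ Gaussian with $\mathbb E[a_{\ell m}\overline{a_{\ell'm'}}]=C_\ell\delta_\ell^{\ell'}\delta_m^{m'}$, $C_\ell>0$), so the $f_\ell$ are independent with $\mathbb E[f_\ell(x)f_\ell(y)]=C_\ell\frac{2\ell+1}{4\pi}P_\ell(\cos d(x,y))$. Let $b\ge0$ be $C^\infty$, supported in $[1/2,2]$, with $\sum_j b(\ell/2^j)^2=1$ for $\ell>2$. Put $\beta_j=\sum_{\ell=2^{j-1}}^{2^{j+1}}b(\ell/2^j)f_\ell$, $B_{2^j}=\sum_\ell b(\ell/2^j)^2C_\ell\frac{2\ell+1}{4\pi}$, $A_{2^j}=\frac1{B_{2^j}}\sum_\ell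 b(\ell/2^j)^2\frac{\ell(\ell+1)}2C_\ell\frac{2\ell+1}{4\pi}$, $\tilde\beta_j=\beta_j/\sqrt{B_{2^j}}$. $\partial_1,\partial_2$ are derivatives along an orthonormal tangent frame (in spherical coordinates $(\theta,\varphi)$: $\partial_1=\partial_\theta$, $\partial_2=(\sin\theta)^{-1}\partial_\varphi$); then $\mathbb E[(\partial_i\tilde\beta_j(x))^2]=A_{2^j}$ and we set $\tilde\partial_i\tilde\beta_j=\partial_i\tilde\beta_j/\sqrt{A_{2^j}}$. $\mathcal L_j(z)$ is the length of $\{x:\tilde\beta_j(x)=z\}$. $H_q$ are the (probabilists') Hermite polynomials, $\phi$ the standard Gaussian density, $\beta_\ell(z):=\phi(z)H_\ell(z)$, and $\alpha_{2n,2m}=\sqrt{\frac\pi2}\frac{(2n)!(2m)!}{n!m!}\frac{1}{2^{n+m}}\sum_{i=0}^{n+m}(-1)^{i+n+m}\binom{n+m}{i}\frac{(2i+1)!}{(i!)^2}\frac1{4^i}$, with $\alpha_{k,l}=0$ unless $k,l$ are both even. The $q$-th Wiener chaos component of $\mathcal L_j(z)$ (w.r.t. the Gaussian space generated by $f$) is $$\operatorname{proj}(\mathcal L_j(z)|C_q)=\sqrt{A_{2^j}}\sum_{u=0}^q\sum_{k=0}^u\frac{\alpha_{k,u-k}\beta_{q-u}(z)}{k!(u-k)!(q-u)!}\int_{\mathbb S^2}H_{q-u}(\tilde\beta_j(x))H_k(\tilde\partial_1\tilde\beta_j(x))H_{u-k}(\tilde\partial_2\tilde\beta_j(x))\,dx.$$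 Model Assumption: $C_\ell=\ell^{-a}G(\ell)$, $a>4$, $G=P/Q$ with $P,Q$ positive polynomials of equal degree, $G:=\lim_\ell G(\ell)>0$. *)

theory Defs
  imports "HOL-Probability.Probability" "HOL-Computational_Algebra.Polynomial"
begin

definition sph :: "real \<Rightarrow> real \<Rightarrow> real^3" where
  "sph t s = vector [sin t * cos s, sin t * sin s, cos t]"

fun hermite :: "nat \<Rightarrow> real \<Rightarrow> real" where
  "hermite 0 x = 1"
| "hermite (Suc 0) x = x"
| "hermite (Suc (Suc n)) x = x * hermite (Suc n) x - real (Suc n) * hermite n x"

fun legendre :: "nat \<Rightarrow> real \<Rightarrow> real" where
  "legendre 0 x = 1"
| "legendre (Suc 0) x = x"
| "legendre (Suc (Suc n)) x =
     ((2 * real n + 3) * x * legendre (Suc n) x - real (Suc n) * legendre n x) / real (n + 2)"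

definition hermite_beta :: "nat \<Rightarrow> real \<Rightarrow> real" where
  "hermite_beta q z = std_normal_density z * hermite q z"

definition alpha :: "nat \<Rightarrow> nat \<Rightarrow> real" where
  "alpha k l = (if even k \<and> even l then
     (let n = k div 2; m = l div 2 in
       sqrt (pi / 2) * (fact (2*n) * fact (2*m) / (fact n * fact m)) / 2 ^ (n + m) *
       (\<Sum>i = 0..n+m. (-1) ^ (i + n + m) * real ((n + m) choose i) *
            (fact (2*i+1) / (fact i)^2) / 4 ^ i))
     else 0)"

(* the multipole range of the j-th needlet; b is supported in [1/2,2] *)
definition lrange :: "nat \<Rightarrow> nat set" where
  "lrange j = {2 ^ (j - 1) .. 2 ^ (j + 1)}"

definition Bw :: "(real \<Rightarrow> real) \<Rightarrow> (nat \<Rightarrow> real) \<Rightarrow> nat \<Rightarrow> real" where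
  "Bw b C j = (\<Sum>l\<in>lrange j. (b (real l / 2 ^ j))^2 * C l * (2 * real l + 1) / (4 * pi))"

definition Aw :: "(real \<Rightarrow> real) \<Rightarrow> (nat \<Rightarrow> real) \<Rightarrow> nat \<Rightarrow> real" where
  "Aw b C j = (\<Sum>l\<in>lrange j. (b (real l / 2 ^ j))^2 * (real l * (real l + 1) / 2) *
       C l * (2 * real l + 1) / (4 * pi)) / Bw b C j"

definition needlet :: "(real \<Rightarrow> real) \<Rightarrow> (nat \<Rightarrow> real^3 \<Rightarrow> 'w \<Rightarrow> real) \<Rightarrow> nat \<Rightarrow> real^3 \<Rightarrow> 'w \<Rightarrow> real" where
  "needlet b f j p \<omega> = (\<Sum>l\<in>lrange j. b (real l / 2 ^ j) * f l p \<omega>)"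

definition nneedlet :: "(real \<Rightarrow> real) \<Rightarrow> (nat \<Rightarrow> real) \<Rightarrow> (nat \<Rightarrow> real^3 \<Rightarrow> 'w \<Rightarrow> real) \<Rightarrow> nat \<Rightarrow> real^3 \<Rightarrow> 'w \<Rightarrow> real" where
  "nneedlet b C f j p \<omega> = needlet b f j p \<omega> / sqrt (Bw b C j)"

(* normalised tangential derivatives at the point sph t s:
   partial_1 = d/dt, partial_2 = (sin t)^-1 d/ds, divided by sqrt A *)
definition nd1 :: "(real \<Rightarrow> real) \<Rightarrow> (nat \<Rightarrow> real) \<Rightarrow> (nat \<Rightarrow> real^3 \<Rightarrow> 'w \<Rightarrow> real) \<Rightarrow> nat \<Rightarrow> real \<Rightarrow> real \<Rightarrow> 'w \<Rightarrow> real" where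
  "nd1 b C f j t s \<omega> = deriv (\<lambda>t'. nneedlet b C f j (sph t' s) \<omega>) t / sqrt (Aw b C j)"

definition nd2 :: "(real \<Rightarrow> real) \<Rightarrow> (nat \<Rightarrow> real) \<Rightarrow> (nat \<Rightarrow> real^3 \<Rightarrow> 'w \<Rightarrow> real) \<Rightarrow> nat \<Rightarrow> real \<Rightarrow> real \<Rightarrow> 'w \<Rightarrow> real" where
  "nd2 b C f j t s \<omega> = deriv (\<lambda>s'. nneedlet b C f j (sph t s') \<omega>) s / sin t / sqrt (Aw b C j)"

(* q-th chaos component of L_j(z); the integral over S^2 is written in
   spherical coordinates with surface element sin t dt ds *)
definition proj_chaos :: "(real \<Rightarrow> real) \<Rightarrow> (nat \<Rightarrow> real) \<Rightarrow> (nat \<Rightarrow> real^3 \<Rightarrow> 'w \<Rightarrow> real) \<Rightarrow> nat \<Rightarrow> real \<Rightarrow> nat \<Rightarrow> 'w \<Rightarrow> real" where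
  "proj_chaos b C f j z q \<omega> = sqrt (Aw b C j) *
     (\<Sum>u = 0..q. \<Sum>k = 0..u.
        alpha k (u - k) * hermite_beta (q - u) z / (fact k * fact (u - k) * fact (q - u)) *
        (LINT y:{0..pi} \<times> {0..2*pi}|lborel.
           hermite (q - u) (nneedlet b C f j (sph (fst y) (snd y)) \<omega>) *
           hermite k (nd1 b C f j (fst y) (snd y) \<omega>) *
           hermite (u - k) (nd2 b C f j (fst y) (snd y) \<omega>) * sin (fst y)))"

definition Ma :: "(real \<Rightarrow> real) \<Rightarrow> real \<Rightarrow> real" where
  "Ma b a = (LBINT x=1/2..2. (b x)^2 * x powr (3 - a)) / (LBINT x=1/2..2. (b x)^2 * x powr (1 - a))"

definition limit_var :: "(real \<Rightarrow> real) \<Rightarrow> real \<Rightarrow> real \<Rightarrow> real" where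
  "limit_var b a z = pi ^ 3 * (std_normal_density z)^2 * Ma b a *
     (1 / (LBINT x=1/2..2. (b x)^2 * x powr (1 - a))^2) *
     (LBINT x=1/2..2. (b x)^4 * x powr (1 - 2*a) * (x^2 / Ma b a + z^2 - 1)^2)"

end

theory Submission
  imports Defs
begin

text \<open>
  The kernel $P_\ell(x\cdot y)$ has finite rank, so a Cholesky factorisation of it writes $f_\ell$,
  almost surely and simultaneously at all points of the sphere, as a finite sum of independent standard
  Gaussian variables times linear combinations of the zonal functions $P_\ell(\cdot\,y)$.
  These are eigenfunctions of the spherical Laplacian; Green's formula therefore makes distinct
  multipoles orthogonal and gives $\int|\nabla f_\ell|^2=\ell(\ell+1)\int f_\ell^2$.
  Hence the first chaos vanishes, and the second is the centred quadratic form
  $\sum_\ell w_\ell\bigl(\int f_\ell^2-\mathrm{E}\int f_\ell^2\bigr)$, with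
  $\mathrm{Var}\int f_\ell^2=2\,C_\ell^2(2\ell+1)$ because $\int P_\ell(x\cdot y)^2\,dx=4\pi/(2\ell+1)$.
  With $\ell=2^jx$ the resulting sums over $\ell$ are Riemann sums on $[1/2,2]$.
\<close>

section \<open>Legendre polynomials\<close>

text \<open>The hypotheses give only characteristic functions of finitely many field values: neither
  coefficients a_lm, nor spherical harmonics, nor an addition formula. The kernel itself replaces
  them. Its positivity is read off from the bound 1 on a characteristic function, its rank is finite
  by the three-term recurrence, and every function that the factorisation produces is a combination
  of kernel columns, hence zonal by construction. Which system arises does not matter: the variance
  sees only the trace and the Hilbert-Schmidt norm of the kernel, and both are computed without
  diagonalising it.

  The chaos components contain derivatives of sample paths, so an identity that holds almost surely
  at each single point is too weak. Path continuity provides one null set for the whole sphere;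
  outside it the computation is deterministic.

  The limit cannot vanish, because x^2 / M_a + z^2 - 1 has at most one zero in [1/2,2], whereas b is
  nonzero at more than one point.\<close>

fun legendre_poly :: "nat \<Rightarrow> real poly" where
  "legendre_poly 0 = 1"
| "legendre_poly (Suc 0) = [:0, 1:]"
| "legendre_poly (Suc (Suc n)) =
     smult (1 / real (n + 2)) (smult (2 * real n + 3) ([:0, 1:] * legendre_poly (Suc n))
       - smult (real (Suc n)) (legendre_poly n))"

text \<open>The polynomial twin of \<open>legendre\<close> makes \<open>pderiv\<close> available and
  turns identities at every point into identities of polynomials.\<close>

lemma poly_legendre_poly: "poly (legendre_poly n) x = legendre n x"
  by (induction n rule: legendre_poly.induct) (simp_all add: field_simps)

abbreviation "legendre_deriv n x \<equiv> poly (pderiv (legendre_poly n)) x"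

lemma legendre_has_derivative:
  "(legendre n has_real_derivative legendre_deriv n x) (at x)"
proof -
  have "legendre n = poly (legendre_poly n)"
    by (simp add: poly_legendre_poly fun_eq_iff)
  thus ?thesis by (simp add: poly_DERIV)
qed

lemma legendre_deriv_Suc_Suc:
  "real (n + 2) * legendre_deriv (Suc (Suc n)) x =
     (2 * real n + 3) * (legendre (Suc n) x + x * legendre_deriv (Suc n) x)
       - real (Suc n) * legendre_deriv n x"
  by (simp add: pderiv_smult pderiv_diff pderiv_mult pderiv_pCons poly_legendre_poly field_simps
      del: of_nat_Suc of_nat_add)

lemma legendre_Suc_Suc:
  "real (n + 2) * legendre (Suc (Suc n)) x =
     (2 * real n + 3) * x * legendre (Suc n) x - real (Suc n) * legendre n x"
  by simp

text \<open>The two identities need each other: the step for the first uses both hypotheses and the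
  differentiated three-term recurrence, and the second then follows with the three-term recurrence
  itself.\<close>

lemma legendre_deriv_recurrences:
  "legendre_deriv (Suc n) x = x * legendre_deriv n x + real (Suc n) * legendre n x"
  "x * legendre_deriv (Suc n) x - legendre_deriv n x = real (Suc n) * legendre (Suc n) x"
proof (induction n)
  case 0
  { case 1 show ?case by (simp add: pderiv_pCons) }
  { case 2 show ?case by (simp add: pderiv_pCons) }
next
  case (Suc n)
  define p q p' q' r r' where "p = legendre n x" and "q = legendre (Suc n) x"
    and "p' = legendre_deriv n x" and "q' = legendre_deriv (Suc n) x"
    and "r = legendre (Suc (Suc n)) x" and "r' = legendre_deriv (Suc (Suc n)) x"
  define m where "m = real n"
  have m: "real (Suc n) = m + 1" "real (n + 2) = m + 2" "real (Suc (Suc n)) = m + 2" "m \<ge> 0"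
    by (simp_all add: m_def)
  have IH: "q' = x * p' + (m + 1) * p" "x * q' - p' = (m + 1) * q"
    using Suc.IH unfolding p_def q_def p'_def q'_def m(1) .
  have r': "(m + 2) * r' = (2 * m + 3) * (q + x * q') - (m + 1) * p'"
    using legendre_deriv_Suc_Suc[of n x]
    unfolding r'_def q'_def q_def p'_def m m_def[symmetric] .
  have r: "(m + 2) * r = (2 * m + 3) * x * q - (m + 1) * p"
    using legendre_Suc_Suc[of n x]
    unfolding r_def q_def p_def m m_def[symmetric] .
  \<comment> \<open>The recurrences determine r' only after multiplication by m + 2; this positive
    factor is cancelled afterwards.\<close>
  have "(m + 2) * r' = (m + 2) * (x * q' + (m + 2) * q)"
    using IH r' by algebra
  hence r1: "r' = x * q' + (m + 2) * q"
    using m by simp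
  have r2: "x * r' - q' = (m + 2) * r"
    using IH r r1 by algebra
  { case 1 show ?case using r1 unfolding m r'_def q'_def q_def . }
  { case 2 show ?case using r2 unfolding m r'_def q'_def r_def . }
qed

lemma legendre_deriv_one_minus_square:
  "(1 - x\<^sup>2) * legendre_deriv (Suc n) x = real (Suc n) * (legendre n x - x * legendre (Suc n) x)"
  using legendre_deriv_recurrences[where n = n and x = x] by algebra

text \<open>For u = p . y with |p| = |y| = 1, the tangential gradient of u has squared length 1 -
  u^2 and the Laplacian of u is -2u. So ((1 - u^2) c(u))' is the spherical divergence of c(u) grad
  u, and c = P' gives the Laplacian of P(p . y).\<close>

definition zonal_div :: "real poly \<Rightarrow> real poly" where
  "zonal_div c = pderiv ([:1, 0, -1:] * c)"



lemma poly_zonal_div: "poly (zonal_div c) x = (1 - x\<^sup>2) * poly (pderiv c) x - 2 * x * poly c x"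
proof -
  have "poly (zonal_div c) x = poly [:1, 0, -1:] x * poly (pderiv c) x
      + poly (pderiv [:1, 0, -1:]) x * poly c x"
    unfolding zonal_div_def pderiv_mult poly_add poly_mult by simp
  thus ?thesis by (simp add: pderiv_pCons power2_eq_square algebra_simps)
qed

text \<open>This is the eigenvalue equation of the spherical Laplacian on zonal functions. The
  first-order identity for (1 - x^2) P_n' is lifted to polynomials and differentiated once.\<close>

lemma legendre_ode:
  "poly (zonal_div (pderiv (legendre_poly n))) x = - (real n * (real n + 1)) * legendre n x"
proof (cases n)
  case 0
  thus ?thesis by (simp add: zonal_div_def)
next
  case (Suc k)
  have "poly ([:1, 0, -1:] * pderiv (legendre_poly n)) y =
      poly (smult (real n) (legendre_poly k - [:0, 1:] * legendre_poly n)) y" for y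
    using legendre_deriv_one_minus_square[of y k]
    by (simp add: Suc poly_legendre_poly power2_eq_square algebra_simps)
  hence "[:1, 0, -1:] * pderiv (legendre_poly n) =
      smult (real n) (legendre_poly k - [:0, 1:] * legendre_poly n)"
    by (simp add: poly_eq_poly_eq_iff[symmetric] fun_eq_iff)
  hence "poly (zonal_div (pderiv (legendre_poly n))) x =
      real n * (legendre_deriv k x - legendre n x - x * legendre_deriv n x)"
    by (simp add: zonal_div_def pderiv_smult pderiv_diff pderiv_mult pderiv_pCons
        poly_legendre_poly algebra_simps)
  also have "legendre_deriv k x - x * legendre_deriv n x = - (real n * legendre n x)"
    using legendre_deriv_recurrences(2)[where n = k and x = x] Suc by simp
  hence "legendre_deriv k x - legendre n x - x * legendre_deriv n x = - (real n + 1) * legendre n x"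
    by (simp add: algebra_simps)
  finally show ?thesis by (simp add: algebra_simps)
qed

lemma legendre_at_one: "legendre n 1 = 1"
  by (induction n rule: legendre_poly.induct) (simp_all add: field_simps)

lemma legendre_at_minus_one: "legendre n (-1) = (-1) ^ n"
  by (induction n rule: legendre_poly.induct) (simp_all add: field_simps)

text \<open>The telescoping primitive comes from
  $(2k+1)P_k^2-(2k-1)P_{k-1}^2=\bigl(u(P_k^2+P_{k-1}^2)-2P_kP_{k-1}\bigr)'$,
  whose right-hand side vanishes at $u=\pm1$ before differentiation.\<close>

lemma legendre_square_eq_zonal_div:
  "\<exists>c. \<forall>x. (2 * real n + 1) * (legendre n x)\<^sup>2 - 1 = poly (zonal_div c) x"
proof -
  have "\<exists>c. \<forall>x. (2 * real n + 1) * (legendre n x)\<^sup>2 - 1 = poly (pderiv ([:1, 0, -1:] * c)) x"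
  proof (induction n)
    case 0
    show ?case by (intro exI[of _ 0]) simp
  next
    case (Suc n)
    then obtain c where c:
      "\<And>x. (2 * real n + 1) * (legendre n x)\<^sup>2 - 1 = poly (pderiv ([:1, 0, -1:] * c)) x"
      by blast
    define P Q where "P = legendre_poly n" and "Q = legendre_poly (Suc n)"
    define A where "A = [:0, 1:] * (Q * Q + P * P) - smult 2 (Q * P)"
    have P1: "poly P 1 = 1" "poly Q 1 = 1" "poly P (-1) = (-1) ^ n" "poly Q (-1) = - ((-1) ^ n)"
      by (simp_all only: P_def Q_def poly_legendre_poly legendre_at_one legendre_at_minus_one
          power_Suc mult_minus1)
    have "((-1) ^ n * (-1) ^ n :: real) = 1" by (simp flip: power_mult_distrib)
    hence A0: "poly A 1 = 0" "poly A (-1) = 0"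
      by (simp_all add: A_def P1)
    then obtain B where B: "A = [:-1, 1:] * B"
      using poly_eq_0_iff_dvd[of A 1] by (auto simp: dvd_def)
    have "poly B (-1) = 0" using A0(2) unfolding B by simp
    then obtain E where E: "B = [:1, 1:] * E"
      using poly_eq_0_iff_dvd[of B "-1"] by (auto simp: dvd_def)
    \<comment> \<open>Both endpoints are roots of \<open>A\<close>; the sign of \<open>E\<close>
      comes from (u - 1)(u + 1) = -(1 - u^2).\<close>
    have AE: "A = [:1, 0, -1:] * (- E)"
      unfolding B E mult.assoc[symmetric] by simp
    have "(2 * real (Suc n) + 1) * (legendre (Suc n) x)\<^sup>2 - 1 =
        poly (pderiv ([:1, 0, -1:] * (c - E))) x" for x
    proof -
      define p q p' q' where "p = legendre n x" and "q = legendre (Suc n) x"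
        and "p' = legendre_deriv n x" and "q' = legendre_deriv (Suc n) x"
      define m where "m = real n"
      have pQ: "poly P x = p" "poly Q x = q" "poly (pderiv P) x = p'" "poly (pderiv Q) x = q'"
        by (simp_all only: P_def Q_def p_def q_def p'_def q'_def poly_legendre_poly)
      have rec: "q' = x * p' + (m + 1) * p" "x * q' - p' = (m + 1) * q"
        using legendre_deriv_recurrences[where n = n and x = x]
        by (simp_all add: p_def q_def p'_def q'_def m_def add.commute)
      have A': "poly (pderiv A) x = q * q + p * p + 2 * x * (q * q' + p * p') - 2 * (q' * p + q * p')"
        by (simp add: A_def pderiv_smult pderiv_diff pderiv_add pderiv_mult pderiv_pCons pQ
            algebra_simps)
      have "[:1, 0, -1:] * (c - E) = [:1, 0, -1:] * c + A"
        unfolding AE by (simp only: algebra_simps)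
      hence "poly (pderiv ([:1, 0, -1:] * (c - E))) x =
          ((2 * m + 1) * p\<^sup>2 - 1) + poly (pderiv A) x"
        by (simp only: pderiv_add poly_add c[symmetric] p_def m_def)
      also have "\<dots> = (2 * (m + 1) + 1) * q\<^sup>2 - 1"
        using rec unfolding A' by algebra
      finally show ?thesis by (simp add: m_def q_def add.commute)
    qed
    thus ?case by blast
  qed
  thus ?thesis by (simp add: zonal_div_def)
qed

section \<open>Integration over the sphere in spherical coordinates\<close>

text \<open>\<open>sph_theta\<close> and \<open>sph_phi\<close> form the orthonormal tangent frame.
  The coordinate derivative in s is sin t times \<open>sph_phi\<close>, which compensates the
  division by sin t in \<open>nd2\<close>.\<close>

definition sph_theta :: "real \<Rightarrow> real \<Rightarrow> real^3" where
  "sph_theta t s = vector [cos t * cos s, cos t * sin s, - sin t]"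

definition sph_phi :: "real \<Rightarrow> real^3" where
  "sph_phi s = vector [- sin s, cos s, 0]"

text \<open>Written over the parameter box as in \<open>proj_chaos\<close> and applied to functions
  on the ambient space, so that no surface measure has to be constructed.\<close>

definition sph_int :: "(real^3 \<Rightarrow> real) \<Rightarrow> real" where
  "sph_int g = (LINT y:{0..pi} \<times> {0..2*pi}|lborel. g (sph (fst y) (snd y)) * sin (fst y))"

lemma inner_3: "(x :: real^3) \<bullet> y = x$1 * y$1 + x$2 * y$2 + x$3 * y$3"
  by (simp add: inner_vec_def sum_3)

lemma sph_nth: "sph t s $ 1 = sin t * cos s" "sph t s $ 2 = sin t * sin s" "sph t s $ 3 = cos t"
  "sph_theta t s $ 1 = cos t * cos s" "sph_theta t s $ 2 = cos t * sin s" "sph_theta t s $ 3 = - sin t"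
  "sph_phi s $ 1 = - sin s" "sph_phi s $ 2 = cos s" "sph_phi s $ 3 = 0"
  by (simp_all add: sph_def sph_theta_def sph_phi_def)

lemma sph_eq: "sph t s = (sin t * cos s) *\<^sub>R axis 1 1 + (sin t * sin s) *\<^sub>R axis 2 1 + cos t *\<^sub>R axis 3 1"
  by (simp add: vec_eq_iff forall_3 sph_nth axis_def)

lemma sph_theta_eq:
  "sph_theta t s = (cos t * cos s) *\<^sub>R axis 1 1 + (cos t * sin s) *\<^sub>R axis 2 1 + (- sin t) *\<^sub>R axis 3 1"
  by (simp add: vec_eq_iff forall_3 sph_nth axis_def)

lemma sph_phi_eq: "sph_phi s = (- sin s) *\<^sub>R axis 1 1 + cos s *\<^sub>R axis 2 1"
  by (simp add: vec_eq_iff forall_3 sph_nth axis_def)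

lemma sph_in_sphere: "sph t s \<in> sphere 0 1"
proof -
  have "(sin t * cos s)\<^sup>2 + (sin t * sin s)\<^sup>2 + (cos t)\<^sup>2 = 1"
    using sin_cos_squared_add[of t] sin_cos_squared_add[of s] by algebra
  thus ?thesis
    by (simp add: norm_eq_sqrt_inner inner_3 sph_nth power2_eq_square)
qed

lemma continuous_on_sph [continuous_intros]:
  fixes f g :: "'a::t2_space \<Rightarrow> real"
  assumes "continuous_on A f" "continuous_on A g"
  shows "continuous_on A (\<lambda>x. sph (f x) (g x))"
  unfolding sph_eq by (intro continuous_intros assms)

lemma continuous_on_sph_theta [continuous_intros]:
  fixes f g :: "'a::t2_space \<Rightarrow> real"
  assumes "continuous_on A f" "continuous_on A g"
  shows "continuous_on A (\<lambda>x. sph_theta (f x) (g x))"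
  unfolding sph_theta_eq by (intro continuous_intros assms)

lemma continuous_on_sph_phi [continuous_intros]:
  fixes g :: "'a::t2_space \<Rightarrow> real"
  assumes "continuous_on A g"
  shows "continuous_on A (\<lambda>x. sph_phi (g x))"
  unfolding sph_phi_eq by (intro continuous_intros assms)

lemma sph_has_vector_derivative:
  "((\<lambda>t. sph t s) has_vector_derivative sph_theta t s) (at t)"
  "((\<lambda>s. sph t s) has_vector_derivative sin t *\<^sub>R sph_phi s) (at s)"
  unfolding sph_eq sph_theta_eq sph_phi_eq
  by (auto intro!: derivative_eq_intros simp: algebra_simps)

text \<open>Parseval in the orthonormal basis \<open>sph_theta\<close>, \<open>sph_phi\<close>,
  \<open>sph\<close>, with the radial product moved to the right. It makes sums over both tangent
  directions independent of the frame.\<close>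

lemma sph_frame_inner:
  "(x \<bullet> sph_theta t s) * (y \<bullet> sph_theta t s) + (x \<bullet> sph_phi s) * (y \<bullet> sph_phi s)
     = x \<bullet> y - (x \<bullet> sph t s) * (y \<bullet> sph t s)"
proof -
  have "(sin t)\<^sup>2 + (cos t)\<^sup>2 = 1" "(sin s)\<^sup>2 + (cos s)\<^sup>2 = 1" by simp_all
  thus ?thesis
    unfolding inner_3 sph_nth by algebra
qed

lemma continuous_set_integrable_box:
  fixes F :: "real \<times> real \<Rightarrow> real"
  assumes "continuous_on UNIV F"
  shows "set_integrable lborel ({0..pi} \<times> {0..2*pi}) F"
  unfolding set_integrable_def
  by (intro borel_integrable_compact compact_Times compact_Icc continuous_on_subset[OF assms]) auto

lemma sph_integrable:
  assumes "continuous_on UNIV g"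
  shows "set_integrable lborel ({0..pi} \<times> {0..2*pi}) (\<lambda>y. g (sph (fst y) (snd y)) * sin (fst y))"
  by (intro continuous_set_integrable_box continuous_intros continuous_on_compose2[OF assms]) auto

lemma sph_int_add:
  assumes "continuous_on UNIV g" "continuous_on UNIV h"
  shows "sph_int (\<lambda>p. g p + h p) = sph_int g + sph_int h"
  unfolding sph_int_def distrib_right
  by (rule set_integral_add) (intro sph_integrable assms)+

lemma sph_int_cmult: "sph_int (\<lambda>p. c * g p) = c * sph_int g"
  unfolding sph_int_def mult.assoc by (rule set_integral_mult_right)

lemma sph_int_sum:
  assumes "finite I" "\<And>i. i \<in> I \<Longrightarrow> continuous_on UNIV (g i)"
  shows "sph_int (\<lambda>p. \<Sum>i\<in>I. g i p) = (\<Sum>i\<in>I. sph_int (g i))"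
  using assms
proof (induction I rule: finite_induct)
  case empty
  show ?case by (simp add: sph_int_def)
next
  case (insert i I)
  have "continuous_on UNIV (\<lambda>p. \<Sum>i\<in>I. g i p)"
    using insert.prems by (intro continuous_on_sum) auto
  thus ?case using insert by (simp add: sph_int_add)
qed

lemma sph_int_cong_sphere:
  assumes "\<And>p. p \<in> sphere 0 1 \<Longrightarrow> g p = h p"
  shows "sph_int g = sph_int h"
  unfolding sph_int_def using assms[OF sph_in_sphere] by simp

text \<open>The divergence theorem on the parameter rectangle. Equal values on opposite sides
  suffice: this fits a flux that vanishes at both poles and a periodic longitude.\<close>

lemma box_integral_divergence:
  fixes U V U' V' :: "real \<Rightarrow> real \<Rightarrow> real"
  assumes U: "\<And>t s. ((\<lambda>t. U t s) has_real_derivative U' t s) (at t)"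
    and V: "\<And>t s. ((\<lambda>s. V t s) has_real_derivative V' t s) (at s)"
    and cont: "continuous_on UNIV (\<lambda>y. U' (fst y) (snd y))" "continuous_on UNIV (\<lambda>y. V' (fst y) (snd y))"
    and bound: "\<And>s. U pi s = U 0 s" "\<And>t. V t (2*pi) = V t 0"
  shows "(LINT y:{0..pi} \<times> {0..2*pi}|lborel. U' (fst y) (snd y) + V' (fst y) (snd y)) = 0"
proof -
  have box: "{0..pi} \<times> {0..2*pi} = cbox (0, 0) (pi, 2*pi)"
    by (simp add: cbox_Pair_eq)
  have IU: "integral {0..pi} (\<lambda>t. U' t s) = 0" for s
    using fundamental_theorem_of_calculus[of 0 pi "\<lambda>t. U t s" "\<lambda>t. U' t s"] U bound(1)
    by (auto simp: has_real_derivative_iff_has_vector_derivative has_vector_derivative_at_within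
        intro!: integral_unique)
  have IV: "integral {0..2*pi} (\<lambda>s. V' t s) = 0" for t
    using fundamental_theorem_of_calculus[of 0 "2*pi" "\<lambda>s. V t s" "\<lambda>s. V' t s"] V bound(2)
    by (auto simp: has_real_derivative_iff_has_vector_derivative has_vector_derivative_at_within
        intro!: integral_unique)
  have contU: "continuous_on (cbox (0, 0) (pi, 2*pi)) (\<lambda>(t, s). U' t s)"
    using continuous_on_subset[OF cont(1)] by (simp add: case_prod_unfold)
  have "(LINT y:{0..pi} \<times> {0..2*pi}|lborel. U' (fst y) (snd y)) =
      integral (cbox (0, 0) (pi, 2*pi)) (\<lambda>y. U' (fst y) (snd y))"
    unfolding box[symmetric]
    by (intro set_borel_integral_eq_integral continuous_set_integrable_box cont)
  also have "\<dots> = integral (cbox 0 pi) (\<lambda>t. integral (cbox 0 (2*pi)) (U' t))"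
    using integral_prod_continuous[OF contU] by (simp add: case_prod_unfold)
  also have "\<dots> = 0"
    unfolding integral_swap_continuous[OF contU] by (simp add: IU)
  finally have 1: "(LINT y:{0..pi} \<times> {0..2*pi}|lborel. U' (fst y) (snd y)) = 0" .
  have "(LINT y:{0..pi} \<times> {0..2*pi}|lborel. V' (fst y) (snd y)) =
      integral (cbox (0, 0) (pi, 2*pi)) (\<lambda>y. V' (fst y) (snd y))"
    unfolding box[symmetric]
    by (intro set_borel_integral_eq_integral continuous_set_integrable_box cont)
  also have "\<dots> = integral (cbox 0 pi) (\<lambda>t. integral (cbox 0 (2*pi)) (V' t))"
    by (subst integral_prod_continuous) (auto intro: continuous_on_subset[OF cont(2)])
  also have "\<dots> = 0"
    by (simp add: IV)
  finally have 2: "(LINT y:{0..pi} \<times> {0..2*pi}|lborel. V' (fst y) (snd y)) = 0" .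
  show ?thesis
    by (subst set_integral_add) (use 1 2 in \<open>auto intro!: continuous_set_integrable_box cont\<close>)
qed

lemma sph_int_one: "sph_int (\<lambda>p. 1) = 4 * pi"
proof -
  have box: "{0..pi} \<times> {0..2*pi} = cbox (0, 0) (pi, 2*pi)"
    by (simp add: cbox_Pair_eq)
  have "((\<lambda>t. 2 * pi * sin t) has_integral (- 2 * pi * cos pi) - (- 2 * pi * cos 0)) {0..pi}"
    by (rule fundamental_theorem_of_calculus)
      (auto intro!: derivative_eq_intros
        simp flip: has_real_derivative_iff_has_vector_derivative)
  hence I: "integral {0..pi} (\<lambda>t. 2 * pi * sin t) = 4 * pi"
    by (simp add: integral_unique)
  have "sph_int (\<lambda>p. 1) = integral (cbox (0, 0) (pi, 2*pi)) (\<lambda>y. sin (fst y))"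
    unfolding sph_int_def box[symmetric] mult_1
    by (intro set_borel_integral_eq_integral continuous_set_integrable_box continuous_intros)
  also have "\<dots> = integral (cbox 0 pi) (\<lambda>t. integral (cbox 0 (2*pi)) (\<lambda>s. sin t))"
    by (subst integral_prod_continuous) (auto intro!: continuous_intros)
  finally show ?thesis by (simp add: I)
qed

text \<open>In the coordinates \<open>(t, s)\<close> the integrand is
  $\partial_t\bigl(\sin t\,g\,\chi\,(y\cdot e_\theta)\bigr)+\partial_s\bigl(g\,\chi\,(y\cdot e_\varphi)\bigr)$
  with $g=\psi(p\cdot x)$ and $\chi=\chi(p\cdot y)$.\<close>

lemma sph_green_zonal:
  fixes q c :: "real poly" and x y :: "real^3"
  assumes y: "norm y = 1"
  shows "sph_int (\<lambda>p. poly q (p \<bullet> x) * poly (zonal_div c) (p \<bullet> y)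
      + poly (pderiv q) (p \<bullet> x) * poly c (p \<bullet> y) * (x \<bullet> y - (x \<bullet> p) * (y \<bullet> p))) = 0"
proof -
  define U where "U = (\<lambda>t s. sin t * poly q (sph t s \<bullet> x) * poly c (sph t s \<bullet> y) * (sph_theta t s \<bullet> y))"
  define V where "V = (\<lambda>t s. poly q (sph t s \<bullet> x) * poly c (sph t s \<bullet> y) * (sph_phi s \<bullet> y))"
  define U' where "U' = (\<lambda>t s. cos t * poly q (sph t s \<bullet> x) * poly c (sph t s \<bullet> y) * (sph_theta t s \<bullet> y)
      + sin t * (poly (pderiv q) (sph t s \<bullet> x) * (sph_theta t s \<bullet> x)) * poly c (sph t s \<bullet> y) * (sph_theta t s \<bullet> y)
      + sin t * poly q (sph t s \<bullet> x) * (poly (pderiv c) (sph t s \<bullet> y) * (sph_theta t s \<bullet> y)) * (sph_theta t s \<bullet> y)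
      - sin t * poly q (sph t s \<bullet> x) * poly c (sph t s \<bullet> y) * (sph t s \<bullet> y))"
  define V' where "V' = (\<lambda>t s. (poly (pderiv q) (sph t s \<bullet> x) * (sin t * (sph_phi s \<bullet> x))) * poly c (sph t s \<bullet> y) * (sph_phi s \<bullet> y)
      + poly q (sph t s \<bullet> x) * (poly (pderiv c) (sph t s \<bullet> y) * (sin t * (sph_phi s \<bullet> y))) * (sph_phi s \<bullet> y)
      - poly q (sph t s \<bullet> x) * poly c (sph t s \<bullet> y) * (sin t * (sph t s \<bullet> y) + cos t * (sph_theta t s \<bullet> y)))"
  have d_t: "((\<lambda>t. sph t s \<bullet> w) has_real_derivative (sph_theta t s \<bullet> w)) (at t)" for t s w
    unfolding inner_3 sph_nth by (auto intro!: derivative_eq_intros simp: algebra_simps)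
  have d_tt: "((\<lambda>t. sph_theta t s \<bullet> w) has_real_derivative (- (sph t s \<bullet> w))) (at t)" for t s w
    unfolding inner_3 sph_nth by (auto intro!: derivative_eq_intros simp: algebra_simps)
  have d_s: "((\<lambda>s. sph t s \<bullet> w) has_real_derivative sin t * (sph_phi s \<bullet> w)) (at s)" for t s w
    unfolding inner_3 sph_nth by (auto intro!: derivative_eq_intros simp: algebra_simps)
  \<comment> \<open>The derivative of e_phi is -(cos s, sin s, 0), which does not depend on t.
    Expressed through \<open>sph\<close> and \<open>sph_theta\<close> at colatitude t, it has a cos
    t part that cancels the derivative of sin t in \<open>U'\<close>.\<close>
  have d_ss: "((\<lambda>s. sph_phi s \<bullet> w) has_real_derivative
      - (sin t * (sph t s \<bullet> w) + cos t * (sph_theta t s \<bullet> w))) (at s)" for t s w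
  proof -
    have "sin t * (sph t s \<bullet> w) + cos t * (sph_theta t s \<bullet> w) = cos s * w$1 + sin s * w$2"
      using sin_cos_squared_add[of t] unfolding inner_3 sph_nth by algebra
    thus ?thesis
      unfolding inner_3 sph_nth by (auto intro!: derivative_eq_intros simp: algebra_simps)
  qed
  note poly_d = DERIV_chain2[OF poly_DERIV]
  have contp: "continuous_on UNIV (\<lambda>y. poly r (sph (fst y) (snd y) \<bullet> w))" for r w
    by (intro continuous_intros)
  have U: "((\<lambda>t. U t s) has_real_derivative U' t s) (at t)" for t s
    unfolding U_def U'_def
    by (rule derivative_eq_intros poly_d[OF d_t] d_tt refl)+ (simp add: algebra_simps)
  have V: "((\<lambda>s. V t s) has_real_derivative V' t s) (at s)" for t s
    unfolding V_def V'_def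
    by (rule derivative_eq_intros poly_d[OF d_s] d_ss[of _ t] refl)+ (simp add: algebra_simps)
  have "(LINT y:{0..pi} \<times> {0..2*pi}|lborel. U' (fst y) (snd y) + V' (fst y) (snd y)) = 0"
  proof (rule box_integral_divergence[OF U V])
    show "continuous_on UNIV (\<lambda>y. U' (fst y) (snd y))" "continuous_on UNIV (\<lambda>y. V' (fst y) (snd y))"
      unfolding U'_def V'_def by (intro continuous_intros contp)+
    \<comment> \<open>\<open>U\<close> carries the factor sin t, which vanishes at both poles;
      \<open>V\<close> is periodic in s.\<close>
    show "U pi s = U 0 s" "V t (2*pi) = V t 0" for t s
      by (simp_all add: U_def V_def sph_def sph_phi_def)
  qed
  moreover have "U' t s + V' t s = (poly q (sph t s \<bullet> x) * poly (zonal_div c) (sph t s \<bullet> y)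
      + poly (pderiv q) (sph t s \<bullet> x) * poly c (sph t s \<bullet> y)
        * (x \<bullet> y - (x \<bullet> sph t s) * (y \<bullet> sph t s))) * sin t" for t s
  proof -
    have 1: "(sph_theta t s \<bullet> y) * (sph_theta t s \<bullet> y) + (sph_phi s \<bullet> y) * (sph_phi s \<bullet> y)
        = 1 - (sph t s \<bullet> y)\<^sup>2"
      using sph_frame_inner[of y t s y] y
      by (simp add: inner_commute power2_eq_square norm_eq_1)
    have 2: "(sph_theta t s \<bullet> x) * (sph_theta t s \<bullet> y) + (sph_phi s \<bullet> x) * (sph_phi s \<bullet> y)
        = x \<bullet> y - (x \<bullet> sph t s) * (y \<bullet> sph t s)"
      using sph_frame_inner[of x t s y] by (simp add: inner_commute)
    show ?thesis
      unfolding U'_def V'_def poly_zonal_div 1[symmetric] 2[symmetric]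
      by (simp add: algebra_simps)
  qed
  ultimately show ?thesis
    unfolding sph_int_def by simp
qed

text \<open>The centred square is the divergence of a zonal field and integrates to zero, so only
  the constant 1 on a sphere of area 4 pi remains. This is Green's formula with constant q, where
  the gradient term is absent.\<close>

lemma sph_int_legendre_square:
  assumes "norm y = 1"
  shows "sph_int (\<lambda>p. (legendre l (p \<bullet> y))\<^sup>2) = 4 * pi / (2 * real l + 1)"
proof -
  obtain c where c: "\<And>x. (2 * real l + 1) * (legendre l x)\<^sup>2 - 1 = poly (zonal_div c) x"
    using legendre_square_eq_zonal_div by blast
  have "0 = sph_int (\<lambda>p. poly (zonal_div c) (p \<bullet> y))"
    using sph_green_zonal[OF assms, of 1 0 c] by simp
  also have "\<dots> = sph_int (\<lambda>p. (2 * real l + 1) * (legendre l (p \<bullet> y))\<^sup>2 + (- 1) * 1)"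
    unfolding c[symmetric] by simp
  also have "\<dots> = (2 * real l + 1) * sph_int (\<lambda>p. (legendre l (p \<bullet> y))\<^sup>2) - 4 * pi"
    unfolding poly_legendre_poly[symmetric]
    by (subst sph_int_add)
      (auto simp only: sph_int_cmult sph_int_one intro!: continuous_intros)
  finally show ?thesis by (simp add: field_simps)
qed

section \<open>Zonal functions\<close>

text \<open>The poles y have norm 1, as Green's formula requires. \<open>G\<close> is the gradient
  in R^3; away from the sphere \<open>h\<close> is merely one smooth extension, and only the
  tangential part of \<open>G\<close> will matter.\<close>

definition zonal :: "nat \<Rightarrow> (real^3 \<Rightarrow> real) \<Rightarrow> (real^3 \<Rightarrow> real^3) \<Rightarrow> bool" where
  "zonal l h G \<longleftrightarrow> (\<exists>T w. finite T \<and> T \<subseteq> sphere 0 1 \<and>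
     h = (\<lambda>p. \<Sum>y\<in>T. w y * legendre l (p \<bullet> y)) \<and>
     G = (\<lambda>p. \<Sum>y\<in>T. (w y * legendre_deriv l (p \<bullet> y)) *\<^sub>R y))"

lemma zonal_zero: "zonal l (\<lambda>p. 0) (\<lambda>p. 0)"
  unfolding zonal_def by (intro exI[of _ "{}"]) simp

text \<open>The constant as the harmonic of degree 0: orthogonality to it gives mean zero in
  positive degree.\<close>

lemma zonal_const: "zonal 0 (\<lambda>p. 1) (\<lambda>p. 0)"
  unfolding zonal_def
  by (intro exI[of _ "{axis 1 1}"] exI[of _ "\<lambda>_. 1"]) simp

lemma zonal_add:
  assumes "zonal l h G" "zonal l h' G'"
  shows "zonal l (\<lambda>p. h p + h' p) (\<lambda>p. G p + G' p)"
proof -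
  obtain T w where T: "finite T" "T \<subseteq> sphere 0 1" "h = (\<lambda>p. \<Sum>y\<in>T. w y * legendre l (p \<bullet> y))"
    "G = (\<lambda>p. \<Sum>y\<in>T. (w y * legendre_deriv l (p \<bullet> y)) *\<^sub>R y)"
    using assms(1) unfolding zonal_def by blast
  obtain T' w' where T': "finite T'" "T' \<subseteq> sphere 0 1" "h' = (\<lambda>p. \<Sum>y\<in>T'. w' y * legendre l (p \<bullet> y))"
    "G' = (\<lambda>p. \<Sum>y\<in>T'. (w' y * legendre_deriv l (p \<bullet> y)) *\<^sub>R y)"
    using assms(2) unfolding zonal_def by blast
  define v where "v y = (if y \<in> T then w y else 0) + (if y \<in> T' then w' y else 0)" for y
  have ext: "(\<Sum>y\<in>A. r y *\<^sub>R k y) = (\<Sum>y\<in>T \<union> T'. (if y \<in> A then r y else 0) *\<^sub>R k y)"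
    if "A \<subseteq> T \<union> T'" for A :: "(real^3) set" and r :: "real^3 \<Rightarrow> real" and k :: "real^3 \<Rightarrow> 'b::real_vector"
    using that T(1) T'(1) by (intro sum.mono_neutral_cong_left) auto
  have v: "(\<Sum>y\<in>T. w y *\<^sub>R k y) + (\<Sum>y\<in>T'. w' y *\<^sub>R k y) = (\<Sum>y\<in>T \<union> T'. v y *\<^sub>R k y)"
    for k :: "real^3 \<Rightarrow> 'b::real_vector"
    by (subst (1 2) ext) (auto simp: v_def scaleR_left_distrib sum.distrib)
  have "h p + h' p = (\<Sum>y\<in>T \<union> T'. v y * legendre l (p \<bullet> y))" for p
    using v[of "\<lambda>y. legendre l (p \<bullet> y)"] T(3) T'(3) by simp
  moreover have "G p + G' p = (\<Sum>y\<in>T \<union> T'. (v y * legendre_deriv l (p \<bullet> y)) *\<^sub>R y)" for p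
    using v[of "\<lambda>y. legendre_deriv l (p \<bullet> y) *\<^sub>R y"] T(4) T'(4) by simp
  ultimately show ?thesis
    unfolding zonal_def using T(1,2) T'(1,2)
    by (intro exI[of _ "T \<union> T'"] exI[of _ v]) auto
qed

lemma zonal_cmult:
  assumes "zonal l h G"
  shows "zonal l (\<lambda>p. c * h p) (\<lambda>p. c *\<^sub>R G p)"
proof -
  obtain T w where T: "finite T" "T \<subseteq> sphere 0 1" "h = (\<lambda>p. \<Sum>y\<in>T. w y * legendre l (p \<bullet> y))"
    "G = (\<lambda>p. \<Sum>y\<in>T. (w y * legendre_deriv l (p \<bullet> y)) *\<^sub>R y)"
    using assms unfolding zonal_def by blast
  show ?thesis
    unfolding zonal_def using T
    by (intro exI[of _ T] exI[of _ "\<lambda>y. c * w y"])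
      (auto simp: sum_distrib_left scaleR_sum_right mult.assoc)
qed

lemma zonal_sum:
  assumes "\<And>i. i \<in> I \<Longrightarrow> zonal l (h i) (G i)"
  shows "zonal l (\<lambda>p. \<Sum>i\<in>I. c i * h i p) (\<lambda>p. \<Sum>i\<in>I. c i *\<^sub>R G i p)"
  using assms
proof (induction I rule: infinite_finite_induct)
  case (insert i I)
  thus ?case using zonal_add[OF zonal_cmult] by simp
qed (simp_all add: zonal_zero)

lemma zonal_has_derivative:
  assumes "zonal l h G"
  shows "(h has_derivative (\<lambda>v. G p \<bullet> v)) (at p)"
proof -
  obtain T w where T: "h = (\<lambda>p. \<Sum>y\<in>T. w y * legendre l (p \<bullet> y))"
    "G = (\<lambda>p. \<Sum>y\<in>T. (w y * legendre_deriv l (p \<bullet> y)) *\<^sub>R y)"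
    using assms unfolding zonal_def by blast
  have "((\<lambda>p. legendre l (p \<bullet> y)) has_derivative (\<lambda>v. (v \<bullet> y) * legendre_deriv l (p \<bullet> y))) (at p)" for y
    by (rule DERIV_compose_FDERIV[OF legendre_has_derivative]) (auto intro!: derivative_eq_intros)
  hence "(h has_derivative (\<lambda>v. \<Sum>y\<in>T. w y * ((v \<bullet> y) * legendre_deriv l (p \<bullet> y)))) (at p)"
    unfolding T by (intro has_derivative_sum has_derivative_mult_right)
  also have "(\<lambda>v. \<Sum>y\<in>T. w y * ((v \<bullet> y) * legendre_deriv l (p \<bullet> y))) = (\<lambda>v. G p \<bullet> v)"
    unfolding T inner_sum_left inner_scaleR_left
    by (intro ext sum.cong refl) (simp add: inner_commute)
  finally show ?thesis .
qed

lemma zonal_continuous: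
  assumes "zonal l h G"
  shows "continuous_on A h" "continuous_on A G"
  using assms unfolding zonal_def poly_legendre_poly[symmetric]
  by (auto intro!: continuous_intros)

text \<open>\<open>sph_dirichlet\<close> is the inner product of the tangential parts of two ambient gradients.\<close>

definition sph_dirichlet :: "(real^3 \<Rightarrow> real^3) \<Rightarrow> (real^3 \<Rightarrow> real^3) \<Rightarrow> real^3 \<Rightarrow> real" where
  "sph_dirichlet G G' p = G p \<bullet> G' p - (G p \<bullet> p) * (G' p \<bullet> p)"

lemma sph_dirichlet_sum:
  "sph_dirichlet (\<lambda>p. \<Sum>x\<in>T. a x p *\<^sub>R u x p) (\<lambda>p. \<Sum>y\<in>T'. b y p *\<^sub>R v y p) p =
     (\<Sum>x\<in>T. \<Sum>y\<in>T'. (a x p * b y p) * sph_dirichlet (u x) (v y) p)"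
  unfolding sph_dirichlet_def inner_sum_left
  unfolding inner_sum_right sum_product sum_subtractf[symmetric]
  by (intro sum.cong refl) (simp add: algebra_simps)

text \<open>Green's formula with q the Legendre polynomial of degree l and c the derivative of the
  one of degree l', extended bilinearly. The eigenvalue comes from the second factor alone although
  the left side is symmetric; this asymmetry yields orthogonality.\<close>

lemma zonal_green:
  assumes "zonal l h G" "zonal l' h' G'"
  shows "sph_int (sph_dirichlet G G') = real l' * (real l' + 1) * sph_int (\<lambda>p. h p * h' p)"
proof -
  obtain T w where T: "finite T" "T \<subseteq> sphere 0 1" "h = (\<lambda>p. \<Sum>y\<in>T. w y * legendre l (p \<bullet> y))"
    "G = (\<lambda>p. \<Sum>y\<in>T. (w y * legendre_deriv l (p \<bullet> y)) *\<^sub>R y)"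
    using assms(1) unfolding zonal_def by blast
  obtain T' w' where T': "finite T'" "T' \<subseteq> sphere 0 1" "h' = (\<lambda>p. \<Sum>y\<in>T'. w' y * legendre l' (p \<bullet> y))"
    "G' = (\<lambda>p. \<Sum>y\<in>T'. (w' y * legendre_deriv l' (p \<bullet> y)) *\<^sub>R y)"
    using assms(2) unfolding zonal_def by blast
  define g where "g x y p = legendre_deriv l (p \<bullet> x) * legendre_deriv l' (p \<bullet> y) *
      (x \<bullet> y - (x \<bullet> p) * (y \<bullet> p))" for x y p :: "real^3"
  define k where "k x y p = legendre l (p \<bullet> x) * legendre l' (p \<bullet> y)" for x y p :: "real^3"
  have cont: "continuous_on UNIV (\<lambda>p. c * g x y p)" "continuous_on UNIV (\<lambda>p. c * k x y p)" for x y c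
    unfolding g_def k_def poly_legendre_poly[symmetric] by (intro continuous_intros)+
  have gk: "sph_int (g x y) = real l' * (real l' + 1) * sph_int (k x y)" if "y \<in> T'" for x y
  proof -
    have "norm y = 1" using that T'(2) by auto
    from sph_green_zonal[OF this, of "legendre_poly l" x "pderiv (legendre_poly l')"]
    have "0 = sph_int (\<lambda>p. (- (real l' * (real l' + 1))) * k x y p + 1 * g x y p)"
      unfolding g_def k_def legendre_ode poly_legendre_poly by (simp add: mult_ac)
    also have "\<dots> = (- (real l' * (real l' + 1))) * sph_int (k x y) + 1 * sph_int (g x y)"
      unfolding sph_int_add[OF cont(2,1)] sph_int_cmult ..
    finally show ?thesis by simp
  qed
  have "sph_dirichlet G G' p = (\<Sum>x\<in>T. \<Sum>y\<in>T'. (w x * w' y) * g x y p)" for p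
    unfolding T T' g_def sph_dirichlet_sum
    by (intro sum.cong refl) (simp add: sph_dirichlet_def)
  hence "sph_int (sph_dirichlet G G') = sph_int (\<lambda>p. \<Sum>x\<in>T. \<Sum>y\<in>T'. (w x * w' y) * g x y p)"
    by presburger
  also have "\<dots> = (\<Sum>x\<in>T. \<Sum>y\<in>T'. (w x * w' y) * sph_int (g x y))"
    using T(1) T'(1) by (simp add: sph_int_sum sph_int_cmult cont continuous_on_sum)
  also have "\<dots> = real l' * (real l' + 1) * (\<Sum>x\<in>T. \<Sum>y\<in>T'. (w x * w' y) * sph_int (k x y))"
    by (simp add: gk sum_distrib_left mult_ac)
  also have "(\<Sum>x\<in>T. \<Sum>y\<in>T'. (w x * w' y) * sph_int (k x y)) =
      sph_int (\<lambda>p. \<Sum>x\<in>T. \<Sum>y\<in>T'. (w x * w' y) * k x y p)"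
    using T(1) T'(1) by (simp add: sph_int_sum sph_int_cmult cont continuous_on_sum)
  also have "(\<lambda>p. \<Sum>x\<in>T. \<Sum>y\<in>T'. (w x * w' y) * k x y p) = (\<lambda>p. h p * h' p)"
    unfolding T T' k_def sum_product by (intro ext sum.cong refl) simp
  finally show ?thesis .
qed

text \<open>The Dirichlet form is symmetric, so both eigenvalues multiply the same integral, and
  they differ: l'(l'+1) - l(l+1) = (l' - l)(l' + l + 1).\<close>

lemma zonal_orthogonal:
  assumes "zonal l h G" "zonal l' h' G'" "l \<noteq> l'"
  shows "sph_int (\<lambda>p. h p * h' p) = 0"
proof -
  have "real l' * (real l' + 1) * sph_int (\<lambda>p. h p * h' p) =
      real l * (real l + 1) * sph_int (\<lambda>p. h' p * h p)"
    using zonal_green[OF assms(1,2)] zonal_green[OF assms(2,1)]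
    by (simp add: sph_dirichlet_def[abs_def] inner_commute mult.commute)
  hence "(real l' - real l) * (real l' + real l + 1) * sph_int (\<lambda>p. h p * h' p) = 0"
    by (simp add: mult.commute[of "h' _"] algebra_simps)
  moreover have "real l' - real l \<noteq> 0" "real l' + real l + 1 \<noteq> 0"
    using assms(3) by linarith+
  ultimately show ?thesis by simp
qed

lemma zonal_mean_zero:
  assumes "zonal l h G" "l \<ge> 1"
  shows "sph_int h = 0"
  using zonal_orthogonal[OF assms(1) zonal_const] assms(2) by simp

text \<open>Pythagoras for the field and for its tangential gradient: cross terms between degrees
  vanish in both, the second time because the Dirichlet form is a multiple of the inner
  product.\<close>

lemma zonal_expansion_energy:
  assumes "finite L" "\<And>l. l \<in> L \<Longrightarrow> zonal l (h l) (G l)"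
  shows "sph_int (\<lambda>p. (\<Sum>l\<in>L. c l * h l p)\<^sup>2) = (\<Sum>l\<in>L. (c l)\<^sup>2 * sph_int (\<lambda>p. (h l p)\<^sup>2))"
    and "sph_int (sph_dirichlet (\<lambda>p. \<Sum>l\<in>L. c l *\<^sub>R G l p) (\<lambda>p. \<Sum>l\<in>L. c l *\<^sub>R G l p)) =
      (\<Sum>l\<in>L. (c l)\<^sup>2 * (real l * (real l + 1)) * sph_int (\<lambda>p. (h l p)\<^sup>2))"
proof -
  have cont: "continuous_on UNIV (\<lambda>p. a * (h l p * h k p))"
    "continuous_on UNIV (\<lambda>p. a * sph_dirichlet (G l) (G k) p)" if "l \<in> L" "k \<in> L" for a l k
    unfolding sph_dirichlet_def
    by (intro continuous_intros zonal_continuous[OF assms(2)] that)+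
  have orth: "sph_int (\<lambda>p. h l p * h k p) = (if l = k then sph_int (\<lambda>p. (h l p)\<^sup>2) else 0)"
    if "l \<in> L" "k \<in> L" for l k
    using zonal_orthogonal[OF assms(2) assms(2)] that by (auto simp: power2_eq_square)
  have orth': "sph_int (sph_dirichlet (G l) (G k)) =
      (if l = k then real l * (real l + 1) * sph_int (\<lambda>p. (h l p)\<^sup>2) else 0)"
    if "l \<in> L" "k \<in> L" for l k
    unfolding zonal_green[OF assms(2)[OF that(1)] assms(2)[OF that(2)]] orth[OF that] by simp
  have "(\<lambda>p. (\<Sum>l\<in>L. c l * h l p)\<^sup>2) = (\<lambda>p. \<Sum>l\<in>L. \<Sum>k\<in>L. (c l * c k) * (h l p * h k p))"
    unfolding power2_eq_square sum_product by (intro ext sum.cong refl) simp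
  hence "sph_int (\<lambda>p. (\<Sum>l\<in>L. c l * h l p)\<^sup>2) = (\<Sum>l\<in>L. \<Sum>k\<in>L. (c l * c k) * sph_int (\<lambda>p. h l p * h k p))"
    using assms(1) by (simp add: sph_int_sum sph_int_cmult cont continuous_on_sum)
  also have "\<dots> = (\<Sum>l\<in>L. \<Sum>k\<in>L. if l = k then (c l)\<^sup>2 * sph_int (\<lambda>p. (h l p)\<^sup>2) else 0)"
    by (intro sum.cong refl) (simp add: orth power2_eq_square[of "c _"])
  finally show "sph_int (\<lambda>p. (\<Sum>l\<in>L. c l * h l p)\<^sup>2) = (\<Sum>l\<in>L. (c l)\<^sup>2 * sph_int (\<lambda>p. (h l p)\<^sup>2))"
    using assms(1) by simp
  have "sph_dirichlet (\<lambda>p. \<Sum>l\<in>L. c l *\<^sub>R G l p) (\<lambda>p. \<Sum>l\<in>L. c l *\<^sub>R G l p) =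
      (\<lambda>p. \<Sum>l\<in>L. \<Sum>k\<in>L. (c l * c k) * sph_dirichlet (G l) (G k) p)"
    by (intro ext sph_dirichlet_sum)
  hence "sph_int (sph_dirichlet (\<lambda>p. \<Sum>l\<in>L. c l *\<^sub>R G l p) (\<lambda>p. \<Sum>l\<in>L. c l *\<^sub>R G l p)) =
      (\<Sum>l\<in>L. \<Sum>k\<in>L. (c l * c k) * sph_int (sph_dirichlet (G l) (G k)))"
    using assms(1) by (simp add: sph_int_sum sph_int_cmult cont continuous_on_sum)
  also have "\<dots> = (\<Sum>l\<in>L. \<Sum>k\<in>L. if l = k then (c l)\<^sup>2 * (real l * (real l + 1)) * sph_int (\<lambda>p. (h l p)\<^sup>2) else 0)"
    by (intro sum.cong refl) (simp add: orth' power2_eq_square[of "c _"])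
  finally show "sph_int (sph_dirichlet (\<lambda>p. \<Sum>l\<in>L. c l *\<^sub>R G l p) (\<lambda>p. \<Sum>l\<in>L. c l *\<^sub>R G l p)) =
      (\<Sum>l\<in>L. (c l)\<^sup>2 * (real l * (real l + 1)) * sph_int (\<lambda>p. (h l p)\<^sup>2))"
    using assms(1) by simp
qed

section \<open>Finite-rank positive semidefinite kernels\<close>

definition psd_kernel :: "'a set \<Rightarrow> ('a \<Rightarrow> 'a \<Rightarrow> real) \<Rightarrow> bool" where
  "psd_kernel S K \<longleftrightarrow> (\<forall>p\<in>S. \<forall>q\<in>S. K p q = K q p) \<and>
     (\<forall>T c. finite T \<longrightarrow> T \<subseteq> S \<longrightarrow> 0 \<le> (\<Sum>s\<in>T. \<Sum>t\<in>T. c s * c t * K s t))"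

lemma psd_kernelD:
  assumes "psd_kernel S K" "finite T" "T \<subseteq> S"
  shows "0 \<le> (\<Sum>s\<in>T. \<Sum>t\<in>T. c s * c t * K s t)"
  using assms unfolding psd_kernel_def by blast

text \<open>The functions u and v are arbitrary; the definition only bounds the length of the
  elimination. The symmetric expansion in columns of K is its outcome.\<close>

definition finite_rank :: "'a set \<Rightarrow> ('a \<Rightarrow> 'a \<Rightarrow> real) \<Rightarrow> bool" where
  "finite_rank S K \<longleftrightarrow> (\<exists>(n::nat) u v. \<forall>p\<in>S. \<forall>q\<in>S. K p q = (\<Sum>k<n. u k p * v k q))"

lemma finite_rank_add_rank_one:
  assumes "finite_rank S K"
  shows "finite_rank S (\<lambda>p q. K p q + g p * h q)"
proof -
  obtain n u v where K: "\<forall>p\<in>S. \<forall>q\<in>S. K p q = (\<Sum>k<(n::nat). u k p * v k q)"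
    using assms unfolding finite_rank_def by blast
  show ?thesis
    unfolding finite_rank_def
    by (intro exI[of _ "Suc n"] exI[of _ "u(n := g)"] exI[of _ "v(n := h)"]) (simp add: K)
qed

lemma finite_rank_add:
  assumes "finite_rank S K" "finite_rank S K'"
  shows "finite_rank S (\<lambda>p q. K p q + K' p q)"
proof -
  obtain n u v where K': "\<forall>p\<in>S. \<forall>q\<in>S. K' p q = (\<Sum>k<(n::nat). u k p * v k q)"
    using assms(2) unfolding finite_rank_def by blast
  have "finite_rank S (\<lambda>p q. K p q + (\<Sum>k<m. u k p * v k q))" for m
  proof (induction m)
    case (Suc m)
    show ?case
      using finite_rank_add_rank_one[OF Suc, of "u m" "v m"] by (simp add: add.assoc)
  qed (use assms(1) in simp)
  from this[of n] K' show ?thesis by (simp add: finite_rank_def)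
qed

lemma finite_rank_mult_rank_one:
  assumes "finite_rank S K"
  shows "finite_rank S (\<lambda>p q. g p * h q * K p q)"
proof -
  obtain n u v where K: "\<forall>p\<in>S. \<forall>q\<in>S. K p q = (\<Sum>k<(n::nat). u k p * v k q)"
    using assms unfolding finite_rank_def by blast
  show ?thesis
    unfolding finite_rank_def
    by (intro exI[of _ n] exI[of _ "\<lambda>k p. g p * u k p"] exI[of _ "\<lambda>k q. h q * v k q"])
      (simp add: K sum_distrib_left mult_ac)
qed

text \<open>p . q is a sum of three rank-one kernels, so the factor x in the three-term recurrence
  at most triples the rank.\<close>

lemma finite_rank_inner_mult:
  fixes S :: "(real^3) set"
  assumes "finite_rank S K"
  shows "finite_rank S (\<lambda>p q. (p \<bullet> q) * K p q)"
proof -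
  have "finite_rank S (\<lambda>p q. (p$1 * q$1 * K p q + p$2 * q$2 * K p q) + p$3 * q$3 * K p q)"
    by (intro finite_rank_add finite_rank_mult_rank_one[OF assms])
  thus ?thesis by (simp add: inner_3 algebra_simps)
qed

lemma finite_rank_legendre: "finite_rank S (\<lambda>p q::real^3. c * legendre l (p \<bullet> q))"
proof -
  have "finite_rank S (\<lambda>p q. legendre l (p \<bullet> q))"
  proof (induction l rule: legendre_poly.induct)
    case 1
    show ?case
      unfolding finite_rank_def
      by (intro exI[of _ "Suc 0"] exI[of _ "\<lambda>_ _. 1"]) simp
  next
    case 2
    have "finite_rank S (\<lambda>p q::real^3. 1)"
      unfolding finite_rank_def
      by (intro exI[of _ "Suc 0"] exI[of _ "\<lambda>_ _. 1"]) simp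
    from finite_rank_inner_mult[OF this] show ?case by simp
  next
    case (3 n)
    have "finite_rank S (\<lambda>p q. (\<lambda>_. (2 * real n + 3) / real (n + 2)) p * (\<lambda>_. 1) q *
        ((p \<bullet> q) * legendre (Suc n) (p \<bullet> q)) +
        (\<lambda>_. - real (Suc n) / real (n + 2)) p * (\<lambda>_. 1) q * legendre n (p \<bullet> q))"
      by (intro finite_rank_add finite_rank_mult_rank_one finite_rank_inner_mult 3)
    moreover have "legendre (Suc (Suc n)) x = (2 * real n + 3) / real (n + 2) * 1 *
        (x * legendre (Suc n) x) + - real (Suc n) / real (n + 2) * 1 * legendre n x" for x
      by (simp add: diff_divide_distrib mult.assoc del: of_nat_add of_nat_Suc)
    ultimately show ?case by presburger
  qed
  from finite_rank_mult_rank_one[OF this, of "\<lambda>_. c" "\<lambda>_. 1"] show ?thesis by simp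
qed

text \<open>Weights (1, 1) and (1, -1) at p and q bound the off-diagonal entry from both sides. This
  ends the factorisation: without a pivot, the remaining kernel is zero.\<close>

lemma psd_kernel_diag_zero:
  assumes psd: "psd_kernel S K" and "\<And>p. p \<in> S \<Longrightarrow> K p p = 0" and pq: "p \<in> S" "q \<in> S"
  shows "K p q = 0"
proof (cases "p = q")
  case True
  thus ?thesis using assms by simp
next
  case False
  have "0 \<le> (\<Sum>s\<in>{p, q}. \<Sum>t\<in>{p, q}. c s * c t * K s t)" for c
    using pq by (intro psd_kernelD[OF psd]) auto
  moreover have "K q p = K p q"
    using psd pq by (auto simp: psd_kernel_def)
  ultimately have "0 \<le> c p * c q * K p q + c q * c p * K p q" for c
    using False assms(2)[OF pq(1)] assms(2)[OF pq(2)] by simp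
  from this[of "\<lambda>_. 1"] this[of "\<lambda>s. if s = p then 1 else - 1"] show ?thesis
    using False by simp
qed

text \<open>Pivoted Cholesky factorisation: subtracting \<open>K p p0 * K p0 q / K p0 p0\<close> keeps the kernel
  positive semidefinite and lowers its rank.\<close>

lemma psd_kernel_orthonormal_expansion_rank:
  fixes K :: "'a \<Rightarrow> 'a \<Rightarrow> real" and I :: "nat set"
  assumes "psd_kernel S K" "finite I" "card I = N"
    and "\<forall>p\<in>S. \<forall>q\<in>S. K p q = (\<Sum>k\<in>I. u k p * v k q)"
  shows "\<exists>(n::nat) T D. finite T \<and> T \<subseteq> S \<and>
     (\<forall>p\<in>S. \<forall>q\<in>S. K p q = (\<Sum>i<n. (\<Sum>t\<in>T. D i t * K p t) * (\<Sum>t\<in>T. D i t * K q t))) \<and>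
     (\<forall>i<n. \<forall>k<n. (\<Sum>s\<in>T. \<Sum>t\<in>T. D i s * D k t * K s t) = (if i = k then 1 else 0))"
  using assms
proof (induction N arbitrary: I u v K)
  case 0
  thus ?case by (intro exI[of _ 0] exI[of _ "{}"]) auto
next
  case (Suc N)
  note psd = Suc.prems(1) and rank = Suc.prems(4)[rule_format]
  have sym: "K p q = K q p" if "p \<in> S" "q \<in> S" for p q
    using psd that by (auto simp: psd_kernel_def)
  show ?case
  proof (cases "\<forall>p\<in>S. K p p = 0")
    case True
    hence "K p q = 0" if "p \<in> S" "q \<in> S" for p q
      using psd_kernel_diag_zero[OF psd] that by blast
    thus ?thesis by (intro exI[of _ 0] exI[of _ "{}"]) auto
  next
    case False
    then obtain p0 where p0: "p0 \<in> S" "K p0 p0 \<noteq> 0" by blast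
    define \<kappa> where "\<kappa> = K p0 p0"
    have "0 \<le> (\<Sum>s\<in>{p0}. \<Sum>t\<in>{p0}. 1 * 1 * K s t)"
      using p0 by (intro psd_kernelD[OF psd]) auto
    hence \<kappa>: "\<kappa> > 0" using p0(2) by (simp add: \<kappa>_def)
    define K' where "K' p q = K p q - K p p0 * K p0 q / \<kappa>" for p q
    have K'0: "K' p p0 = 0" "K' p0 p = 0" for p
      using \<kappa> by (simp_all add: K'_def \<kappa>_def)
    \<comment> \<open>The pivot may or may not lie in T; the indicators cover both cases.\<close>
    have shift: "(\<Sum>s\<in>insert p0 T. ((if s \<in> T then c s else 0) - (if s = p0 then m else 0)) * g s)
        = (\<Sum>s\<in>T. c s * g s) - m * g p0" if "finite T" for T c m and g :: "'a \<Rightarrow> real"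
    proof -
      have "(\<Sum>s\<in>insert p0 T. (if s \<in> T then c s else 0) * g s) = (\<Sum>s\<in>T. c s * g s)"
        using that by (intro sum.mono_neutral_cong_right) auto
      moreover have "(\<Sum>s\<in>insert p0 T. (if s = p0 then m else 0) * g s) = m * g p0"
        using that by (simp add: if_distrib[of "\<lambda>x. x * _"] cong: if_cong)
      ultimately show ?thesis by (simp add: left_diff_distrib sum_subtractf)
    qed
    have quad: "(\<Sum>s\<in>T. \<Sum>t\<in>T. c s * d t * k s t) = (\<Sum>s\<in>T. c s * (\<Sum>t\<in>T. d t * k s t))"
      for T and c d :: "'a \<Rightarrow> real" and k
      by (simp add: sum_distrib_left mult.assoc)
    \<comment> \<open>\<open>ext\<close> subtracts from the weights c the multiple of the pivot that
      makes them K-orthogonal to p0. Applying K to the corrected weights is applying K' to c, so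
      positivity, columns and orthonormality all transfer.\<close>
    define ext where "ext T c s = (if s \<in> T then c s else 0) -
        (if s = p0 then (\<Sum>t\<in>T. c t * K t p0) / \<kappa> else 0)" for T and c :: "'a \<Rightarrow> real" and s
    have ext1: "(\<Sum>t\<in>insert p0 T. ext T c t * K p t) = (\<Sum>t\<in>T. c t * K' p t)"
      if "finite T" "T \<subseteq> S" for T c p
    proof -
      have "(\<Sum>t\<in>insert p0 T. ext T c t * K p t) =
          (\<Sum>t\<in>T. c t * K p t) - (\<Sum>t\<in>T. c t * K t p0) / \<kappa> * K p p0"
        unfolding ext_def by (rule shift[OF that(1)])
      also have "(\<Sum>t\<in>T. c t * K t p0) = (\<Sum>t\<in>T. c t * K p0 t)"
        using that p0 by (intro sum.cong refl) (auto simp: sym)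
      also have "(\<Sum>t\<in>T. c t * K p t) - (\<Sum>t\<in>T. c t * K p0 t) / \<kappa> * K p p0 = (\<Sum>t\<in>T. c t * K' p t)"
        unfolding K'_def right_diff_distrib sum_subtractf sum_divide_distrib sum_distrib_right
        by (simp add: mult_ac)
      finally show ?thesis .
    qed
    have ext2: "(\<Sum>s\<in>insert p0 T. \<Sum>t\<in>insert p0 T. ext T c s * ext T d t * K s t) =
        (\<Sum>s\<in>T. \<Sum>t\<in>T. c s * d t * K' s t)" if "finite T" "T \<subseteq> S" for T c d
      unfolding quad ext1[OF that] unfolding ext_def shift[OF that(1)] K'0 by simp
    have "psd_kernel S K'"
      unfolding psd_kernel_def
    proof (intro conjI ballI allI impI)
      show "K' p q = K' q p" if "p \<in> S" "q \<in> S" for p q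
        using that p0 by (simp add: K'_def sym)
    next
      fix T c assume T: "finite T" "T \<subseteq> S"
      show "0 \<le> (\<Sum>s\<in>T. \<Sum>t\<in>T. c s * c t * K' s t)"
        unfolding ext2[OF T, symmetric] using T p0(1) by (intro psd_kernelD[OF psd]) auto
    qed
    obtain r where r: "r \<in> I" "u r p0 \<noteq> 0"
      using rank[OF p0(1) p0(1)] p0(2) by (metis (no_types, lifting) mult_zero_left sum.neutral)
    define v' where "v' k q = v k q - v k p0 * K p0 q / \<kappa>" for k q
    have K'v: "K' p q = (\<Sum>k\<in>I. u k p * v' k q)" if "p \<in> S" "q \<in> S" for p q
      unfolding K'_def v'_def rank[OF that] rank[OF that(1) p0(1)]
      by (simp add: right_diff_distrib sum_subtractf sum_distrib_right sum_divide_distrib mult.assoc)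
    \<comment> \<open>K' vanishes in the row p0 while \<open>u r p0\<close> is nonzero, so
      \<open>v' r\<close> is a combination of the other \<open>v' k\<close>. Eliminating it leaves
      one summand fewer.\<close>
    have rank': "K' p q = (\<Sum>k\<in>I - {r}. (u k p - u r p * u k p0 / u r p0) * v' k q)"
      if "p \<in> S" "q \<in> S" for p q
    proof -
      have "0 = u r p0 * v' r q + (\<Sum>k\<in>I - {r}. u k p0 * v' k q)"
        using K'v[OF p0(1) that(2)] Suc.prems(2) r(1) by (simp add: K'0 sum.remove)
      hence "v' r q = - (\<Sum>k\<in>I - {r}. u k p0 * v' k q) / u r p0"
        using r(2) by (simp add: field_simps)
      hence "K' p q = (\<Sum>k\<in>I - {r}. u k p * v' k q) - u r p * (\<Sum>k\<in>I - {r}. u k p0 * v' k q) / u r p0"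
        using K'v[OF that] Suc.prems(2) r(1) by (simp add: sum.remove)
      thus ?thesis
        by (simp add: left_diff_distrib sum_subtractf sum_distrib_left sum_divide_distrib mult.assoc)
    qed
    have crd: "card (I - {r}) = N" using Suc.prems(2,3) r(1) by simp
    have rk: "\<forall>p\<in>S. \<forall>q\<in>S. K' p q = (\<Sum>k\<in>I - {r}. (u k p - u r p * u k p0 / u r p0) * v' k q)"
      using rank' by blast
    obtain n :: nat and T D where T: "finite T" "T \<subseteq> S"
      and D1: "\<forall>p\<in>S. \<forall>q\<in>S. K' p q = (\<Sum>i<n. (\<Sum>t\<in>T. D i t * K' p t) * (\<Sum>t\<in>T. D i t * K' q t))"
      and D2: "\<forall>i<n. \<forall>k<n. (\<Sum>s\<in>T. \<Sum>t\<in>T. D i s * D k t * K' s t) = (if i = k then 1 else 0)"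
      using Suc.IH[OF \<open>psd_kernel S K'\<close> finite_Diff[OF Suc.prems(2)] crd rk]
      by (elim exE conjE)
    \<comment> \<open>The new member n is the normalised point mass at the pivot; the earlier ones
      are corrected by \<open>ext\<close> and hence orthogonal to it.\<close>
    define E where "E i = (if i < n then ext T (D i) else (\<lambda>s. if s = p0 then 1 / sqrt \<kappa> else 0))" for i
    have E1: "(\<Sum>t\<in>insert p0 T. E i t * K p t) = (\<Sum>t\<in>T. D i t * K' p t)" if "i < n" for i p
      using ext1[OF T] that by (simp add: E_def)
    have E2: "(\<Sum>t\<in>insert p0 T. E n t * g t) = g p0 / sqrt \<kappa>" for g
      using T(1) by (simp add: E_def if_distrib[of "\<lambda>x. x * _"] cong: if_cong)
    have "K p q = (\<Sum>i<Suc n. (\<Sum>t\<in>insert p0 T. E i t * K p t) * (\<Sum>t\<in>insert p0 T. E i t * K q t))"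
      if "p \<in> S" "q \<in> S" for p q
    proof -
      have "K p p0 / sqrt \<kappa> * (K q p0 / sqrt \<kappa>) = K p p0 * K p0 q / \<kappa>"
        using \<kappa> sym[OF that(2) p0(1)] by simp
      moreover have "K p q = K' p q + K p p0 * K p0 q / \<kappa>" by (simp add: K'_def)
        moreover have "K' p q = (\<Sum>i<n. (\<Sum>t\<in>T. D i t * K' p t) * (\<Sum>t\<in>T. D i t * K' q t))"
          using D1 that by blast
        ultimately show ?thesis by (simp add: E1 E2)
    qed
    moreover have "(\<Sum>s\<in>insert p0 T. \<Sum>t\<in>insert p0 T. E i s * E k t * K s t) = (if i = k then 1 else 0)"
      if ik: "i < Suc n" "k < Suc n" for i k
    proof -
      consider "i < n" "k < n" | "i < n" "k = n" | "i = n" "k < n" | "i = n" "k = n"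
        using ik unfolding less_Suc_eq by blast
      thus ?thesis
      proof cases
        case 1
        thus ?thesis using D2 ext2[OF T] by (simp add: E_def)
      next
        case 2
        have "(\<Sum>s\<in>insert p0 T. E i s * (K s p0 / sqrt \<kappa>)) =
            (\<Sum>s\<in>insert p0 T. E i s * K p0 s) / sqrt \<kappa>"
          unfolding sum_divide_distrib using T p0(1) by (intro sum.cong refl) (auto simp: sym)
        thus ?thesis using 2 unfolding quad by (simp only: E1 E2 K'0) simp
      next
        case 3
        thus ?thesis unfolding quad by (simp only: E1 E2 K'0) simp
      next
        case 4
        thus ?thesis unfolding quad using \<kappa> by (simp only: E2) (simp add: \<kappa>_def)
      qed
    qed
    ultimately show ?thesis
      using T p0(1) by (intro exI[of _ "Suc n"] exI[of _ "insert p0 T"] exI[of _ E]) auto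
  qed
qed

lemma psd_kernel_orthonormal_expansion:
  fixes K :: "'a \<Rightarrow> 'a \<Rightarrow> real"
  assumes "psd_kernel S K" "finite_rank S K"
  shows "\<exists>(n::nat) T D. finite T \<and> T \<subseteq> S \<and>
     (\<forall>p\<in>S. \<forall>q\<in>S. K p q = (\<Sum>i<n. (\<Sum>t\<in>T. D i t * K p t) * (\<Sum>t\<in>T. D i t * K q t))) \<and>
     (\<forall>i<n. \<forall>k<n. (\<Sum>s\<in>T. \<Sum>t\<in>T. D i s * D k t * K s t) = (if i = k then 1 else 0))"
proof -
  obtain n u v where "\<forall>p\<in>S. \<forall>q\<in>S. K p q = (\<Sum>k<(n::nat). u k p * v k q)"
    using assms(2) unfolding finite_rank_def by blast
  thus ?thesis
    using psd_kernel_orthonormal_expansion_rank[OF assms(1), of "{..<n}" n u v] by simp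
qed

section \<open>Gaussian families\<close>

text \<open>Levy's uniqueness theorem identifies X / sqrt v with a standard normal variable, whose
  moments are known. The case v = 0 is kept: it turns a vanishing variance into an almost sure
  identity.\<close>

lemma (in prob_space) char_gaussian:
  fixes X :: "'a \<Rightarrow> real"
  assumes X: "X \<in> borel_measurable M"
    and char: "\<And>t. (\<integral>\<omega>. cis (t * X \<omega>) \<partial>M) = complex_of_real (exp (- (t\<^sup>2 * v) / 2))"
    and v: "v \<ge> 0"
  shows "integrable M (\<lambda>\<omega>. (X \<omega>) ^ 2)" "(\<integral>\<omega>. (X \<omega>) ^ 2 \<partial>M) = v"
    and "integrable M (\<lambda>\<omega>. (X \<omega>) ^ 4)" "(\<integral>\<omega>. (X \<omega>) ^ 4 \<partial>M) = 3 * v\<^sup>2"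
    and "v = 0 \<Longrightarrow> AE \<omega> in M. X \<omega> = 0"
proof -
  have char_distr: "char (distr M borel (\<lambda>\<omega>. r * X \<omega>)) t = complex_of_real (exp (- ((r * t)\<^sup>2 * v) / 2))" for r t
  proof -
    have "char (distr M borel (\<lambda>\<omega>. r * X \<omega>)) t = (\<integral>\<omega>. cis ((r * t) * X \<omega>) \<partial>M)"
      unfolding char_def using X
      by (subst integral_distr) (auto simp: cis_conv_exp mult_ac)
    thus ?thesis using char[of "r * t"] by simp
  qed
  have AE0: "AE \<omega> in M. X \<omega> = 0" if "v = 0"
  proof -
    have "real_distribution (distr M borel (\<lambda>\<omega>. 1 * X \<omega>))"
      using X by (intro real_distribution_distr) auto
    moreover have "real_distribution (return borel (0::real))"
      by (simp add: real_distribution_def real_distribution_axioms_def prob_space_return)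
    moreover have "char (distr M borel (\<lambda>\<omega>. 1 * X \<omega>)) = char (return borel 0)"
      unfolding char_distr by (simp add: that char_def integral_return fun_eq_iff)
    ultimately have "distr M borel (\<lambda>\<omega>. 1 * X \<omega>) = return borel 0"
      by (rule Levy_uniqueness)
    hence "distr M borel X = return borel 0" by simp
    moreover have "AE x in return borel (0::real). x = 0"
      by (subst AE_return) auto
    ultimately have "AE x in distr M borel X. x = 0"
      by (simp only:)
    thus ?thesis by (rule AE_distrD[OF X])
  qed
  have "(integrable M (\<lambda>\<omega>. (X \<omega>) ^ 2) \<and> (\<integral>\<omega>. (X \<omega>) ^ 2 \<partial>M) = v) \<and>
    (integrable M (\<lambda>\<omega>. (X \<omega>) ^ 4) \<and> (\<integral>\<omega>. (X \<omega>) ^ 4 \<partial>M) = 3 * v\<^sup>2)"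
  proof (cases "v = 0")
    case True
    have "AE \<omega> in M. (X \<omega>) ^ 2 = 0" "AE \<omega> in M. (X \<omega>) ^ 4 = 0"
      using AE0[OF True] by auto
    moreover from this have "integrable M (\<lambda>\<omega>. (X \<omega>) ^ 2)" "integrable M (\<lambda>\<omega>. (X \<omega>) ^ 4)"
      using X by (auto intro: integrable_cong_AE_imp[of M "\<lambda>_. 0"])
    ultimately show ?thesis by (simp add: True integral_eq_zero_AE)
  next
    case False
    hence v0: "v > 0" using v by simp
    define Y where "Y = (\<lambda>\<omega>. 1 / sqrt v * X \<omega>)"
    have Y: "Y \<in> borel_measurable M" using X by (simp add: Y_def)
    have "distr M borel Y = std_normal_distribution"
      unfolding Y_def
    proof (rule Levy_uniqueness)
      show "real_distribution (distr M borel (\<lambda>\<omega>. 1 / sqrt v * X \<omega>))"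
        using X by (intro real_distribution_distr) auto
      show "char (distr M borel (\<lambda>\<omega>. 1 / sqrt v * X \<omega>)) = char std_normal_distribution"
        unfolding char_distr char_std_normal_distribution
        using v0 by (simp add: fun_eq_iff power_divide)
    qed (rule real_dist_normal_dist)
    hence mom: "integrable M (\<lambda>\<omega>. (Y \<omega>) ^ (2 * k)) \<and>
        (\<integral>\<omega>. (Y \<omega>) ^ (2 * k) \<partial>M) = fact (2 * k) / (2 ^ k * fact k)" for k
      using std_normal_distribution_even_moments[of k]
        integrable_distr_eq[OF Y, of "\<lambda>x. x ^ (2 * k)"] integral_distr[OF Y, of "\<lambda>x. x ^ (2 * k)"]
      by simp
    have XY: "X \<omega> = sqrt v * Y \<omega>" for \<omega> using v0 by (simp add: Y_def)
    have "sqrt v ^ 4 = (sqrt v ^ 2) ^ 2" by simp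
    hence "sqrt v ^ 4 = v ^ 2" using v0 by simp
    thus ?thesis
      using mom[of 1] mom[of 2] v0 unfolding XY power_mult_distrib
      by (simp add: fact_numeral)
  qed
  thus "integrable M (\<lambda>\<omega>. (X \<omega>) ^ 2)" "(\<integral>\<omega>. (X \<omega>) ^ 2 \<partial>M) = v"
    "integrable M (\<lambda>\<omega>. (X \<omega>) ^ 4)" "(\<integral>\<omega>. (X \<omega>) ^ 4 \<partial>M) = 3 * v\<^sup>2"
    by blast+
  show "v = 0 \<Longrightarrow> AE \<omega> in M. X \<omega> = 0" by (rule AE0)
qed

text \<open>Independent standard normals, encoded by their joint characteristic function: the law of
  the field is given in this form, and it yields the moments of all linear combinations.\<close>

definition (in prob_space) std_gaussian_family :: "'i set \<Rightarrow> ('i \<Rightarrow> 'a \<Rightarrow> real) \<Rightarrow> bool" where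
  "std_gaussian_family J g \<longleftrightarrow> finite J \<and> (\<forall>x\<in>J. g x \<in> borel_measurable M) \<and>
     (\<forall>c. (\<integral>\<omega>. cis (\<Sum>x\<in>J. c x * g x \<omega>) \<partial>M) = complex_of_real (exp (- (\<Sum>x\<in>J. (c x)\<^sup>2) / 2)))"

context prob_space
begin

lemma std_gaussian_combination_moments:
  assumes "std_gaussian_family J g"
  shows "integrable M (\<lambda>\<omega>. (\<Sum>x\<in>J. c x * g x \<omega>) ^ 2)"
    "(\<integral>\<omega>. (\<Sum>x\<in>J. c x * g x \<omega>) ^ 2 \<partial>M) = (\<Sum>x\<in>J. (c x)\<^sup>2)"
    "integrable M (\<lambda>\<omega>. (\<Sum>x\<in>J. c x * g x \<omega>) ^ 4)"
    "(\<integral>\<omega>. (\<Sum>x\<in>J. c x * g x \<omega>) ^ 4 \<partial>M) = 3 * (\<Sum>x\<in>J. (c x)\<^sup>2)\<^sup>2"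
proof -
  have meas: "(\<lambda>\<omega>. \<Sum>x\<in>J. c x * g x \<omega>) \<in> borel_measurable M"
    using assms unfolding std_gaussian_family_def
    by (intro borel_measurable_sum borel_measurable_times borel_measurable_const) blast
  have ch: "(\<integral>\<omega>. cis (t * (\<Sum>x\<in>J. c x * g x \<omega>)) \<partial>M) =
      complex_of_real (exp (- (t\<^sup>2 * (\<Sum>x\<in>J. (c x)\<^sup>2)) / 2))" for t
  proof -
    have "(\<integral>\<omega>. cis (\<Sum>x\<in>J. (t * c x) * g x \<omega>) \<partial>M) =
        complex_of_real (exp (- (\<Sum>x\<in>J. (t * c x)\<^sup>2) / 2))"
      using assms[unfolded std_gaussian_family_def, THEN conjunct2, THEN conjunct2]
      by (rule spec)
    thus ?thesis by (simp add: sum_distrib_left mult.assoc power_mult_distrib)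
  qed
  have "(\<Sum>x\<in>J. (c x)\<^sup>2) \<ge> 0" by (simp add: sum_nonneg)
  note * = char_gaussian[OF meas ch this]
  show "integrable M (\<lambda>\<omega>. (\<Sum>x\<in>J. c x * g x \<omega>) ^ 2)"
    "(\<integral>\<omega>. (\<Sum>x\<in>J. c x * g x \<omega>) ^ 2 \<partial>M) = (\<Sum>x\<in>J. (c x)\<^sup>2)"
    "integrable M (\<lambda>\<omega>. (\<Sum>x\<in>J. c x * g x \<omega>) ^ 4)"
    "(\<integral>\<omega>. (\<Sum>x\<in>J. c x * g x \<omega>) ^ 4 \<partial>M) = 3 * (\<Sum>x\<in>J. (c x)\<^sup>2)\<^sup>2"
    using * by simp_all
qed

text \<open>Polarisation writes products of two and four variables as signed sums of second and
  fourth powers of linear combinations, whose moments depend on the variance \<open>V\<close>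
  alone.\<close>

lemma std_gaussian_wick:
  fixes J :: "'i set"
  assumes fam: "std_gaussian_family J g" and J: "a \<in> J" "b \<in> J" "c \<in> J" "d \<in> J"
  shows "integrable M (\<lambda>\<omega>. g a \<omega> * g b \<omega>)"
    "(\<integral>\<omega>. g a \<omega> * g b \<omega> \<partial>M) = of_bool (a = b)"
    "integrable M (\<lambda>\<omega>. g a \<omega> * g b \<omega> * g c \<omega> * g d \<omega>)"
    "(\<integral>\<omega>. g a \<omega> * g b \<omega> * g c \<omega> * g d \<omega> \<partial>M) =
       of_bool (a = b) * of_bool (c = d) + of_bool (a = c) * of_bool (b = d) + of_bool (a = d) * of_bool (b = c)"
proof -
  have fin: "finite J" using fam by (simp add: std_gaussian_family_def)
  define e where "e x y = (of_bool (y = x) :: real)" for x y :: 'i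
  have e1: "(\<Sum>y\<in>J. e x y * h y) = h x" if "x \<in> J" for x and h :: "'i \<Rightarrow> real"
    using that fin by (simp add: e_def)
  define X where "X e1 e2 e3 \<omega> = g a \<omega> + e1 * g b \<omega> + e2 * g c \<omega> + e3 * g d \<omega>" for e1 e2 e3 \<omega>
  define V where "V e1 e2 e3 = 1 + e1\<^sup>2 + e2\<^sup>2 + e3\<^sup>2 + 2 * e1 * of_bool (a = b) + 2 * e2 * of_bool (a = c)
      + 2 * e3 * of_bool (a = d) + 2 * e1 * e2 * of_bool (b = c) + 2 * e1 * e3 * of_bool (b = d)
      + 2 * e2 * e3 * of_bool (c = d)" for e1 e2 e3 :: real
  have XV: "(\<Sum>y\<in>J. (e a y + e1 * e b y + e2 * e c y + e3 * e d y) * g y \<omega>) = X e1 e2 e3 \<omega>"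
    "(\<Sum>y\<in>J. (e a y + e1 * e b y + e2 * e c y + e3 * e d y)\<^sup>2) = V e1 e2 e3" for e1 e2 e3 \<omega>
  proof -
    have lin: "(\<Sum>y\<in>J. (e a y + e1 * e b y + e2 * e c y + e3 * e d y) * h y) =
        h a + e1 * h b + e2 * h c + e3 * h d" for h
      by (simp add: distrib_right sum.distrib mult.assoc e1 J flip: sum_distrib_left)
    show "(\<Sum>y\<in>J. (e a y + e1 * e b y + e2 * e c y + e3 * e d y) * g y \<omega>) = X e1 e2 e3 \<omega>"
      unfolding lin X_def ..
    show "(\<Sum>y\<in>J. (e a y + e1 * e b y + e2 * e c y + e3 * e d y)\<^sup>2) = V e1 e2 e3"
      unfolding power2_eq_square lin V_def by (simp add: e_def algebra_simps eq_commute)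
  qed
  note mom = std_gaussian_combination_moments[OF fam, of "\<lambda>y. e a y + _ * e b y + _ * e c y + _ * e d y", unfolded XV]
  have ab: "g a \<omega> * g b \<omega> = (X 1 0 0 \<omega> ^ 2 - X (-1) 0 0 \<omega> ^ 2) / 4" for \<omega>
    unfolding X_def by (simp add: power2_eq_square algebra_simps)
  show "integrable M (\<lambda>\<omega>. g a \<omega> * g b \<omega>)"
    unfolding ab by (intro integrable_divide Bochner_Integration.integrable_diff mom)
  have "(\<integral>\<omega>. g a \<omega> * g b \<omega> \<partial>M) = (V 1 0 0 - V (-1) 0 0) / 4"
    unfolding ab by (simp add: mom)
  thus "(\<integral>\<omega>. g a \<omega> * g b \<omega> \<partial>M) = of_bool (a = b)"
    by (simp add: V_def)
  \<comment> \<open>The first sign is fixed and the other three run over 8 choices, weighted by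
    their product. Each choice contributes 4! = 24 times the product, whence 192.\<close>
  have abcd: "g a \<omega> * g b \<omega> * g c \<omega> * g d \<omega> =
      (X 1 1 1 \<omega> ^ 4 - X 1 1 (-1) \<omega> ^ 4 - X 1 (-1) 1 \<omega> ^ 4 - X (-1) 1 1 \<omega> ^ 4
       + X 1 (-1) (-1) \<omega> ^ 4 + X (-1) 1 (-1) \<omega> ^ 4 + X (-1) (-1) 1 \<omega> ^ 4 - X (-1) (-1) (-1) \<omega> ^ 4) / 192" for \<omega>
  proof -
    have "192 * (x * y * z * w) = (x + 1 * y + 1 * z + 1 * w) ^ 4 - (x + 1 * y + 1 * z + (-1) * w) ^ 4
       - (x + 1 * y + (-1) * z + 1 * w) ^ 4 - (x + (-1) * y + 1 * z + 1 * w) ^ 4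
       + (x + 1 * y + (-1) * z + (-1) * w) ^ 4 + (x + (-1) * y + 1 * z + (-1) * w) ^ 4
       + (x + (-1) * y + (-1) * z + 1 * w) ^ 4 - (x + (-1) * y + (-1) * z + (-1) * w) ^ 4"
      for x y z w :: real by algebra
    from this[of "g a \<omega>" "g b \<omega>" "g c \<omega>" "g d \<omega>"] show ?thesis
      unfolding X_def by simp
  qed
  show "integrable M (\<lambda>\<omega>. g a \<omega> * g b \<omega> * g c \<omega> * g d \<omega>)"
    unfolding abcd by (intro integrable_divide Bochner_Integration.integrable_diff Bochner_Integration.integrable_add mom)
  have "(\<integral>\<omega>. g a \<omega> * g b \<omega> * g c \<omega> * g d \<omega> \<partial>M) =
      (3 * (V 1 1 1)\<^sup>2 - 3 * (V 1 1 (-1))\<^sup>2 - 3 * (V 1 (-1) 1)\<^sup>2 - 3 * (V (-1) 1 1)\<^sup>2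
       + 3 * (V 1 (-1) (-1))\<^sup>2 + 3 * (V (-1) 1 (-1))\<^sup>2 + 3 * (V (-1) (-1) 1)\<^sup>2 - 3 * (V (-1) (-1) (-1))\<^sup>2) / 192"
    unfolding abcd by (simp add: mom)
  also have "\<dots> = of_bool (a = b) * of_bool (c = d) + of_bool (a = c) * of_bool (b = d) + of_bool (a = d) * of_bool (b = c)"
    unfolding V_def
    by (simp add: power2_eq_square algebra_simps)
  finally show "(\<integral>\<omega>. g a \<omega> * g b \<omega> * g c \<omega> * g d \<omega> \<partial>M) =
       of_bool (a = b) * of_bool (c = d) + of_bool (a = c) * of_bool (b = d) + of_bool (a = d) * of_bool (b = c)" .
qed

text \<open>Centring each product removes the pairing within it. The two crosswise Wick pairings
  survive, and symmetry of m makes them equal, which gives the factor 2.\<close>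

lemma std_gaussian_quadratic_form_variance:
  assumes fam: "std_gaussian_family J g" and sym: "\<And>a b. a \<in> J \<Longrightarrow> b \<in> J \<Longrightarrow> m a b = m b a"
  shows "(\<integral>\<omega>. ((\<Sum>a\<in>J. \<Sum>b\<in>J. m a b * (g a \<omega> * g b \<omega>)) - (\<Sum>a\<in>J. m a a))\<^sup>2 \<partial>M) =
    2 * (\<Sum>a\<in>J. \<Sum>b\<in>J. (m a b)\<^sup>2)"
proof -
  have fin: "finite J" using fam by (simp add: std_gaussian_family_def)
  define H where "H a b \<omega> = g a \<omega> * g b \<omega> - of_bool (a = b)" for a b \<omega>
  have HH: "H a b \<omega> * H c d \<omega> = g a \<omega> * g b \<omega> * g c \<omega> * g d \<omega> - of_bool (a = b) * (g c \<omega> * g d \<omega>)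
      - of_bool (c = d) * (g a \<omega> * g b \<omega>) + of_bool (a = b) * of_bool (c = d)" for a b c d \<omega>
    by (simp add: H_def algebra_simps)
  have int: "integrable M (\<lambda>\<omega>. H a b \<omega> * H c d \<omega>)"
    and EHH: "(\<integral>\<omega>. H a b \<omega> * H c d \<omega> \<partial>M) = of_bool (a = c) * of_bool (b = d) + of_bool (a = d) * of_bool (b = c)"
    if "a \<in> J" "b \<in> J" "c \<in> J" "d \<in> J" for a b c d
  proof -
    note w = std_gaussian_wick[OF fam that] std_gaussian_wick(1,2)[OF fam that(3,4) that(1,2)]
    show "integrable M (\<lambda>\<omega>. H a b \<omega> * H c d \<omega>)"
      unfolding HH
      by (intro Bochner_Integration.integrable_add Bochner_Integration.integrable_diff
          integrable_mult_right w integrable_const)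
    show "(\<integral>\<omega>. H a b \<omega> * H c d \<omega> \<partial>M) = of_bool (a = c) * of_bool (b = d) + of_bool (a = d) * of_bool (b = c)"
      unfolding HH using w by (simp add: prob_space)
  qed
  have "(\<Sum>a\<in>J. \<Sum>b\<in>J. m a b * (g a \<omega> * g b \<omega>)) - (\<Sum>a\<in>J. m a a) = (\<Sum>a\<in>J. \<Sum>b\<in>J. m a b * H a b \<omega>)" for \<omega>
    using fin by (simp add: H_def right_diff_distrib sum_subtractf)
  hence sq: "((\<Sum>a\<in>J. \<Sum>b\<in>J. m a b * (g a \<omega> * g b \<omega>)) - (\<Sum>a\<in>J. m a a))\<^sup>2 =
      (\<Sum>a\<in>J. \<Sum>c\<in>J. \<Sum>b\<in>J. \<Sum>d\<in>J. (m a b * m c d) * (H a b \<omega> * H c d \<omega>))" for \<omega>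
    unfolding power2_eq_square by (simp add: sum_product mult_ac)
  have "(\<integral>\<omega>. ((\<Sum>a\<in>J. \<Sum>b\<in>J. m a b * (g a \<omega> * g b \<omega>)) - (\<Sum>a\<in>J. m a a))\<^sup>2 \<partial>M) =
      (\<Sum>a\<in>J. \<Sum>c\<in>J. \<Sum>b\<in>J. \<Sum>d\<in>J. (m a b * m c d) * (of_bool (a = c) * of_bool (b = d) + of_bool (a = d) * of_bool (b = c)))"
    unfolding sq by (simp add: int EHH)
  also have "\<dots> = (\<Sum>a\<in>J. \<Sum>b\<in>J. m a b * m a b) + (\<Sum>a\<in>J. \<Sum>b\<in>J. m a b * m b a)"
  proof -
    have 1: "(\<Sum>b\<in>J. \<Sum>d\<in>J. (m a b * m c d) * (of_bool (a = c) * of_bool (b = d))) =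
        of_bool (c = a) * (\<Sum>b\<in>J. m a b * m c b)" if "a \<in> J" "c \<in> J" for a c
      using fin that by (auto simp: of_bool_def if_distrib[of "\<lambda>x. _ * x"] cong: if_cong)
    have 2: "(\<Sum>b\<in>J. \<Sum>d\<in>J. (m a b * m c d) * (of_bool (a = d) * of_bool (b = c))) = m a c * m c a"
      if "a \<in> J" "c \<in> J" for a c
    proof -
      have "(\<Sum>d\<in>J. (m a b * m c d) * (of_bool (a = d) * of_bool (b = c))) =
          (if b = c then m a c * m c a else 0)" for b
        using fin that by (simp add: of_bool_def if_distrib[of "\<lambda>x. _ * x"] cong: if_cong)
      thus ?thesis using fin that by simp
    qed
    show ?thesis
      unfolding distrib_left sum.distrib using fin by (simp add: 1 2)
  qed
  also have "\<dots> = 2 * (\<Sum>a\<in>J. \<Sum>b\<in>J. (m a b)\<^sup>2)"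
    using sym by (simp add: power2_eq_square)
  finally show ?thesis .
qed

end

section \<open>The chaos components of a sum of zonal functions\<close>

text \<open>The usual argument for Caratheodory functions: rounding y down to a grid of mesh 1 / Suc
  k leaves countably many measurable pieces, and continuity in y gives the limit. Measurability in
  \<omega> of integrals over the box rests on it.\<close>

lemma borel_measurable_pair_continuous:
  fixes F :: "real \<times> real \<Rightarrow> 'w \<Rightarrow> real"
  assumes meas: "\<And>y. F y \<in> borel_measurable M" and cont: "\<And>\<omega>. continuous_on UNIV (\<lambda>y. F y \<omega>)"
  shows "(\<lambda>x. F (snd x) (fst x)) \<in> borel_measurable (M \<Otimes>\<^sub>M lborel)"
proof (rule borel_measurable_LIMSEQ_real)
  fix k :: nat
  define R where "R = M \<Otimes>\<^sub>M (lborel :: (real \<times> real) measure)"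
  have fl1: "(\<lambda>x. \<lfloor>Suc k * fst (snd x)\<rfloor>) \<in> R \<rightarrow>\<^sub>M count_space UNIV"
    unfolding R_def lborel_prod[symmetric] by measurable
  have fl2: "(\<lambda>x. \<lfloor>Suc k * snd (snd x)\<rfloor>) \<in> R \<rightarrow>\<^sub>M count_space UNIV"
    unfolding R_def lborel_prod[symmetric] by measurable
  have "(\<lambda>x. F (of_int a / Suc k, of_int b / Suc k) (fst x)) \<in> borel_measurable R" for a b :: int
    unfolding R_def using meas by measurable
  from measurable_compose_countable[OF this fl2]
  have "(\<lambda>x. F (of_int a / Suc k, of_int \<lfloor>Suc k * snd (snd x)\<rfloor> / Suc k) (fst x)) \<in> borel_measurable R" for a :: int .
  from measurable_compose_countable[OF this fl1]
  show "(\<lambda>x. F (of_int \<lfloor>Suc k * fst (snd x)\<rfloor> / Suc k, of_int \<lfloor>Suc k * snd (snd x)\<rfloor> / Suc k) (fst x))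
      \<in> borel_measurable (M \<Otimes>\<^sub>M lborel)"
    unfolding R_def .
next
  fix x :: "'w \<times> real \<times> real"
  have lim: "(\<lambda>k. of_int \<lfloor>real (Suc k) * r\<rfloor> / real (Suc k)) \<longlonglongrightarrow> r" for r :: real
  proof (rule tendsto_sandwich)
    show "\<forall>\<^sub>F k in sequentially. r - 1 / real (Suc k) \<le> of_int \<lfloor>real (Suc k) * r\<rfloor> / real (Suc k)"
    proof (rule always_eventually, rule allI)
      fix k
      have "real (Suc k) * r - 1 \<le> of_int \<lfloor>real (Suc k) * r\<rfloor>" by linarith
      hence "(real (Suc k) * r - 1) / real (Suc k) \<le> of_int \<lfloor>real (Suc k) * r\<rfloor> / real (Suc k)"
        by (rule divide_right_mono) simp
      thus "r - 1 / real (Suc k) \<le> of_int \<lfloor>real (Suc k) * r\<rfloor> / real (Suc k)"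
        by (simp add: diff_divide_distrib del: of_nat_Suc)
    qed
    show "\<forall>\<^sub>F k in sequentially. of_int \<lfloor>real (Suc k) * r\<rfloor> / real (Suc k) \<le> r"
    proof (rule always_eventually, rule allI)
      fix k
      have "of_int \<lfloor>real (Suc k) * r\<rfloor> \<le> real (Suc k) * r" by linarith
      thus "of_int \<lfloor>real (Suc k) * r\<rfloor> / real (Suc k) \<le> r"
        by (simp add: field_simps del: of_nat_Suc)
    qed
    have "(\<lambda>k. 1 / real (Suc k)) \<longlonglongrightarrow> 0"
      using LIMSEQ_inverse_real_of_nat by (simp add: inverse_eq_divide)
    from tendsto_diff[OF tendsto_const this, of r]
    show "(\<lambda>k. r - 1 / real (Suc k)) \<longlonglongrightarrow> r" by simp
  qed auto
  have "isCont (\<lambda>y. F y (fst x)) (snd x)"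
    using cont[of "fst x"] continuous_on_eq_continuous_at[OF open_UNIV] by blast
  moreover have "(\<lambda>k. (of_int \<lfloor>real (Suc k) * fst (snd x)\<rfloor> / real (Suc k), of_int \<lfloor>real (Suc k) * snd (snd x)\<rfloor> / real (Suc k)))
      \<longlonglongrightarrow> (fst (snd x), snd (snd x))"
    by (intro tendsto_Pair lim)
  ultimately show "(\<lambda>k. F (of_int \<lfloor>real (Suc k) * fst (snd x)\<rfloor> / real (Suc k),
      of_int \<lfloor>real (Suc k) * snd (snd x)\<rfloor> / real (Suc k)) (fst x)) \<longlonglongrightarrow> F (snd x) (fst x)"
    using isCont_tendsto_compose by fastforce
qed

text \<open>Turns the derivatives in \<open>nd1\<close> and \<open>nd2\<close> into limits of
  sequences of measurable functions.\<close>

lemma deriv_LIMSEQ: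
  assumes "(g :: real \<Rightarrow> real) differentiable (at x)"
  shows "(\<lambda>k. (g (x + 1 / real (Suc k)) - g x) / (1 / real (Suc k))) \<longlonglongrightarrow> deriv g x"
proof -
  have "((\<lambda>h. (g (x + h) - g x) / h) \<longlongrightarrow> deriv g x) (at 0)"
    using assms by (simp add: DERIV_deriv_iff_real_differentiable[symmetric] DERIV_def)
  moreover have "filterlim (\<lambda>k. 1 / real (Suc k)) (at 0) sequentially"
    unfolding filterlim_at using LIMSEQ_inverse_real_of_nat by (simp add: inverse_eq_divide)
  ultimately show ?thesis by (rule filterlim_compose)
qed

lemma borel_measurable_hermite [measurable]: "hermite n \<in> borel_measurable borel"
proof (induction n rule: legendre_poly.induct)
  case (3 n)
  thus ?case by (simp add: hermite.simps(3)[abs_def])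
qed (simp_all add: hermite.simps(1,2)[abs_def])

section \<open>The first two chaos components as integrals of zonal functions\<close>

lemma lrange_simps: "finite (lrange j)" "lrange j \<subseteq> {1..}"
  by (auto simp: lrange_def intro: le_trans[OF one_le_power])

text \<open>No other values occur up to chaos order 2. Terms with an odd derivative index drop out,
  and the ratio 1/2 weighs the derivative part of the second chaos.\<close>

lemma alpha_values: "alpha 0 0 = sqrt (pi / 2)" "alpha 2 0 = sqrt (pi / 2) / 2" "alpha 0 2 = sqrt (pi / 2) / 2"
  "alpha (Suc 0) 0 = 0" "alpha 0 (Suc 0) = 0" "alpha (Suc 0) (Suc 0) = 0"
  by (simp_all add: alpha_def Let_def fact_numeral)

lemma proj_chaos_one:
  "proj_chaos b C f j z 1 \<omega> = sqrt (Aw b C j) * (sqrt (pi / 2) * hermite_beta 1 z *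
     (LINT y:{0..pi} \<times> {0..2*pi}|lborel. nneedlet b C f j (sph (fst y) (snd y)) \<omega> * sin (fst y)))"
  by (simp add: proj_chaos_def alpha_values)

lemma proj_chaos_two:
  "proj_chaos b C f j z 2 \<omega> = sqrt (Aw b C j) * sqrt (pi / 2) * std_normal_density z / 2 *
     ((z\<^sup>2 - 1) * (LINT y:{0..pi} \<times> {0..2*pi}|lborel.
          ((nneedlet b C f j (sph (fst y) (snd y)) \<omega>)\<^sup>2 - 1) * sin (fst y)) +
      ((LINT y:{0..pi} \<times> {0..2*pi}|lborel. ((nd1 b C f j (fst y) (snd y) \<omega>)\<^sup>2 - 1) * sin (fst y)) +
       (LINT y:{0..pi} \<times> {0..2*pi}|lborel. ((nd2 b C f j (fst y) (snd y) \<omega>)\<^sup>2 - 1) * sin (fst y))) / 2)"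
proof -
  have h2: "hermite (Suc (Suc 0)) x = x\<^sup>2 - 1" for x by (simp add: power2_eq_square)
  have a2: "alpha (Suc (Suc 0)) 0 = sqrt (pi / 2) / 2" "alpha 0 (Suc (Suc 0)) = sqrt (pi / 2) / 2"
    using alpha_values(2,3) by (simp_all add: numeral_2_eq_2)
  show ?thesis
    unfolding proj_chaos_def
    by (simp add: numeral_2_eq_2 alpha_values a2 hermite_beta_def h2 del: hermite.simps(3))
      (simp add: field_simps)
qed

text \<open>Here \<omega> is fixed. Agreement with zonal functions on the sphere suffices, and each
  degree in \<open>lrange j\<close> is at least 1, so each has mean zero.\<close>

lemma proj_chaos_one_zonal:
  assumes f: "\<And>l t s. l \<in> lrange j \<Longrightarrow> f l (sph t s) \<omega> = h l (sph t s)"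
    and zonal: "\<And>l. l \<in> lrange j \<Longrightarrow> zonal l (h l) (G l)"
  shows "proj_chaos b C f j z 1 \<omega> = 0"
proof -
  define c where "c l = b (real l / 2 ^ j) / sqrt (Bw b C j)" for l
  have "nneedlet b C f j (sph t s) \<omega> = (\<Sum>l\<in>lrange j. c l * h l (sph t s))" for t s
    by (simp add: nneedlet_def needlet_def c_def f sum_divide_distrib)
  hence "(LINT y:{0..pi} \<times> {0..2*pi}|lborel. nneedlet b C f j (sph (fst y) (snd y)) \<omega> * sin (fst y)) =
      sph_int (\<lambda>p. \<Sum>l\<in>lrange j. c l * h l p)"
    by (simp add: sph_int_def)
  also have "\<dots> = (\<Sum>l\<in>lrange j. c l * sph_int (h l))"
    using lrange_simps by (simp add: sph_int_sum sph_int_cmult continuous_on_mult_left zonal_continuous[OF zonal])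
  also have "\<dots> = 0"
    using lrange_simps[of j] by (intro sum.neutral ballI) (auto simp: zonal_mean_zero[OF zonal])
  finally show ?thesis unfolding proj_chaos_one by simp
qed

text \<open>The coefficient of the integral of f_l^2 in the second chaos: z^2 - 1 stems from H_2 of
  the field, the other summand from the gradient, whose energy is l(l+1) times that
  integral.\<close>

definition chaos_weight :: "(real \<Rightarrow> real) \<Rightarrow> (nat \<Rightarrow> real) \<Rightarrow> nat \<Rightarrow> real \<Rightarrow> nat \<Rightarrow> real" where
  "chaos_weight b C j z l = (b (real l / 2 ^ j))\<^sup>2 / Bw b C j *
     ((z\<^sup>2 - 1) + real l * (real l + 1) / (2 * Aw b C j))"

text \<open>The constant 4 pi z^2 is 4 pi (z^2 - 1) from the field plus half of 8 pi from the two
  derivatives; it will turn out to be the mean of the sum.\<close>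

lemma proj_chaos_two_zonal:
  assumes f: "\<And>l t s. l \<in> lrange j \<Longrightarrow> f l (sph t s) \<omega> = h l (sph t s)"
    and zonal: "\<And>l. l \<in> lrange j \<Longrightarrow> zonal l (h l) (G l)"
    and AB: "Aw b C j > 0" "Bw b C j > 0"
  shows "proj_chaos b C f j z 2 \<omega> = sqrt (Aw b C j) * sqrt (pi / 2) * std_normal_density z / 2 *
     ((\<Sum>l\<in>lrange j. chaos_weight b C j z l * sph_int (\<lambda>p. (h l p)\<^sup>2)) - 4 * pi * z\<^sup>2)"
proof -
  define c where "c l = b (real l / 2 ^ j) / sqrt (Bw b C j)" for l
  define A where "A = Aw b C j"
  define H where "H p = (\<Sum>l\<in>lrange j. c l * h l p)" for p
  define K where "K p = (\<Sum>l\<in>lrange j. c l *\<^sub>R G l p)" for p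
  have A: "A > 0" using AB by (simp add: A_def)
  have contH: "continuous_on UNIV H" and contK: "continuous_on UNIV K"
    unfolding H_def K_def by (auto intro!: continuous_intros zonal_continuous[OF zonal])
  have derH: "(H has_derivative (\<lambda>v. K p \<bullet> v)) (at p)" for p
  proof -
    have "(H has_derivative (\<lambda>v. \<Sum>l\<in>lrange j. c l * (G l p \<bullet> v))) (at p)"
      unfolding H_def by (intro has_derivative_sum has_derivative_mult_right zonal_has_derivative[OF zonal])
    thus ?thesis by (simp add: K_def inner_sum_left)
  qed
  \<comment> \<open>The expansion is known only on the sphere; the coordinate curves stay there,
    which is enough to differentiate along them.\<close>
  have N: "nneedlet b C f j (sph t s) \<omega> = H (sph t s)" for t s
    by (simp add: nneedlet_def needlet_def c_def f H_def sum_divide_distrib)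
  have chain: "((\<lambda>x. H (g x)) has_real_derivative K (g x) \<bullet> g') (at x)"
    if "(g has_vector_derivative g') (at x)" for g g' x
    using has_derivative_compose[OF that[unfolded has_vector_derivative_def] derH]
    by (simp add: has_field_derivative_def mult.commute[of _ "K _ \<bullet> _"])
  have n1: "nd1 b C f j t s \<omega> = (K (sph t s) \<bullet> sph_theta t s) / sqrt A" for t s
    unfolding nd1_def N A_def[symmetric]
    using DERIV_imp_deriv[OF chain[OF sph_has_vector_derivative(1)]] by simp
  have n2: "nd2 b C f j t s \<omega> = sin t * (K (sph t s) \<bullet> sph_phi s) / sin t / sqrt A" for t s
    unfolding nd2_def N A_def[symmetric]
    using DERIV_imp_deriv[OF chain[OF sph_has_vector_derivative(2)]] by simp
  have I0: "(LINT y:{0..pi} \<times> {0..2*pi}|lborel. ((nneedlet b C f j (sph (fst y) (snd y)) \<omega>)\<^sup>2 - 1) * sin (fst y))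
      = (\<Sum>l\<in>lrange j. (c l)\<^sup>2 * sph_int (\<lambda>p. (h l p)\<^sup>2)) - 4 * pi"
  proof -
    have "(LINT y:{0..pi} \<times> {0..2*pi}|lborel. ((nneedlet b C f j (sph (fst y) (snd y)) \<omega>)\<^sup>2 - 1) * sin (fst y))
        = sph_int (\<lambda>p. (H p)\<^sup>2 + (-1) * 1)"
      by (simp add: sph_int_def N)
    also have "\<dots> = sph_int (\<lambda>p. (H p)\<^sup>2) + (-1) * sph_int (\<lambda>p. 1)"
      by (subst sph_int_add) (auto simp only: sph_int_cmult intro!: continuous_intros contH)
    finally show ?thesis
      using zonal_expansion_energy(1)[OF lrange_simps(1) zonal, where c = c] by (simp add: H_def sph_int_one)
  qed
  have I12: "(LINT y:{0..pi} \<times> {0..2*pi}|lborel. ((nd1 b C f j (fst y) (snd y) \<omega>)\<^sup>2 - 1) * sin (fst y)) +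
       (LINT y:{0..pi} \<times> {0..2*pi}|lborel. ((nd2 b C f j (fst y) (snd y) \<omega>)\<^sup>2 - 1) * sin (fst y))
     = (\<Sum>l\<in>lrange j. (c l)\<^sup>2 * (real l * (real l + 1)) * sph_int (\<lambda>p. (h l p)\<^sup>2)) / A - 8 * pi"
    (is "?I1 + ?I2 = _")
  proof -
    have "?I1 = (LINT y:{0..pi} \<times> {0..2*pi}|lborel.
        ((K (sph (fst y) (snd y)) \<bullet> sph_theta (fst y) (snd y))\<^sup>2 / A - 1) * sin (fst y))"
      using A by (simp add: n1 power_divide)
    \<comment> \<open>Where sin t = 0, division by zero makes \<open>nd2\<close> equal to 0 instead
      of a directional derivative; the surface factor sin t removes the difference.\<close>
    moreover have "((nd2 b C f j t s \<omega>)\<^sup>2 - 1) * sin t = ((K (sph t s) \<bullet> sph_phi s)\<^sup>2 / A - 1) * sin t" for t s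
      using A by (cases "sin t = 0") (simp_all add: n2 power_divide)
    ultimately have "?I1 + ?I2 = (LINT y:{0..pi} \<times> {0..2*pi}|lborel.
        ((K (sph (fst y) (snd y)) \<bullet> sph_theta (fst y) (snd y))\<^sup>2 / A - 1) * sin (fst y)) +
        (LINT y:{0..pi} \<times> {0..2*pi}|lborel.
        ((K (sph (fst y) (snd y)) \<bullet> sph_phi (snd y))\<^sup>2 / A - 1) * sin (fst y))"
      by presburger
    also have "\<dots> = (LINT y:{0..pi} \<times> {0..2*pi}|lborel.
        ((K (sph (fst y) (snd y)) \<bullet> sph_theta (fst y) (snd y))\<^sup>2 / A - 1) * sin (fst y) +
        ((K (sph (fst y) (snd y)) \<bullet> sph_phi (snd y))\<^sup>2 / A - 1) * sin (fst y))"
      by (rule set_integral_add(2)[symmetric]; rule continuous_set_integrable_box)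
        (use A in \<open>auto intro!: continuous_intros continuous_on_compose2[OF contK]\<close>)
    also have "\<dots> = sph_int (\<lambda>p. 1 / A * sph_dirichlet K K p + (-2) * 1)"
    proof -
      have "((K (sph t s) \<bullet> sph_theta t s)\<^sup>2 / A - 1) * sin t + ((K (sph t s) \<bullet> sph_phi s)\<^sup>2 / A - 1) * sin t
          = (1 / A * sph_dirichlet K K (sph t s) + (-2) * 1) * sin t" for t s
        unfolding sph_dirichlet_def power2_eq_square sph_frame_inner[symmetric]
        by (simp add: algebra_simps add_divide_distrib)
      thus ?thesis unfolding sph_int_def by simp
    qed
    also have "\<dots> = 1 / A * sph_int (sph_dirichlet K K) + (-2) * sph_int (\<lambda>p. 1)"
      unfolding sph_dirichlet_def
      by (subst sph_int_add) (auto simp only: sph_int_cmult intro!: continuous_intros contK)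
    finally show ?thesis
      using zonal_expansion_energy(2)[OF lrange_simps(1) zonal, where c = c]
      by (simp add: K_def[abs_def] sph_int_one)
  qed
  have "(z\<^sup>2 - 1) * ((\<Sum>l\<in>lrange j. (c l)\<^sup>2 * sph_int (\<lambda>p. (h l p)\<^sup>2)) - 4 * pi) +
      ((\<Sum>l\<in>lrange j. (c l)\<^sup>2 * (real l * (real l + 1)) * sph_int (\<lambda>p. (h l p)\<^sup>2)) / A - 8 * pi) / 2 =
      (\<Sum>l\<in>lrange j. (z\<^sup>2 - 1) * ((c l)\<^sup>2 * sph_int (\<lambda>p. (h l p)\<^sup>2)) +
        (c l)\<^sup>2 * (real l * (real l + 1)) * sph_int (\<lambda>p. (h l p)\<^sup>2) / (2 * A)) - 4 * pi * z\<^sup>2"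
    unfolding sum.distrib sum_distrib_left[symmetric] sum_divide_distrib[symmetric] by (simp add: field_simps)
  also have "(\<Sum>l\<in>lrange j. (z\<^sup>2 - 1) * ((c l)\<^sup>2 * sph_int (\<lambda>p. (h l p)\<^sup>2)) +
        (c l)\<^sup>2 * (real l * (real l + 1)) * sph_int (\<lambda>p. (h l p)\<^sup>2) / (2 * A)) =
      (\<Sum>l\<in>lrange j. chaos_weight b C j z l * sph_int (\<lambda>p. (h l p)\<^sup>2))"
    using AB by (intro sum.cong refl) (simp add: chaos_weight_def c_def A_def power_divide algebra_simps
        add_divide_distrib diff_divide_distrib)
  finally show ?thesis
    unfolding proj_chaos_two I0 I12 by simp
qed

section \<open>Gaussian random harmonics\<close>

definition harmonic_variance :: "(nat \<Rightarrow> real) \<Rightarrow> nat \<Rightarrow> real" where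
  "harmonic_variance C l = C l * (2 * real l + 1) / (4 * pi)"

text \<open>Differentiability of paths serves twice: for continuity, which allows passing from a
  dense set to the whole sphere, and for measurability of the derivatives in
  \<open>proj_chaos\<close>.\<close>

locale gaussian_harmonics = prob_space M for M :: "'w measure" +
  fixes f :: "nat \<Rightarrow> real^3 \<Rightarrow> 'w \<Rightarrow> real" and C :: "nat \<Rightarrow> real"
  assumes f_meas: "f l p \<in> borel_measurable M"
    and f_gauss: "finite S \<Longrightarrow> S \<subseteq> {1..} \<times> sphere 0 1 \<Longrightarrow>
        (\<integral>\<omega>. cis (\<Sum>(l, p)\<in>S. c (l, p) * f l p \<omega>) \<partial>M) =
        complex_of_real (exp (- (\<Sum>(l, p)\<in>S. \<Sum>(l', q)\<in>S.
            (if l = l' then c (l, p) * c (l', q) * C l * (2 * real l + 1) / (4 * pi)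
                 * legendre l (p \<bullet> q) else 0)) / 2))"
    and f_diff: "l \<ge> 1 \<Longrightarrow> (\<lambda>q. f l q \<omega>) differentiable (at p)"
begin

definition kern :: "nat \<Rightarrow> real^3 \<Rightarrow> real^3 \<Rightarrow> real" where
  "kern l p q = harmonic_variance C l * legendre l (p \<bullet> q)"

lemma kern_commute: "kern l p q = kern l q p"
  by (simp add: kern_def inner_commute)

text \<open>Grouping the index set by degree makes the covariance block diagonal; this is the
  independence of the multipoles.\<close>

lemma f_char:
  assumes L: "finite L" "L \<subseteq> {1..}" and T: "\<And>l. l \<in> L \<Longrightarrow> finite (T l)" "\<And>l. l \<in> L \<Longrightarrow> T l \<subseteq> sphere 0 1"
  shows "(\<integral>\<omega>. cis (\<Sum>l\<in>L. \<Sum>p\<in>T l. c l p * f l p \<omega>) \<partial>M) =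
    complex_of_real (exp (- (\<Sum>l\<in>L. \<Sum>p\<in>T l. \<Sum>q\<in>T l. c l p * c l q * kern l p q) / 2))"
proof -
  define S where "S = Sigma L T"
  have S: "finite S" "S \<subseteq> {1..} \<times> sphere 0 1"
    using L T by (auto simp: S_def)
  have sumS: "(\<Sum>(l, p)\<in>S. g l p) = (\<Sum>l\<in>L. \<Sum>p\<in>T l. g l p)" for g :: "nat \<Rightarrow> real^3 \<Rightarrow> real"
    unfolding S_def using L T by (subst sum.Sigma) auto
  have inner: "(\<Sum>l'\<in>L. \<Sum>q\<in>T l'. if l = l' then c l p * c l' q * C l * (2 * real l + 1) / (4 * pi)
      * legendre l (p \<bullet> q) else 0) = (\<Sum>q\<in>T l. c l p * c l q * kern l p q)" if "l \<in> L" for l p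
  proof -
    have "(\<Sum>l'\<in>L. \<Sum>q\<in>T l'. if l = l' then c l p * c l' q * C l * (2 * real l + 1) / (4 * pi)
      * legendre l (p \<bullet> q) else 0) = (\<Sum>l'\<in>L. if l = l' then (\<Sum>q\<in>T l'. c l p * c l' q * kern l p q) else 0)"
      by (intro sum.cong refl) (auto simp: kern_def harmonic_variance_def mult.assoc)
    thus ?thesis using L(1) that by simp
  qed
  show ?thesis
    using f_gauss[OF S, of "\<lambda>(l, p). c l p"] unfolding sumS prod.case
    by (simp add: inner)
qed

text \<open>A characteristic function has modulus at most 1, so exp(-q/2) \<le> 1 for each value q
  of the quadratic form. Positivity thus comes from the existence of the field.\<close>

lemma kern_psd:
  assumes "l \<ge> 1"
  shows "psd_kernel (sphere 0 1) (kern l)"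
  unfolding psd_kernel_def
proof (intro conjI ballI allI impI)
  fix T :: "(real^3) set" and c :: "real^3 \<Rightarrow> real" assume T: "finite T" "T \<subseteq> sphere 0 1"
  have "(\<integral>\<omega>. cis (\<Sum>p\<in>T. c p * f l p \<omega>) \<partial>M) =
      complex_of_real (exp (- (\<Sum>p\<in>T. \<Sum>q\<in>T. c p * c q * kern l p q) / 2))"
    using f_char[of "{l}" "\<lambda>_. T" "\<lambda>_. c"] T assms by simp
  moreover have "norm (\<integral>\<omega>. cis (\<Sum>p\<in>T. c p * f l p \<omega>) \<partial>M) \<le> (\<integral>\<omega>. norm (cis (\<Sum>p\<in>T. c p * f l p \<omega>)) \<partial>M)"
    by (rule integral_norm_bound)
  ultimately show "0 \<le> (\<Sum>s\<in>T. \<Sum>t\<in>T. c s * c t * kern l s t)"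
    by (simp add: prob_space)
qed (rule kern_commute)

text \<open>Weights annihilated by the covariance matrix give a combination of variance 0; this is
  how laws produce linear relations between sample values.\<close>

lemma AE_zero_variance:
  assumes "l \<ge> 1" "finite T" "T \<subseteq> sphere 0 1" "\<And>s. s \<in> T \<Longrightarrow> (\<Sum>t\<in>T. c t * kern l s t) = 0"
  shows "AE \<omega> in M. (\<Sum>t\<in>T. c t * f l t \<omega>) = 0"
proof (rule char_gaussian(5))
  show "(\<lambda>\<omega>. \<Sum>t\<in>T. c t * f l t \<omega>) \<in> borel_measurable M"
    using f_meas by measurable
  fix r :: real
  have "(\<Sum>s\<in>T. \<Sum>t\<in>T. (r * c s) * (r * c t) * kern l s t) = (\<Sum>s\<in>T. (r * c s) * r * (\<Sum>t\<in>T. c t * kern l s t))"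
    by (simp add: sum_distrib_left mult_ac)
  also have "\<dots> = 0" by (simp add: assms(4))
  finally have "(\<Sum>s\<in>T. \<Sum>t\<in>T. (r * c s) * (r * c t) * kern l s t) = 0" .
  hence "(\<integral>\<omega>. cis (\<Sum>p\<in>T. (r * c p) * f l p \<omega>) \<partial>M) = 1"
    using f_char[of "{l}" "\<lambda>_. T" "\<lambda>_ p. r * c p"] assms(1-3) by simp
  thus "(\<integral>\<omega>. cis (r * (\<Sum>t\<in>T. c t * f l t \<omega>)) \<partial>M) = complex_of_real (exp (- (r\<^sup>2 * 0) / 2))"
    by (simp add: sum_distrib_left mult.assoc)
qed auto

lemma continuous_on_f:
  assumes "l \<ge> 1"
  shows "continuous_on A (\<lambda>q. f l q \<omega>)"
  using f_diff[OF assms]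
  by (intro continuous_at_imp_continuous_on ballI differentiable_imp_continuous_within) auto

text \<open>The \<open>Y l i\<close> are orthonormalised combinations of kernel columns, and \<xi>
  applies the same combinations to f_l. Orthonormality makes the \<xi> standard and independent;
  since the kernel is reproduced, the remainder of f_l has variance 0 at each point.\<close>

lemma harmonic_expansion:
  obtains Y G and n :: "nat \<Rightarrow> nat" and \<xi>
  where "\<And>l i. l \<ge> 1 \<Longrightarrow> zonal l (Y l i) (G l i)"
    and "\<And>l p q. l \<ge> 1 \<Longrightarrow> p \<in> sphere 0 1 \<Longrightarrow> q \<in> sphere 0 1 \<Longrightarrow> kern l p q = (\<Sum>i<n l. Y l i p * Y l i q)"
    and "\<And>l. l \<ge> 1 \<Longrightarrow> AE \<omega> in M. \<forall>t s. f l (sph t s) \<omega> = (\<Sum>i<n l. \<xi> (l, i) \<omega> * Y l i (sph t s))"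
    and "\<And>L. finite L \<Longrightarrow> L \<subseteq> {1..} \<Longrightarrow> std_gaussian_family (SIGMA l:L. {..<n l}) \<xi>"
proof -
  define P where "P l n T D \<longleftrightarrow> finite T \<and> T \<subseteq> sphere 0 1 \<and>
     (\<forall>p\<in>sphere 0 1. \<forall>q\<in>sphere 0 1. kern l p q = (\<Sum>i<n. (\<Sum>t\<in>T. D i t * kern l p t) * (\<Sum>t\<in>T. D i t * kern l q t))) \<and>
     (\<forall>i<n. \<forall>k<n. (\<Sum>s\<in>T. \<Sum>t\<in>T. D i s * D k t * kern l s t) = (if i = k then 1 else 0))"
    for l and n :: nat and T D
  have "\<exists>n T D. P l n T D" if "l \<ge> 1" for l
    unfolding P_def
    by (intro psd_kernel_orthonormal_expansion kern_psd that)
      (unfold kern_def, rule finite_rank_legendre)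
  then obtain n T D where P: "\<And>l. l \<ge> 1 \<Longrightarrow> P l (n l) (T l) (D l)"
    by metis
  define Y where "Y l i p = (\<Sum>t\<in>T l. D l i t * kern l p t)" for l i p
  define G where "G l i p = (\<Sum>t\<in>T l. ((D l i t * harmonic_variance C l) * legendre_deriv l (p \<bullet> t)) *\<^sub>R t)" for l i p
  define \<xi> where "\<xi> = (\<lambda>(l, i) \<omega>. \<Sum>t\<in>T l. D l i t * f l t \<omega>)"
  have T: "finite (T l)" "T l \<subseteq> sphere 0 1" if "l \<ge> 1" for l
    using P[OF that] by (simp_all add: P_def)
  have K: "kern l p q = (\<Sum>i<n l. Y l i p * Y l i q)" if "l \<ge> 1" "p \<in> sphere 0 1" "q \<in> sphere 0 1" for l p q
    using P[OF that(1)] that(2,3) unfolding P_def Y_def by blast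
  have orth: "(\<Sum>s\<in>T l. \<Sum>t\<in>T l. D l i s * D l k t * kern l s t) = (if i = k then 1 else 0)"
    if "l \<ge> 1" "i < n l" "k < n l" for l i k
    using P[OF that(1)] that(2,3) unfolding P_def by blast
  have zon: "zonal l (Y l i) (G l i)" if "l \<ge> 1" for l i
    unfolding zonal_def
    using T[OF that]
    by (intro exI[of _ "T l"] exI[of _ "\<lambda>t. D l i t * harmonic_variance C l"])
      (simp add: Y_def G_def kern_def fun_eq_iff mult.assoc)
  have AE: "AE \<omega> in M. \<forall>t s. f l (sph t s) \<omega> = (\<Sum>i<n l. \<xi> (l, i) \<omega> * Y l i (sph t s))"
    if l: "l \<ge> 1" for l
  proof -
    have pt: "AE \<omega> in M. f l p \<omega> = (\<Sum>i<n l. \<xi> (l, i) \<omega> * Y l i p)" if p: "p \<in> sphere 0 1" for p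
    proof -
      \<comment> \<open>The weights of the remainder f_l(p) minus its expansion, over
        \<open>insert p (T l)\<close>; p may already lie in \<open>T l\<close>.\<close>
      define c where "c t = of_bool (t = p) - of_bool (t \<in> T l) * (\<Sum>i<n l. Y l i p * D l i t)" for t
      have c: "(\<Sum>t\<in>insert p (T l). c t * g t) = g p - (\<Sum>i<n l. (\<Sum>t\<in>T l. D l i t * g t) * Y l i p)" for g
      proof -
        have "(\<Sum>t\<in>insert p (T l). c t * g t) = (\<Sum>t\<in>insert p (T l). of_bool (t = p) * g t)
            - (\<Sum>t\<in>insert p (T l). of_bool (t \<in> T l) * (\<Sum>i<n l. Y l i p * D l i t) * g t)"
          by (simp add: c_def left_diff_distrib sum_subtractf)
        also have "(\<Sum>t\<in>insert p (T l). of_bool (t = p) * g t) = g p"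
          using T(1)[OF l] by simp
        also have "(\<Sum>t\<in>insert p (T l). of_bool (t \<in> T l) * (\<Sum>i<n l. Y l i p * D l i t) * g t) =
            (\<Sum>t\<in>T l. \<Sum>i<n l. (D l i t * g t) * Y l i p)"
          using T(1)[OF l] by (intro sum.mono_neutral_cong_right) (auto simp: sum_distrib_left mult_ac)
        also have "\<dots> = (\<Sum>i<n l. (\<Sum>t\<in>T l. D l i t * g t) * Y l i p)"
          by (subst sum.swap) (simp add: sum_distrib_right)
        finally show ?thesis .
      qed
      have "(\<Sum>t\<in>insert p (T l). c t * kern l s t) = 0" if "s \<in> insert p (T l)" for s
      proof -
        have s: "s \<in> sphere 0 1" using that p T(2)[OF l] by auto
        have "(\<Sum>t\<in>insert p (T l). c t * kern l s t) = kern l s p - (\<Sum>i<n l. Y l i s * Y l i p)"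
          unfolding c Y_def ..
        thus ?thesis using K[OF l s p] by simp
      qed
      hence "AE \<omega> in M. (\<Sum>t\<in>insert p (T l). c t * f l t \<omega>) = 0"
        using T[OF l] p by (intro AE_zero_variance l) auto
      thus ?thesis
        unfolding c \<xi>_def by simp
    qed
    \<comment> \<open>The null set depends on p, so countably many parameters are treated at once.
      The set where two continuous functions differ is open; missing a dense set, it is
      empty.\<close>
    obtain A :: "(real \<times> real) set" where A: "countable A" "\<And>U. open U \<Longrightarrow> U \<noteq> {} \<Longrightarrow> \<exists>d\<in>A. d \<in> U"
      using countable_dense_exists by blast
    have "AE \<omega> in M. \<forall>y\<in>A. f l (sph (fst y) (snd y)) \<omega> = (\<Sum>i<n l. \<xi> (l, i) \<omega> * Y l i (sph (fst y) (snd y)))"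
      using A(1) by (subst AE_ball_countable) (auto intro!: pt[OF sph_in_sphere])
    thus ?thesis
    proof eventually_elim
      case (elim \<omega>)
      define U where "U = {y. f l (sph (fst y) (snd y)) \<omega> \<noteq> (\<Sum>i<n l. \<xi> (l, i) \<omega> * Y l i (sph (fst y) (snd y)))}"
      have "open U"
        unfolding U_def
        by (intro open_Collect_neq continuous_intros continuous_on_compose2[OF continuous_on_f[OF l, of UNIV]]
            continuous_on_compose2[OF zonal_continuous(1)[OF zon[OF l], of UNIV]]) auto
      hence "U = {}" using A(2)[of U] elim by (auto simp: U_def)
      thus ?case by (auto simp: U_def)
    qed
  qed
  have fam: "std_gaussian_family (SIGMA l:L. {..<n l}) \<xi>" if L: "finite L" "L \<subseteq> {1..}" for L
    unfolding std_gaussian_family_def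
  proof (intro conjI ballI allI)
    show "finite (SIGMA l:L. {..<n l})" using L by auto
    show "\<xi> x \<in> borel_measurable M" for x
      unfolding \<xi>_def case_prod_unfold using f_meas by measurable
    fix c :: "nat \<times> nat \<Rightarrow> real"
    \<comment> \<open>Collecting the coefficient of each value of f_l puts a combination of the
      \<xi> into the form required by \<open>f_char\<close>.\<close>
    define e where "e l t = (\<Sum>i<n l. c (l, i) * D l i t)" for l t
    have sumS: "(\<Sum>x\<in>(SIGMA l:L. {..<n l}). g x) = (\<Sum>l\<in>L. \<Sum>i<n l. g (l, i))" for g :: "nat \<times> nat \<Rightarrow> real"
      using L by (subst sum.Sigma) auto
    have 1: "(\<Sum>x\<in>(SIGMA l:L. {..<n l}). c x * \<xi> x \<omega>) = (\<Sum>l\<in>L. \<Sum>t\<in>T l. e l t * f l t \<omega>)" for \<omega>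
    proof -
      have "(\<Sum>i<n l. c (l, i) * \<xi> (l, i) \<omega>) = (\<Sum>t\<in>T l. e l t * f l t \<omega>)" for l
        unfolding e_def \<xi>_def prod.case sum_distrib_left sum_distrib_right
        by (subst sum.swap) (simp add: mult.assoc)
      thus ?thesis unfolding sumS by simp
    qed
    have 2: "(\<Sum>s\<in>T l. \<Sum>t\<in>T l. e l s * e l t * kern l s t) = (\<Sum>i<n l. (c (l, i))\<^sup>2)" if "l \<in> L" for l
    proof -
      have l: "l \<ge> 1" using that L by auto
      have "(\<Sum>s\<in>T l. \<Sum>t\<in>T l. e l s * e l t * kern l s t) =
          (\<Sum>s\<in>T l. \<Sum>t\<in>T l. \<Sum>i<n l. \<Sum>k<n l. (c (l, i) * c (l, k)) * (D l i s * D l k t * kern l s t))"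
        unfolding e_def sum_product unfolding sum_distrib_right by (simp add: mult_ac)
      also have "\<dots> = (\<Sum>s\<in>T l. \<Sum>i<n l. \<Sum>t\<in>T l. \<Sum>k<n l. (c (l, i) * c (l, k)) * (D l i s * D l k t * kern l s t))"
        by (intro sum.cong refl sum.swap)
      also have "\<dots> = (\<Sum>i<n l. \<Sum>s\<in>T l. \<Sum>k<n l. \<Sum>t\<in>T l. (c (l, i) * c (l, k)) * (D l i s * D l k t * kern l s t))"
        by (subst sum.swap) (intro sum.cong refl sum.swap)
      also have "\<dots> = (\<Sum>i<n l. \<Sum>k<n l. \<Sum>s\<in>T l. \<Sum>t\<in>T l. (c (l, i) * c (l, k)) * (D l i s * D l k t * kern l s t))"
        by (intro sum.cong refl sum.swap)
      also have "\<dots> = (\<Sum>i<n l. \<Sum>k<n l. (c (l, i) * c (l, k)) * (if i = k then 1 else 0))"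
        unfolding sum_distrib_left[symmetric] by (intro sum.cong refl) (simp add: orth[OF l])
      also have "\<dots> = (\<Sum>i<n l. (c (l, i))\<^sup>2)"
        by (simp add: power2_eq_square if_distrib[of "\<lambda>x. _ * x"] cong: if_cong)
      finally show ?thesis .
    qed
    show "(\<integral>\<omega>. cis (\<Sum>x\<in>(SIGMA l:L. {..<n l}). c x * \<xi> x \<omega>) \<partial>M) =
        complex_of_real (exp (- (\<Sum>x\<in>(SIGMA l:L. {..<n l}). (c x)\<^sup>2) / 2))"
      unfolding 1 sumS using L T by (subst f_char) (auto simp: 2)
  qed
  show thesis
    by (rule that[OF zon K AE fam])
qed

end

section \<open>Measurability and second moments of the chaos components\<close>

context gaussian_harmonics
begin

lemma nneedlet_joint_measurable:
  "(\<lambda>x. nneedlet b C f j (sph (fst (snd x)) (snd (snd x))) (fst x)) \<in> borel_measurable (M \<Otimes>\<^sub>M lborel)"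
proof (rule borel_measurable_pair_continuous[where F = "\<lambda>y. nneedlet b C f j (sph (fst y) (snd y))"])
  show "nneedlet b C f j (sph (fst y) (snd y)) \<in> borel_measurable M" for y
    unfolding nneedlet_def[abs_def] needlet_def[abs_def] using f_meas by measurable
  have "continuous_on UNIV (\<lambda>y. f l (sph (fst y) (snd y)) \<omega>)" if "l \<in> lrange j" for l \<omega>
    using that lrange_simps(2)[of j]
    by (intro continuous_on_compose2[OF continuous_on_f[of l UNIV]] continuous_intros) auto
  thus "continuous_on UNIV (\<lambda>y. nneedlet b C f j (sph (fst y) (snd y)) \<omega>)" for \<omega>
    unfolding nneedlet_def needlet_def divide_inverse by (intro continuous_intros)
qed

lemma nneedlet_differentiable:
  assumes "(g has_vector_derivative g') (at x)"
  shows "(\<lambda>x. nneedlet b C f j (g x) \<omega>) differentiable (at x)"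
proof -
  have "(\<lambda>x. f l (g x) \<omega>) differentiable (at x)" if "l \<in> lrange j" for l
  proof -
    have "l \<ge> 1" using that lrange_simps(2) by auto
    from f_diff[OF this, of \<omega> "g x"] show ?thesis
      using has_derivative_compose[OF assms[unfolded has_vector_derivative_def]]
      unfolding differentiable_def by blast
  qed
  thus ?thesis
    unfolding nneedlet_def needlet_def divide_inverse
    by (intro differentiable_mult differentiable_sum differentiable_const) (auto simp: lrange_simps)
qed

text \<open>The second chaos equals a polynomial in the Gaussian variables only almost surely;
  replacing it under the expectation requires measurability.\<close>

lemma proj_chaos_measurable: "proj_chaos b C f j z q \<in> borel_measurable M"
proof -
  define R where "R = M \<Otimes>\<^sub>M (lborel :: (real \<times> real) measure)"
  define N where "N y \<omega> = nneedlet b C f j (sph (fst y) (snd y)) \<omega>" for y \<omega>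
  have R1: "(\<lambda>x. N (fst (snd x) + r, snd (snd x)) (fst x)) \<in> borel_measurable R" for r
  proof -
    have "(\<lambda>x. (fst x, (fst (snd x) + r, snd (snd x)))) \<in> R \<rightarrow>\<^sub>M R"
      unfolding R_def lborel_prod[symmetric] by measurable
    from measurable_compose[OF this nneedlet_joint_measurable[folded R_def]]
    show ?thesis by (simp add: N_def)
  qed
  have R2: "(\<lambda>x. N (fst (snd x), snd (snd x) + r) (fst x)) \<in> borel_measurable R" for r
  proof -
    have "(\<lambda>x. (fst x, (fst (snd x), snd (snd x) + r))) \<in> R \<rightarrow>\<^sub>M R"
      unfolding R_def lborel_prod[symmetric] by measurable
    from measurable_compose[OF this nneedlet_joint_measurable[folded R_def]]
    show ?thesis by (simp add: N_def)
  qed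
  have R0: "(\<lambda>x. N (snd x) (fst x)) \<in> borel_measurable R"
    using R1[of 0] by simp
  have sinR: "(\<lambda>x. sin (fst (snd x))) \<in> borel_measurable R"
    unfolding R_def lborel_prod[symmetric] by measurable
  have d1: "(\<lambda>x. nd1 b C f j (fst (snd x)) (snd (snd x)) (fst x)) \<in> borel_measurable R"
  proof (rule borel_measurable_LIMSEQ_real)
    show "(\<lambda>k. (N (fst (snd x) + 1 / real (Suc k), snd (snd x)) (fst x) - N (snd x) (fst x)) / (1 / real (Suc k))
        / sqrt (Aw b C j)) \<longlonglongrightarrow> nd1 b C f j (fst (snd x)) (snd (snd x)) (fst x)" for x
      unfolding nd1_def divide_inverse[of _ "sqrt _"] N_def fst_conv snd_conv
      by (intro tendsto_mult_right
          deriv_LIMSEQ[where g = "\<lambda>t'. nneedlet b C f j (sph t' (snd (snd x))) (fst x)"]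
          nneedlet_differentiable[OF sph_has_vector_derivative(1)])
  qed (intro borel_measurable_divide borel_measurable_diff R0 R1 borel_measurable_const)
  have d2: "(\<lambda>x. nd2 b C f j (fst (snd x)) (snd (snd x)) (fst x)) \<in> borel_measurable R"
  proof (rule borel_measurable_LIMSEQ_real)
    show "(\<lambda>k. (N (fst (snd x), snd (snd x) + 1 / real (Suc k)) (fst x) - N (snd x) (fst x)) / (1 / real (Suc k))
        / sin (fst (snd x)) / sqrt (Aw b C j)) \<longlonglongrightarrow> nd2 b C f j (fst (snd x)) (snd (snd x)) (fst x)" for x
      unfolding nd2_def divide_inverse[of _ "sqrt _"] divide_inverse[of _ "sin _"] N_def fst_conv snd_conv
      by (intro tendsto_mult_right
          deriv_LIMSEQ[where g = "\<lambda>s'. nneedlet b C f j (sph (fst (snd x)) s') (fst x)"]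
          nneedlet_differentiable[OF sph_has_vector_derivative(2)])
  qed (intro borel_measurable_divide borel_measurable_diff R0 R2 borel_measurable_const sinR)
  have box: "{0..pi} \<times> {0..2*pi} \<in> sets (borel :: (real \<times> real) measure)"
    by (intro borel_closed closed_Times closed_atLeastAtMost)
  have "(\<lambda>x. indicator ({0..pi} \<times> {0..2*pi}) (snd x) *\<^sub>R
      (hermite u (N (snd x) (fst x)) * hermite k (nd1 b C f j (fst (snd x)) (snd (snd x)) (fst x)) *
       hermite l (nd2 b C f j (fst (snd x)) (snd (snd x)) (fst x)) * sin (fst (snd x)))) \<in> borel_measurable R" for u k l
  proof (intro borel_measurable_scaleR borel_measurable_times sinR)
    show "(\<lambda>x. indicator ({0..pi} \<times> {0..2*pi}) (snd x) :: real) \<in> borel_measurable R"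
      unfolding R_def using box by measurable
  qed (intro measurable_compose[OF _ borel_measurable_hermite] R0 d1 d2)+
  hence "(\<lambda>\<omega>. LINT y:{0..pi} \<times> {0..2*pi}|lborel.
      hermite u (N y \<omega>) * hermite k (nd1 b C f j (fst y) (snd y) \<omega>) *
       hermite l (nd2 b C f j (fst y) (snd y) \<omega>) * sin (fst y)) \<in> borel_measurable M" for u k l
    unfolding set_lebesgue_integral_def R_def
    by (intro lborel.borel_measurable_lebesgue_integral) (simp add: case_prod_unfold)
  thus ?thesis
    unfolding proj_chaos_def[abs_def] N_def
    by (intro borel_measurable_times borel_measurable_sum borel_measurable_const)
qed

text \<open>The sphere integral vanishes pathwise whatever the normalising factors are, so the claim
  holds for each j and not just for large ones.\<close>

lemma expectation_proj_chaos_one: "(\<integral>\<omega>. (proj_chaos b C f j z 1 \<omega>)\<^sup>2 \<partial>M) = 0"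
proof -
  obtain Y G and n :: "nat \<Rightarrow> nat" and \<xi> where Y: "\<And>l i. l \<ge> 1 \<Longrightarrow> zonal l (Y l i) (G l i)"
    and "\<And>l p q. l \<ge> 1 \<Longrightarrow> p \<in> sphere 0 1 \<Longrightarrow> q \<in> sphere 0 1 \<Longrightarrow> kern l p q = (\<Sum>i<n l. Y l i p * Y l i q)"
    and ex: "\<And>l. l \<ge> 1 \<Longrightarrow> AE \<omega> in M. \<forall>t s. f l (sph t s) \<omega> = (\<Sum>i<n l. \<xi> (l, i) \<omega> * Y l i (sph t s))"
    and "\<And>L. finite L \<Longrightarrow> L \<subseteq> {1..} \<Longrightarrow> std_gaussian_family (SIGMA l:L. {..<n l}) \<xi>"
    by (rule harmonic_expansion) (rule that; (assumption | blast))
  have "AE \<omega> in M. \<forall>l\<in>lrange j. \<forall>t s. f l (sph t s) \<omega> = (\<Sum>i<n l. \<xi> (l, i) \<omega> * Y l i (sph t s))"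
    using lrange_simps[of j] by (subst AE_ball_countable) (auto intro!: ex simp: countable_finite)
  hence "AE \<omega> in M. proj_chaos b C f j z 1 \<omega> = 0"
  proof eventually_elim
    case (elim \<omega>)
    show ?case
    proof (rule proj_chaos_one_zonal)
      show "f l (sph t s) \<omega> = (\<Sum>i<n l. \<xi> (l, i) \<omega> * Y l i (sph t s))" if "l \<in> lrange j" for l t s
        using elim that by blast
      show "zonal l (\<lambda>p. \<Sum>i<n l. \<xi> (l, i) \<omega> * Y l i p) (\<lambda>p. \<Sum>i<n l. \<xi> (l, i) \<omega> *\<^sub>R G l i p)"
        if "l \<in> lrange j" for l
        using that lrange_simps(2)[of j] by (intro zonal_sum Y) auto
    qed
  qed
  hence "AE \<omega> in M. (proj_chaos b C f j z 1 \<omega>)\<^sup>2 = 0" by eventually_elim simp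
  thus ?thesis by (rule integral_eq_zero_AE)
qed

text \<open>These are the trace and the squared Hilbert-Schmidt norm of the integral operator with
  kernel \<open>kern l\<close>, expressed by the Gram matrix of the \<open>Y i\<close>, which need
  not be orthogonal in L^2 of the sphere.\<close>

lemma gram_square_sum:
  fixes n :: nat
  assumes Y: "\<And>i. zonal l (Y i) (G i)"
    and K: "\<And>p q. p \<in> sphere 0 1 \<Longrightarrow> q \<in> sphere 0 1 \<Longrightarrow> kern l p q = (\<Sum>i<n. Y i p * Y i q)"
  shows "(\<Sum>i<n. sph_int (\<lambda>p. Y i p * Y i p)) = 4 * pi * harmonic_variance C l"
    and "(\<Sum>i<n. \<Sum>k<n. (sph_int (\<lambda>p. Y i p * Y k p))\<^sup>2) = (C l)\<^sup>2 * (2 * real l + 1)"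
proof -
  note cont = zonal_continuous(1)[OF Y]
  define V where "V = harmonic_variance C l"
  have "(\<Sum>i<n. sph_int (\<lambda>p. Y i p * Y i p)) = sph_int (\<lambda>p. \<Sum>i<n. Y i p * Y i p)"
    by (subst sph_int_sum) (auto intro!: continuous_intros cont)
  also have "\<dots> = sph_int (\<lambda>p. V * 1)"
  proof (rule sph_int_cong_sphere)
    fix p :: "real^3" assume p: "p \<in> sphere 0 1"
    hence "p \<bullet> p = 1" by (simp add: norm_eq_1)
    thus "(\<Sum>i<n. Y i p * Y i p) = V * 1"
      using K[OF p p] by (simp add: kern_def V_def legendre_at_one)
  qed
  also have "\<dots> = 4 * pi * V"
    unfolding sph_int_cmult sph_int_one by simp
  finally show "(\<Sum>i<n. sph_int (\<lambda>p. Y i p * Y i p)) = 4 * pi * harmonic_variance C l"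
    by (simp add: V_def)
  define m where "m i k = sph_int (\<lambda>p. Y i p * Y k p)" for i k
  have "(\<Sum>i<n. \<Sum>k<n. (m i k)\<^sup>2) = (\<Sum>i<n. \<Sum>k<n. m i k * sph_int (\<lambda>p. Y i p * Y k p))"
    by (simp add: power2_eq_square m_def)
  also have "\<dots> = sph_int (\<lambda>p. \<Sum>i<n. \<Sum>k<n. m i k * (Y i p * Y k p))"
    by (simp add: sph_int_sum sph_int_cmult cont continuous_intros)
  also have "\<dots> = sph_int (\<lambda>p. V\<^sup>2 * (4 * pi / (2 * real l + 1)) * 1)"
  proof (rule sph_int_cong_sphere)
    fix p :: "real^3" assume p: "p \<in> sphere 0 1"
    \<comment> \<open>With p fixed, undoing the Gram integrals leaves the integral of the squared
      kernel over q. It is the same for every p, so the outer integral contributes 4 pi.\<close>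
    have "(\<Sum>i<n. \<Sum>k<n. m i k * (Y i p * Y k p)) =
        sph_int (\<lambda>q. \<Sum>i<n. \<Sum>k<n. (Y i p * Y k p) * (Y i q * Y k q))"
      unfolding m_def by (simp add: sph_int_sum sph_int_cmult cont continuous_intros)
        (intro sum.cong refl mult.commute)
    also have "\<dots> = sph_int (\<lambda>q. V\<^sup>2 * (legendre l (q \<bullet> p))\<^sup>2)"
    proof (rule sph_int_cong_sphere)
      fix q :: "real^3" assume q: "q \<in> sphere 0 1"
      have "(\<Sum>i<n. \<Sum>k<n. (Y i p * Y k p) * (Y i q * Y k q)) = (kern l q p)\<^sup>2"
        unfolding K[OF q p] power2_eq_square sum_product by (intro sum.cong refl) simp
      thus "(\<Sum>i<n. \<Sum>k<n. (Y i p * Y k p) * (Y i q * Y k q)) = V\<^sup>2 * (legendre l (q \<bullet> p))\<^sup>2"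
        by (simp add: kern_def V_def power_mult_distrib)
    qed
    also have "\<dots> = V\<^sup>2 * (4 * pi / (2 * real l + 1)) * 1"
      using p by (simp add: sph_int_cmult sph_int_legendre_square)
    finally show "(\<Sum>i<n. \<Sum>k<n. m i k * (Y i p * Y k p)) = V\<^sup>2 * (4 * pi / (2 * real l + 1)) * 1" .
  qed
  also have "\<dots> = V\<^sup>2 * (4 * pi / (2 * real l + 1)) * (4 * pi)"
    by (simp only: sph_int_cmult sph_int_one)
  also have "\<dots> = (C l)\<^sup>2 * (2 * real l + 1)"
  proof -
    define d where "d = 2 * real l + 1"
    have "d > 0" by (simp add: d_def)
    thus ?thesis
      unfolding V_def harmonic_variance_def d_def[symmetric] by (simp add: power2_eq_square field_simps)
  qed
  finally show "(\<Sum>i<n. \<Sum>k<n. (sph_int (\<lambda>p. Y i p * Y k p))\<^sup>2) = (C l)\<^sup>2 * (2 * real l + 1)"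
    by (simp add: m_def)
qed

text \<open>A and B are built so that the weighted sums of variances equal 2AB and B. The two parts
  of the weight therefore contribute 1 and z^2 - 1, and the mean is the constant subtracted in the
  second chaos.\<close>

lemma chaos_weight_mean:
  assumes AB: "Aw b C j > 0" "Bw b C j > 0"
  shows "(\<Sum>l\<in>lrange j. chaos_weight b C j z l * (4 * pi * harmonic_variance C l)) = 4 * pi * z\<^sup>2"
proof -
  define A B where "A = Aw b C j" and "B = Bw b C j"
  have AB': "A > 0" "B > 0" using AB by (simp_all add: A_def B_def)
  have B: "(\<Sum>l\<in>lrange j. (b (real l / 2 ^ j))\<^sup>2 * harmonic_variance C l) = B"
    by (simp add: B_def Bw_def harmonic_variance_def mult.assoc)
  have A: "(\<Sum>l\<in>lrange j. (b (real l / 2 ^ j))\<^sup>2 * (real l * (real l + 1)) * harmonic_variance C l) = 2 * A * B"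
  proof -
    have "A * B = (\<Sum>l\<in>lrange j. (b (real l / 2 ^ j))^2 * (real l * (real l + 1) / 2) *
       C l * (2 * real l + 1) / (4 * pi))"
      using AB' by (simp add: A_def Aw_def B_def)
    hence "2 * A * B = (\<Sum>l\<in>lrange j. 2 * ((b (real l / 2 ^ j))^2 * (real l * (real l + 1) / 2) *
       C l * (2 * real l + 1) / (4 * pi)))"
      by (simp add: sum_distrib_left mult.assoc)
    also have "\<dots> = (\<Sum>l\<in>lrange j. (b (real l / 2 ^ j))\<^sup>2 * (real l * (real l + 1)) * harmonic_variance C l)"
      by (intro sum.cong refl) (simp add: harmonic_variance_def)
    finally show ?thesis ..
  qed
  have "(\<Sum>l\<in>lrange j. chaos_weight b C j z l * (4 * pi * harmonic_variance C l)) =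
      4 * pi * (z\<^sup>2 - 1) / B * (\<Sum>l\<in>lrange j. (b (real l / 2 ^ j))\<^sup>2 * harmonic_variance C l) +
      4 * pi / (2 * A * B) * (\<Sum>l\<in>lrange j. (b (real l / 2 ^ j))\<^sup>2 * (real l * (real l + 1)) * harmonic_variance C l)"
    unfolding sum_distrib_left sum.distrib[symmetric]
  proof (intro sum.cong refl)
    fix l
    have "\<beta> / B * (x + y / (2 * A)) * (4 * pi * V) = 4 * pi * x / B * (\<beta> * V) + 4 * pi / (2 * A * B) * (\<beta> * y * V)"
      for \<beta> x y V :: real
      using AB' by (simp add: field_simps)
    thus "chaos_weight b C j z l * (4 * pi * harmonic_variance C l) =
        4 * pi * (z\<^sup>2 - 1) / B * ((b (real l / 2 ^ j))\<^sup>2 * harmonic_variance C l) +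
        4 * pi / (2 * A * B) * ((b (real l / 2 ^ j))\<^sup>2 * (real l * (real l + 1)) * harmonic_variance C l)"
      unfolding chaos_weight_def A_def[symmetric] B_def[symmetric] .
  qed
  also have "\<dots> = 4 * pi * z\<^sup>2"
    unfolding A B using AB' by (simp add: field_simps)
  finally show ?thesis .
qed

text \<open>Almost surely the second chaos is c times a centred quadratic form in the \<xi> with
  block diagonal matrix: on degree l, the Gram matrix scaled by the chaos weight.\<close>

lemma expectation_proj_chaos_two:
  assumes AB: "Aw b C j > 0" "Bw b C j > 0"
  shows "(\<integral>\<omega>. (proj_chaos b C f j z 2 \<omega>)\<^sup>2 \<partial>M) =
    Aw b C j * pi / 8 * (std_normal_density z)\<^sup>2 *
     (\<Sum>l\<in>lrange j. 2 * (chaos_weight b C j z l)\<^sup>2 * ((C l)\<^sup>2 * (2 * real l + 1)))"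
proof -
  obtain Y G and n :: "nat \<Rightarrow> nat" and \<xi> where Y: "\<And>l i. l \<ge> 1 \<Longrightarrow> zonal l (Y l i) (G l i)"
    and K: "\<And>l p q. l \<ge> 1 \<Longrightarrow> p \<in> sphere 0 1 \<Longrightarrow> q \<in> sphere 0 1 \<Longrightarrow> kern l p q = (\<Sum>i<n l. Y l i p * Y l i q)"
    and ex: "\<And>l. l \<ge> 1 \<Longrightarrow> AE \<omega> in M. \<forall>t s. f l (sph t s) \<omega> = (\<Sum>i<n l. \<xi> (l, i) \<omega> * Y l i (sph t s))"
    and fam: "\<And>L. finite L \<Longrightarrow> L \<subseteq> {1..} \<Longrightarrow> std_gaussian_family (SIGMA l:L. {..<n l}) \<xi>"
    by (rule harmonic_expansion) (rule that; (assumption | blast))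
  define L where "L = lrange j"
  have L: "finite L" "L \<subseteq> {1..}" using lrange_simps by (auto simp: L_def)
  have L1: "l \<ge> 1" if "l \<in> L" for l using L that by auto
  define J where "J = (SIGMA l:L. {..<n l})"
  define w where "w l = chaos_weight b C j z l" for l
  define g where "g l i k = sph_int (\<lambda>p. Y l i p * Y l k p)" for l i k
  define m where "m x y = (if fst x = fst y then w (fst x) * g (fst x) (snd x) (snd y) else 0)" for x y :: "nat \<times> nat"
  \<comment> \<open>Its square contains (pi/2) / 4, the source of pi/8.\<close>
  define c where "c = sqrt (Aw b C j) * sqrt (pi / 2) * std_normal_density z / 2"
  have sumJ: "(\<Sum>x\<in>J. F x) = (\<Sum>l\<in>L. \<Sum>i<n l. F (l, i))" for F :: "nat \<times> nat \<Rightarrow> real"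
    unfolding J_def using L by (subst sum.Sigma) auto
  have block: "(\<Sum>x\<in>J. \<Sum>y\<in>J. if fst x = fst y then F (fst x) (snd x) (snd y) else 0) =
      (\<Sum>l\<in>L. \<Sum>i<n l. \<Sum>k<n l. F l i k)" for F :: "nat \<Rightarrow> nat \<Rightarrow> nat \<Rightarrow> real"
  proof -
    have "(\<Sum>l'\<in>L. \<Sum>k<n l'. if l = l' then F l i k else 0) = (\<Sum>k<n l. F l i k)" if "l \<in> L" for l i
    proof -
      have "(\<Sum>l'\<in>L. \<Sum>k<n l'. if l = l' then F l i k else 0) = (\<Sum>l'\<in>L. if l = l' then (\<Sum>k<n l'. F l i k) else 0)"
        by (intro sum.cong refl) auto
      thus ?thesis using L(1) that by simp
    qed
    thus ?thesis unfolding sumJ fst_conv snd_conv by simp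
  qed
  have gram1: "(\<Sum>i<n l. sph_int (\<lambda>p. Y l i p * Y l i p)) = 4 * pi * harmonic_variance C l"
    and gram2: "(\<Sum>i<n l. \<Sum>k<n l. (sph_int (\<lambda>p. Y l i p * Y l k p))\<^sup>2) = (C l)\<^sup>2 * (2 * real l + 1)"
    if "l \<in> L" for l
    using gram_square_sum[OF Y[OF L1[OF that]] K[OF L1[OF that]]] by simp_all
  have tr: "(\<Sum>x\<in>J. m x x) = 4 * pi * z\<^sup>2"
  proof -
    have "(\<Sum>x\<in>J. m x x) = (\<Sum>l\<in>L. w l * (\<Sum>i<n l. g l i i))"
      by (simp add: sumJ m_def sum_distrib_left)
    also have "\<dots> = (\<Sum>l\<in>L. w l * (4 * pi * harmonic_variance C l))"
      unfolding g_def by (intro sum.cong refl) (simp add: gram1)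
    finally show ?thesis using chaos_weight_mean[OF AB] by (simp add: L_def w_def)
  qed
  have "AE \<omega> in M. \<forall>l\<in>L. \<forall>t s. f l (sph t s) \<omega> = (\<Sum>i<n l. \<xi> (l, i) \<omega> * Y l i (sph t s))"
    using L by (subst AE_ball_countable) (auto intro!: ex simp: countable_finite)
  hence AE: "AE \<omega> in M. proj_chaos b C f j z 2 \<omega> =
      c * ((\<Sum>x\<in>J. \<Sum>y\<in>J. m x y * (\<xi> x \<omega> * \<xi> y \<omega>)) - (\<Sum>x\<in>J. m x x))"
  proof eventually_elim
    case (elim \<omega>)
    define h where "h l p = (\<Sum>i<n l. \<xi> (l, i) \<omega> * Y l i p)" for l p
    have hf: "f l (sph t s) \<omega> = h l (sph t s)" if "l \<in> lrange j" for l t s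
      using elim that by (simp add: h_def L_def)
    have hz: "zonal l (h l) (\<lambda>p. \<Sum>i<n l. \<xi> (l, i) \<omega> *\<^sub>R G l i p)" if "l \<in> lrange j" for l
      unfolding h_def[abs_def] using that L1 by (intro zonal_sum Y) (auto simp: L_def)
    have h2: "sph_int (\<lambda>p. (h l p)\<^sup>2) = (\<Sum>i<n l. \<Sum>k<n l. g l i k * (\<xi> (l, i) \<omega> * \<xi> (l, k) \<omega>))" if "l \<in> L" for l
    proof -
      have "(\<lambda>p. (h l p)\<^sup>2) = (\<lambda>p. \<Sum>i<n l. \<Sum>k<n l. (\<xi> (l, i) \<omega> * \<xi> (l, k) \<omega>) * (Y l i p * Y l k p))"
        unfolding h_def power2_eq_square sum_product by (intro ext sum.cong refl) simp
      thus ?thesis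
        using zonal_continuous(1)[OF Y[OF L1[OF that]]]
        by (simp add: sph_int_sum sph_int_cmult continuous_intros g_def)
          (intro sum.cong refl mult.commute)
    qed
    have "m x y * (\<xi> x \<omega> * \<xi> y \<omega>) = (if fst x = fst y then w (fst x) *
        (g (fst x) (snd x) (snd y) * (\<xi> (fst x, snd x) \<omega> * \<xi> (fst x, snd y) \<omega>)) else 0)" for x y
      by (cases x; cases y) (simp add: m_def)
    hence "(\<Sum>x\<in>J. \<Sum>y\<in>J. m x y * (\<xi> x \<omega> * \<xi> y \<omega>)) =
        (\<Sum>l\<in>L. \<Sum>i<n l. \<Sum>k<n l. w l * (g l i k * (\<xi> (l, i) \<omega> * \<xi> (l, k) \<omega>)))"
      using block[of "\<lambda>l i k. w l * (g l i k * (\<xi> (l, i) \<omega> * \<xi> (l, k) \<omega>))"] by simp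
    also have "\<dots> = (\<Sum>l\<in>L. w l * sph_int (\<lambda>p. (h l p)\<^sup>2))"
      by (simp add: h2 sum_distrib_left)
    finally show ?case
      using proj_chaos_two_zonal[where f = f and h = h, OF hf hz AB, of z] unfolding tr by (simp add: c_def w_def L_def)
  qed
  have \<xi>m: "\<xi> x \<in> borel_measurable M" if "x \<in> J" for x
    using fam[OF L] that unfolding std_gaussian_family_def J_def[symmetric] by blast
  have "(\<integral>\<omega>. (proj_chaos b C f j z 2 \<omega>)\<^sup>2 \<partial>M) =
      (\<integral>\<omega>. c\<^sup>2 * ((\<Sum>x\<in>J. \<Sum>y\<in>J. m x y * (\<xi> x \<omega> * \<xi> y \<omega>)) - (\<Sum>x\<in>J. m x x))\<^sup>2 \<partial>M)"
  proof (rule integral_cong_AE)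
    show "(\<lambda>\<omega>. (proj_chaos b C f j z 2 \<omega>)\<^sup>2) \<in> borel_measurable M"
      by (intro borel_measurable_power proj_chaos_measurable)
    show "(\<lambda>\<omega>. c\<^sup>2 * ((\<Sum>x\<in>J. \<Sum>y\<in>J. m x y * (\<xi> x \<omega> * \<xi> y \<omega>)) - (\<Sum>x\<in>J. m x x))\<^sup>2) \<in> borel_measurable M"
      by (intro borel_measurable_times borel_measurable_power borel_measurable_diff borel_measurable_sum
          borel_measurable_const \<xi>m)
    show "AE \<omega> in M. (proj_chaos b C f j z 2 \<omega>)\<^sup>2 =
        c\<^sup>2 * ((\<Sum>x\<in>J. \<Sum>y\<in>J. m x y * (\<xi> x \<omega> * \<xi> y \<omega>)) - (\<Sum>x\<in>J. m x x))\<^sup>2"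
      using AE by eventually_elim (simp add: power_mult_distrib)
  qed
  also have "\<dots> = c\<^sup>2 * (2 * (\<Sum>x\<in>J. \<Sum>y\<in>J. (m x y)\<^sup>2))"
    using std_gaussian_quadratic_form_variance[OF fam[OF L, folded J_def], of m]
    by (simp add: m_def g_def mult.commute)
  also have "(\<Sum>x\<in>J. \<Sum>y\<in>J. (m x y)\<^sup>2) = (\<Sum>l\<in>L. \<Sum>i<n l. \<Sum>k<n l. (w l)\<^sup>2 * (g l i k)\<^sup>2)"
    using block[of "\<lambda>l i k. (w l)\<^sup>2 * (g l i k)\<^sup>2"]
    by (simp add: m_def if_distrib[of "\<lambda>x. x\<^sup>2"] power_mult_distrib cong: if_cong)
  also have "\<dots> = (\<Sum>l\<in>L. (w l)\<^sup>2 * ((C l)\<^sup>2 * (2 * real l + 1)))"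
    unfolding sum_distrib_left[symmetric] g_def
    by (intro sum.cong refl) (simp add: gram2)
  also have "c\<^sup>2 = Aw b C j * pi / 8 * (std_normal_density z)\<^sup>2"
    using AB by (simp add: c_def power_mult_distrib power_divide)
  finally show ?thesis
    by (simp add: L_def w_def sum_distrib_left mult.assoc)
qed

end

section \<open>Dyadic Riemann sums\<close>

text \<open>A Riemann sum of mesh 2^-j in x = l / 2^j. The factor r absorbs what does not scale
  exactly: the quotient P/Q and corrections in 1/l.\<close>

definition dyadic_riemann :: "(real \<Rightarrow> real) \<Rightarrow> (nat \<Rightarrow> real) \<Rightarrow> nat \<Rightarrow> real" where
  "dyadic_riemann h r j = (\<Sum>l\<in>lrange j. h (real l / 2 ^ j) * r l) / 2 ^ j"

text \<open>With x = 2 split off, the left endpoints of the cells of a partition of [1/2,2] remain.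
  The index is a successor because \<open>j - 1\<close> is truncated at j = 0.\<close>

lemma lrange_Suc: "lrange (Suc i) = insert (4 * 2 ^ i) {2 ^ i..<4 * 2 ^ i}"
  unfolding lrange_def by auto

lemma dyadic_in_Icc:
  assumes "l \<in> lrange (Suc i)"
  shows "real l / 2 ^ Suc i \<in> {1/2..2}"
proof -
  have "real (2 ^ i) \<le> real l" "real l \<le> real (4 * 2 ^ i)"
    using assms unfolding lrange_def by (simp_all only: of_nat_le_iff) auto
  thus ?thesis by (simp add: field_simps)
qed

text \<open>The mean value theorem and uniform continuity compare each term with the increment of a
  primitive over its cell; the increments telescope.\<close>

lemma dyadic_riemann_tendsto_const:
  assumes cont: "continuous_on {1/2..2} h"
  shows "dyadic_riemann h (\<lambda>_. 1) \<longlonglongrightarrow> integral {1/2..2} h"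
proof (rule LIMSEQ_I)
  fix e :: real assume e: "e > 0"
  define F where "F x = integral {1/2..x} h" for x
  have F: "(F has_real_derivative h x) (at x within {1/2..2})" if "x \<in> {1/2..2}" for x
    unfolding F_def by (rule integral_has_real_derivative[OF cont that])
  have "uniformly_continuous_on {1/2..2} h"
    by (rule compact_uniformly_continuous[OF cont]) simp
  then obtain d where d: "d > 0" "\<And>x y. x \<in> {1/2..2} \<Longrightarrow> y \<in> {1/2..2} \<Longrightarrow> \<bar>x - y\<bar> < d \<Longrightarrow> \<bar>h x - h y\<bar> < e / 4"
    unfolding uniformly_continuous_on_def dist_real_def using e by (metis divide_pos_pos zero_less_numeral)
  have "bounded (h ` {1/2..2})"
    by (intro compact_imp_bounded compact_continuous_image cont) simp
  then obtain H where H: "H > 0" "\<And>x. x \<in> {1/2..2} \<Longrightarrow> \<bar>h x\<bar> \<le> H"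
    unfolding bounded_pos by auto
  have lim: "(\<lambda>i. c / 2 ^ Suc i) \<longlonglongrightarrow> 0" for c :: real
    using LIMSEQ_Suc[OF LIMSEQ_divide_realpow_zero[of 2 c]] by simp
  have "\<forall>\<^sub>F i in sequentially. 1 / 2 ^ Suc i < d \<and> H / 2 ^ Suc i < e / 4"
    using order_tendstoD(2)[OF lim[of 1] d(1)] order_tendstoD(2)[OF lim[of H], of "e / 4"] e
    by (auto intro: eventually_conj)
  then obtain i0 where i0: "\<And>i. i \<ge> i0 \<Longrightarrow> 1 / 2 ^ Suc i < d \<and> H / 2 ^ Suc i < e / 4"
    unfolding eventually_sequentially by blast
  have "\<bar>dyadic_riemann h (\<lambda>_. 1) (Suc i) - integral {1/2..2} h\<bar> < e" if "i \<ge> i0" for i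
  proof -
    define K :: nat where "K = 2 ^ i"
    define N :: real where "N = 2 ^ Suc i"
    have N: "N > 0" "N = 2 * real K" by (simp_all add: N_def K_def)
    have K: "K > 0" by (simp add: K_def)
    have bnd: "1 / N < d" "H / N < e / 4" using i0[OF that] by (simp_all add: N_def)
    have diff: "\<bar>h (real l / N) / N - (F (real (Suc l) / N) - F (real l / N))\<bar> \<le> e / (4 * N)"
      if l: "l \<in> {K..<4 * K}" for l
    proof -
      have in1: "real l / N \<ge> 1/2" "real (Suc l) / N \<le> 2"
        using l N K by (auto simp: field_simps)
      have lt: "real l / N < real (Suc l) / N" using N by (simp add: divide_strict_right_mono)
      have "\<exists>\<xi>\<in>{real l / N<..<real (Suc l) / N}. F (real (Suc l) / N) - F (real l / N) = (real (Suc l) / N - real l / N) * h \<xi>"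
      proof -
        have "continuous_on {1/2..2} F"
          using F by (meson DERIV_continuous continuous_on_eq_continuous_within)
        hence "continuous_on {real l / N..real (Suc l) / N} F"
          by (rule continuous_on_subset) (use in1 in auto)
        moreover have "(F has_derivative (\<lambda>y. y * h x)) (at x)" if "real l / N < x" "x < real (Suc l) / N" for x
        proof -
          have "x \<in> {1/2<..<2}"
            unfolding greaterThanLessThan_iff using that in1 by linarith
          hence "at x within {1/2..2} = at x" by (intro at_within_interior) auto
          moreover have "x \<in> {1/2..2}" using \<open>x \<in> {1/2<..<2}\<close> by simp
          ultimately have "(F has_derivative (*) (h x)) (at x)"
            using F[of x] by (simp only: has_field_derivative_def)
          moreover have "(*) (h x) = (\<lambda>y. y * h x)" by (simp add: fun_eq_iff)
          ultimately show ?thesis by simp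
        qed
        ultimately obtain \<xi> where "real l / N < \<xi>" "\<xi> < real (Suc l) / N"
          "F (real (Suc l) / N) - F (real l / N) = (real (Suc l) / N - real l / N) * h \<xi>"
          using mvt[OF lt, of F "\<lambda>x y. y * h x"] by blast
        thus ?thesis by auto
      qed
      then obtain \<xi> where \<xi>: "real l / N < \<xi>" "\<xi> < real (Suc l) / N"
        "F (real (Suc l) / N) - F (real l / N) = (real (Suc l) / N - real l / N) * h \<xi>" by auto
      have step: "real (Suc l) / N = real l / N + 1 / N" by (simp add: add_divide_distrib)
      have "\<bar>h (real l / N) - h \<xi>\<bar> < e / 4"
        by (rule d(2); (unfold atLeastAtMost_iff)?) (use \<xi>(1,2) in1 bnd(1) step in linarith)+
      hence "\<bar>h (real l / N) - h \<xi>\<bar> / N \<le> e / 4 / N"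
        using N(1) by (intro divide_right_mono) auto
      moreover have "h (real l / N) / N - (F (real (Suc l) / N) - F (real l / N)) = (h (real l / N) - h \<xi>) / N"
        unfolding \<xi>(3) by (simp add: diff_divide_distrib add_divide_distrib)
      ultimately show ?thesis using N(1) by simp
    qed
    have "(\<Sum>l\<in>{K..<4 * K}. F (real (Suc l) / N) - F (real l / N)) = F (real (4 * K) / N) - F (real K / N)"
      using sum_Suc_diff'[of K "4 * K" "\<lambda>l. F (real l / N)"] by simp
    also have "\<dots> = integral {1/2..2} h"
      using N K by (simp add: F_def)
    finally have tele: "integral {1/2..2} h = (\<Sum>l\<in>{K..<4 * K}. F (real (Suc l) / N) - F (real l / N))" ..
    have "dyadic_riemann h (\<lambda>_. 1) (Suc i) = (\<Sum>l\<in>{K..<4 * K}. h (real l / N) / N) + h 2 / N"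
    proof -
      have "real (4 * K) / N = 2" using N K by simp
      thus ?thesis
        unfolding dyadic_riemann_def lrange_Suc K_def[symmetric] N_def[symmetric]
        by (simp add: sum_divide_distrib add_divide_distrib)
    qed
    hence "dyadic_riemann h (\<lambda>_. 1) (Suc i) - integral {1/2..2} h =
        (\<Sum>l\<in>{K..<4 * K}. h (real l / N) / N - (F (real (Suc l) / N) - F (real l / N))) + h 2 / N"
      unfolding tele by (simp add: sum_subtractf)
    also have "\<bar>\<dots>\<bar> \<le> (\<Sum>l\<in>{K..<4 * K}. e / (4 * N)) + H / N"
    proof (rule order_trans[OF abs_triangle_ineq] add_mono)+
      show "\<bar>\<Sum>l\<in>{K..<4 * K}. h (real l / N) / N - (F (real (Suc l) / N) - F (real l / N))\<bar> \<le> (\<Sum>l\<in>{K..<4 * K}. e / (4 * N))"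
        by (rule order_trans[OF sum_abs]) (intro sum_mono diff)
      show "\<bar>h 2 / N\<bar> \<le> H / N"
        using H(2)[of 2] N(1) by (simp add: divide_right_mono)
    qed
    \<comment> \<open>There are 3K cells and N = 2K, so the cell errors e / (4N) add up to 3e/8; the
      extra endpoint costs less than e/4.\<close>
    also have "\<dots> = 3 * e / 8 + H / N"
      using N K by simp
    also have "\<dots> < e" using bnd(2) e by simp
    finally show ?thesis .
  qed
  hence "norm (dyadic_riemann h (\<lambda>_. 1) j - integral {1/2..2} h) < e" if "j \<ge> Suc i0" for j
    using that by (cases j) auto
  thus "\<exists>no. \<forall>n\<ge>no. norm (dyadic_riemann h (\<lambda>_. 1) n - integral {1/2..2} h) < e" by blast
qed

text \<open>The smallest l in the range tends to infinity, so r is uniformly close to R there. For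
  positive j there are at most twice 2^j terms, so errors of size e/4 stay below e after division by
  2^j.\<close>

lemma dyadic_riemann_tendsto:
  assumes cont: "continuous_on {1/2..2} h" and r: "r \<longlonglongrightarrow> R"
  shows "dyadic_riemann h r \<longlonglongrightarrow> R * integral {1/2..2} h"
proof -
  have "bounded (h ` {1/2..2})"
    by (intro compact_imp_bounded compact_continuous_image cont) simp
  then obtain H where H: "H > 0" "\<And>x. x \<in> {1/2..2} \<Longrightarrow> \<bar>h x\<bar> \<le> H"
    unfolding bounded_pos by auto
  have err: "dyadic_riemann h (\<lambda>l. r l - R) \<longlonglongrightarrow> 0"
  proof (rule LIMSEQ_I)
    fix e :: real assume e: "e > 0"
    obtain n0 where n0: "\<And>n. n \<ge> n0 \<Longrightarrow> \<bar>r n - R\<bar> < e / (4 * H)"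
      using LIMSEQ_D[OF r, of "e / (4 * H)"] e H(1) by auto
    have "\<bar>dyadic_riemann h (\<lambda>l. r l - R) (Suc i)\<bar> < e" if "i \<ge> n0" for i
    proof -
      have "n0 \<le> 2 ^ i" using that less_exp[of i] by linarith
      hence b: "\<bar>h (real l / 2 ^ Suc i) * (r l - R)\<bar> \<le> H * (e / (4 * H))" if "l \<in> lrange (Suc i)" for l
        unfolding abs_mult using n0[of l] that H
        by (intro mult_mono H(2) dyadic_in_Icc) (auto simp: lrange_def)
      have "card (lrange (Suc i)) \<le> 4 * 2 ^ i"
        unfolding lrange_def by simp
      hence card: "real (card (lrange (Suc i))) \<le> 4 * 2 ^ i"
        by (metis of_nat_le_iff of_nat_mult of_nat_numeral of_nat_power)
      have "\<bar>\<Sum>l\<in>lrange (Suc i). h (real l / 2 ^ Suc i) * (r l - R)\<bar> \<le> (\<Sum>l\<in>lrange (Suc i). H * (e / (4 * H)))"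
        by (rule order_trans[OF sum_abs]) (intro sum_mono b)
      also have "\<dots> = real (card (lrange (Suc i))) * (e / 4)"
        using H(1) by simp
      also have "\<dots> \<le> 4 * 2 ^ i * (e / 4)"
        using card e by (intro mult_right_mono) auto
      also have "\<dots> < 2 ^ Suc i * e" using e by simp
      finally show ?thesis
        unfolding dyadic_riemann_def by (simp add: field_simps)
    qed
    hence "norm (dyadic_riemann h (\<lambda>l. r l - R) j - 0) < e" if "j \<ge> Suc n0" for j
      using that by (cases j) auto
    thus "\<exists>no. \<forall>n\<ge>no. norm (dyadic_riemann h (\<lambda>l. r l - R) n - 0) < e" by blast
  qed
  have split: "dyadic_riemann h r j = dyadic_riemann h (\<lambda>l. r l - R) j + R * dyadic_riemann h (\<lambda>_. 1) j" for j
  proof -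
    have "(\<Sum>l\<in>lrange j. h (real l / 2 ^ j) * r l) = (\<Sum>l\<in>lrange j. h (real l / 2 ^ j) * (r l - R))
        + R * (\<Sum>l\<in>lrange j. h (real l / 2 ^ j) * 1)"
      unfolding sum_distrib_left sum.distrib[symmetric] by (intro sum.cong refl) (simp add: algebra_simps)
    thus ?thesis by (simp add: dyadic_riemann_def add_divide_distrib)
  qed
  show ?thesis
    using tendsto_add[OF err tendsto_mult_left[OF dyadic_riemann_tendsto_const[OF cont], of R]]
    by (simp flip: split)
qed

lemma powr_diff_nat:
  assumes "(x::real) > 0"
  shows "x powr (real k - a) = x ^ k * x powr (- a)" "x powr (real k - 2 * a) = x ^ k * (x powr (- a))\<^sup>2"
proof -
  have "x powr (real k - c) = x ^ k * x powr (- c)" for c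
    using powr_add[of x "real k" "- c"] assms by (simp add: powr_realpow)
  moreover have "x powr (- (2 * a)) = (x powr (- a))\<^sup>2"
    using powr_add[of x "- a" "- a"] by (simp add: power2_eq_square)
  ultimately show "x powr (real k - a) = x ^ k * x powr (- a)" "x powr (real k - 2 * a) = x ^ k * (x powr (- a))\<^sup>2"
    by simp_all
qed

lemma poly_quotient_tendsto:
  fixes P Q :: "real poly"
  assumes "degree P = degree Q" "Q \<noteq> 0"
  shows "(\<lambda>l. poly P (real l) / poly Q (real l)) \<longlonglongrightarrow> lead_coeff P / lead_coeff Q"
proof -
  have inf: "filterlim real at_infinity sequentially"
    by (rule filterlim_mono[OF filterlim_real_sequentially at_top_le_at_infinity order_refl])
  have "(\<lambda>l. poly P (real l) / real l ^ degree P / (poly Q (real l) / real l ^ degree Q)) \<longlonglongrightarrow>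
      lead_coeff P / lead_coeff Q"
    by (intro tendsto_divide filterlim_compose[OF poly_divide_tendsto_aux inf]) (use assms in auto)
  moreover have "\<forall>\<^sub>F l in sequentially. poly P (real l) / real l ^ degree P / (poly Q (real l) / real l ^ degree Q) =
      poly P (real l) / poly Q (real l)"
    using eventually_gt_at_top[of 0] by eventually_elim (simp add: assms(1))
  ultimately show ?thesis by (rule Lim_transform_eventually)
qed

section \<open>Asymptotics of the variance\<close>

lemma interval_integral_half_two:
  fixes h :: "real \<Rightarrow> real"
  assumes "continuous_on {1/2..2} h"
  shows "(LBINT x=1/2..2. h x) = integral {1/2..2} h"
proof -
  have "(LBINT x=ereal (1/2)..ereal 2. h x) = integral {1/2..2} h"
    by (intro interval_integral_eq_integral borel_integrable_atLeastAtMost' assms) simp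
  moreover have "(1/2::ereal) = ereal (1/2)" "(2::ereal) = ereal 2"
    by (simp_all only: one_ereal_def numeral_eq_ereal) (simp add: ereal_divide)
  ultimately show ?thesis by (simp only:)
qed

text \<open>\<open>r\<close> stands for the quotient P/Q and \<open>g\<close> for its limit;
  \<open>x0\<close> witnesses that b is not identically zero, which makes the normalising integrals
  positive.\<close>

locale needlet_asymptotics =
  fixes b :: "real \<Rightarrow> real" and C r :: "nat \<Rightarrow> real" and a g x0 :: real
  assumes b_cont: "continuous_on UNIV b"
    and C_eq: "l \<ge> 1 \<Longrightarrow> C l = real l powr (- a) * r l"
    and r_lim: "r \<longlonglongrightarrow> g" and g_pos: "g > 0"
    and b_supp: "x \<notin> {1/2..2} \<Longrightarrow> b x = 0" and b_nz: "b x0 \<noteq> 0"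
begin

text \<open>The integrands that remain after l = 2^j x. The values k = 1 and 3 belong to B and A; 1,
  3 and 5 with b^4 come from squaring the chaos weight.\<close>

definition profile2 :: "nat \<Rightarrow> real \<Rightarrow> real" where
  "profile2 k x = (b x)\<^sup>2 * x powr (real k - a)"

definition profile4 :: "nat \<Rightarrow> real \<Rightarrow> real" where
  "profile4 k x = (b x) ^ 4 * x powr (real k - 2 * a)"

lemma continuous_on_profiles: "continuous_on {1/2..2} (profile2 k)" "continuous_on {1/2..2} (profile4 k)"
  unfolding profile2_def profile4_def
  by (auto intro!: continuous_intros continuous_on_subset[OF b_cont])

lemma integral_pos:
  fixes h :: "real \<Rightarrow> real"
  assumes "continuous_on {1/2..2} h" "\<And>x. x \<in> {1/2..2} \<Longrightarrow> h x \<ge> 0" "y \<in> {1/2..2}" "h y \<noteq> 0"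
  shows "integral {1/2..2} h > 0"
proof -
  have "integral {1/2..2} h \<ge> 0"
    by (intro integral_nonneg integrable_continuous_real assms)
  moreover have "integral {1/2..2} h \<noteq> 0"
    using integral_eq_0_iff[OF assms(1)] assms(2-4) by auto
  ultimately show ?thesis by simp
qed

lemma x0_in: "x0 \<in> {1/2..2}"
  using b_supp b_nz by blast

lemma integral_profile2_pos: "integral {1/2..2} (profile2 k) > 0"
  using x0_in b_nz by (intro integral_pos[of _ x0] continuous_on_profiles) (auto simp: profile2_def)

text \<open>With N = 2^j, C_l (2l + 1) scales as N^(1-a) and the sum has of the order of N terms,
  whence the power 2 - a.\<close>

lemma Bw_eq: "Bw b C j = (2 ^ j) powr (2 - a) * dyadic_riemann (profile2 1) (\<lambda>l. r l * (2 + 1 / real l) / (4 * pi)) j"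
proof -
  define N :: real where "N = 2 ^ j"
  have N: "N > 0" by (simp add: N_def)
  have summand: "(b (real l / N))\<^sup>2 * C l * (2 * real l + 1) / (4 * pi) =
      N powr (2 - a) / N * (profile2 1 (real l / N) * (r l * (2 + 1 / real l) / (4 * pi)))" if "l \<in> lrange j" for l
  proof -
    have l: "l \<ge> 1" using that lrange_simps by auto
    define x where "x = real l / N"
    have x: "x > 0" "real l = N * x" using l N by (simp_all add: x_def)
    have C: "C l = N powr (- a) * x powr (- a) * r l"
      using C_eq[OF l] x N by (simp add: powr_mult)
    have "N powr (2 - a) = N ^ 2 * N powr (- a)" "x powr (1 - a) = x * x powr (- a)"
      using powr_diff_nat(1)[OF N, of 2 a] powr_diff_nat(1)[OF x(1), of 1 a] by simp_all
    thus ?thesis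
      unfolding x_def[symmetric] profile2_def C x(2) using x(1) N
      by (simp add: field_simps power2_eq_square)
  qed
  have "Bw b C j = (\<Sum>l\<in>lrange j. N powr (2 - a) / N * (profile2 1 (real l / N) * (r l * (2 + 1 / real l) / (4 * pi))))"
    unfolding Bw_def N_def[symmetric] by (intro sum.cong refl summand)
  thus ?thesis
    unfolding sum_distrib_left[symmetric] dyadic_riemann_def N_def[symmetric] by simp
qed

lemma Aw_num_eq: "(\<Sum>l\<in>lrange j. (b (real l / 2 ^ j))^2 * (real l * (real l + 1) / 2) *
       C l * (2 * real l + 1) / (4 * pi)) =
    (2 ^ j)\<^sup>2 * (2 ^ j) powr (2 - a) *
      dyadic_riemann (profile2 3) (\<lambda>l. r l * (1 + 1 / real l) / 2 * (2 + 1 / real l) / (4 * pi)) j"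
proof -
  define N :: real where "N = 2 ^ j"
  have N: "N > 0" by (simp add: N_def)
  have summand: "(b (real l / N))\<^sup>2 * (real l * (real l + 1) / 2) * C l * (2 * real l + 1) / (4 * pi) =
      N\<^sup>2 * N powr (2 - a) / N * (profile2 3 (real l / N) * (r l * (1 + 1 / real l) / 2 * (2 + 1 / real l) / (4 * pi)))"
    if "l \<in> lrange j" for l
  proof -
    have l: "l \<ge> 1" using that lrange_simps by auto
    define x where "x = real l / N"
    have x: "x > 0" "real l = N * x" using l N by (simp_all add: x_def)
    have C: "C l = N powr (- a) * x powr (- a) * r l"
      using C_eq[OF l] x N by (simp add: powr_mult)
    have "N powr (2 - a) = N ^ 2 * N powr (- a)" "x powr (3 - a) = x ^ 3 * x powr (- a)"
      using powr_diff_nat(1)[OF N, of 2 a] powr_diff_nat(1)[OF x(1), of 3 a] by simp_all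
    thus ?thesis
      unfolding x_def[symmetric] profile2_def C x(2) using x(1) N
      by (simp add: field_simps power2_eq_square power3_eq_cube)
  qed
  have "(\<Sum>l\<in>lrange j. (b (real l / N))\<^sup>2 * (real l * (real l + 1) / 2) * C l * (2 * real l + 1) / (4 * pi)) =
      (\<Sum>l\<in>lrange j. N\<^sup>2 * N powr (2 - a) / N *
        (profile2 3 (real l / N) * (r l * (1 + 1 / real l) / 2 * (2 + 1 / real l) / (4 * pi))))"
    by (intro sum.cong refl summand)
  thus ?thesis
    unfolding sum_distrib_left[symmetric] dyadic_riemann_def N_def[symmetric] by simp
qed

definition Bw_rescaled :: "nat \<Rightarrow> real" where
  "Bw_rescaled = dyadic_riemann (profile2 1) (\<lambda>l. r l * (2 + 1 / real l) / (4 * pi))"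

definition Aw_rescaled :: "nat \<Rightarrow> real" where
  "Aw_rescaled j = dyadic_riemann (profile2 3) (\<lambda>l. r l * (1 + 1 / real l) / 2 * (2 + 1 / real l) / (4 * pi)) j / Bw_rescaled j"

text \<open>The powers N^(2-a) cancel in the quotient, so only the two powers of l from l(l+1) are
  left.\<close>

lemma Aw_eq: "Aw b C j = (2 ^ j)\<^sup>2 * Aw_rescaled j"
  unfolding Aw_def Aw_num_eq Bw_eq Aw_rescaled_def Bw_rescaled_def by simp

lemma Bw_rescaled_tendsto: "Bw_rescaled \<longlonglongrightarrow> g / (2 * pi) * integral {1/2..2} (profile2 1)"
proof -
  have "(\<lambda>l. r l * (2 + 1 / real l) / (4 * pi)) \<longlonglongrightarrow> g * (2 + 0) / (4 * pi)"
    by (intro tendsto_intros r_lim lim_1_over_n) auto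
  from dyadic_riemann_tendsto[OF continuous_on_profiles(1) this] show ?thesis
    by (simp add: Bw_rescaled_def)
qed

lemma Ma_eq: "Ma b a = integral {1/2..2} (profile2 3) / integral {1/2..2} (profile2 1)"
  using interval_integral_half_two[OF continuous_on_profiles(1)[of 3]] interval_integral_half_two[OF continuous_on_profiles(1)[of 1]]
  by (simp add: Ma_def profile2_def)

lemma Ma_pos: "Ma b a > 0"
  unfolding Ma_eq by (intro divide_pos_pos integral_profile2_pos)

lemma Aw_rescaled_tendsto: "Aw_rescaled \<longlonglongrightarrow> Ma b a / 2"
proof -
  have "(\<lambda>l. r l * (1 + 1 / real l) / 2 * (2 + 1 / real l) / (4 * pi)) \<longlonglongrightarrow> g * (1 + 0) / 2 * (2 + 0) / (4 * pi)"
    by (intro tendsto_intros r_lim lim_1_over_n) auto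
  from tendsto_divide[OF dyadic_riemann_tendsto[OF continuous_on_profiles(1)[of 3] this] Bw_rescaled_tendsto]
  have "Aw_rescaled \<longlonglongrightarrow> g * (1 + 0) / 2 * (2 + 0) / (4 * pi) * integral {1/2..2} (profile2 3) / (g / (2 * pi) * integral {1/2..2} (profile2 1))"
    using g_pos integral_profile2_pos[of 1] by (simp add: Aw_rescaled_def[abs_def])
  also have "g * (1 + 0) / 2 * (2 + 0) / (4 * pi) * integral {1/2..2} (profile2 3) / (g / (2 * pi) * integral {1/2..2} (profile2 1)) = Ma b a / 2"
    using g_pos integral_profile2_pos[of 1] by (simp add: Ma_eq field_simps)
  finally show ?thesis .
qed

text \<open>\<open>e\<close> counts the factors 1 + 1/l left by l + 1, and 2 + 1/l is left by 2l +
  1. The leading 2 is the one in the variance of a quadratic form.\<close>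

definition quartic_sum :: "nat \<Rightarrow> nat \<Rightarrow> nat \<Rightarrow> real" where
  "quartic_sum k e = dyadic_riemann (profile4 k) (\<lambda>l. 2 * (r l)\<^sup>2 * (2 + 1 / real l) * (1 + 1 / real l) ^ e)"

lemma quartic_sum_tendsto: "quartic_sum k e \<longlonglongrightarrow> 4 * g\<^sup>2 * integral {1/2..2} (profile4 k)"
proof -
  have "(\<lambda>l. 2 * (r l)\<^sup>2 * (2 + 1 / real l) * (1 + 1 / real l) ^ e) \<longlonglongrightarrow> 2 * g\<^sup>2 * (2 + 0) * (1 + 0) ^ e"
    by (intro tendsto_intros r_lim lim_1_over_n)
  from dyadic_riemann_tendsto[OF continuous_on_profiles(2) this] show ?thesis
    by (simp add: quartic_sum_def)
qed

text \<open>The weight scales as N^(a-2) and C_l^2 (2l + 1) as N^(1-2a), so the sum is of order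
  N^(-2), which the growth of A compensates. The square is expanded because A depends on j: pulled
  out of each term, it leaves Riemann sums with fixed profiles.\<close>

lemma chaos_sum_eq:
  assumes "Aw_rescaled j \<noteq> 0" "Bw_rescaled j \<noteq> 0"
  shows "(2 ^ j)\<^sup>2 * (\<Sum>l\<in>lrange j. 2 * (chaos_weight b C j z l)\<^sup>2 * ((C l)\<^sup>2 * (2 * real l + 1))) =
    ((z\<^sup>2 - 1)\<^sup>2 * quartic_sum 1 0 j + (z\<^sup>2 - 1) / Aw_rescaled j * quartic_sum 3 1 j + 1 / (4 * (Aw_rescaled j)\<^sup>2) * quartic_sum 5 2 j) / (Bw_rescaled j)\<^sup>2"
proof -
  define N :: real where "N = 2 ^ j"
  define A B where "A = Aw_rescaled j" and "B = Bw_rescaled j"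
  define \<zeta> where "\<zeta> = z\<^sup>2 - 1"
  have N: "N > 0" by (simp add: N_def)
  have AB: "A \<noteq> 0" "B \<noteq> 0" using assms by (simp_all add: A_def B_def)
  define q where "q k e l = profile4 k (real l / N) * (2 * (r l)\<^sup>2 * (2 + 1 / real l) * (1 + 1 / real l) ^ e)" for k e l
  have "N\<^sup>2 * (2 * (chaos_weight b C j z l)\<^sup>2 * ((C l)\<^sup>2 * (2 * real l + 1))) =
      (\<zeta>\<^sup>2 * q 1 0 l + \<zeta> / A * q 3 1 l + 1 / (4 * A\<^sup>2) * q 5 2 l) / B\<^sup>2 / N" if "l \<in> lrange j" for l
  proof -
    have l: "l \<ge> 1" using that lrange_simps by auto
    define x where "x = real l / N"
    have x: "x > 0" "real l = N * x" using l N by (simp_all add: x_def)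
    define u v where "u = N powr (- a)" and "v = x powr (- a)"
    have uv: "u > 0" "v > 0" using N x by (simp_all add: u_def v_def)
    have C: "C l = u * v * r l"
      using C_eq[OF l] x N by (simp add: powr_mult u_def v_def)
    have Nu: "N powr (2 - a) = N\<^sup>2 * u"
      using powr_diff_nat(1)[OF N, of 2 a] by (simp add: u_def)
    have p4: "profile4 1 x = (b x) ^ 4 * (x * v\<^sup>2)" "profile4 3 x = (b x) ^ 4 * (x ^ 3 * v\<^sup>2)"
      "profile4 5 x = (b x) ^ 4 * (x ^ 5 * v\<^sup>2)"
      unfolding profile4_def powr_diff_nat(2)[OF x(1)] v_def by simp_all
    \<comment> \<open>\<open>y\<close> and \<open>w\<close> are the corrections in l + 1 = l y and
      2l + 1 = l w.\<close>
    define y where "y = 1 + 1 / (N * x)"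
    define w where "w = 2 + 1 / (N * x)"
    have yw: "N * x + 1 = N * x * y" "2 * (N * x) + 1 = N * x * w"
      using N x by (simp_all add: y_def w_def field_simps)
    have W: "chaos_weight b C j z l = (b x)\<^sup>2 / (N\<^sup>2 * u * B) * (\<zeta> + N * x * (N * x * y) / (2 * (N\<^sup>2 * A)))"
      unfolding chaos_weight_def Aw_eq Bw_eq Bw_rescaled_def[symmetric] N_def[symmetric] A_def[symmetric]
        B_def[symmetric] \<zeta>_def[symmetric] Nu x(2) yw using N by simp
    have "N\<^sup>2 * (2 * (chaos_weight b C j z l)\<^sup>2 * ((C l)\<^sup>2 * (2 * real l + 1))) =
        N\<^sup>2 * (2 * ((b x)\<^sup>2 / (N\<^sup>2 * u * B) * (\<zeta> + x\<^sup>2 * y / (2 * A)))\<^sup>2 * ((u * v * r l)\<^sup>2 * (N * x * w)))"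
      unfolding W C x(2) yw using N by (simp add: power2_eq_square mult.assoc)
    also have "\<dots> = 2 * (b x) ^ 4 * v\<^sup>2 * (r l)\<^sup>2 * x * w * (\<zeta> + x\<^sup>2 * y / (2 * A))\<^sup>2 / B\<^sup>2 / N"
      using N uv AB by (simp add: field_simps power2_eq_square power4_eq_xxxx)
    also have "(\<zeta> + x\<^sup>2 * y / (2 * A))\<^sup>2 = \<zeta>\<^sup>2 + \<zeta> / A * x\<^sup>2 * y + 1 / (4 * A\<^sup>2) * x ^ 4 * y\<^sup>2"
      using AB by (simp add: field_simps power2_eq_square power4_eq_xxxx)
    also have "2 * (b x) ^ 4 * v\<^sup>2 * (r l)\<^sup>2 * x * w * (\<zeta>\<^sup>2 + \<zeta> / A * x\<^sup>2 * y + 1 / (4 * A\<^sup>2) * x ^ 4 * y\<^sup>2) =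
        \<zeta>\<^sup>2 * q 1 0 l + \<zeta> / A * q 3 1 l + 1 / (4 * A\<^sup>2) * q 5 2 l"
      unfolding q_def x_def[symmetric] p4 unfolding x(2) y_def[symmetric] w_def[symmetric]
      by (simp add: distrib_left eval_nat_numeral mult_ac)
    finally show ?thesis .
  qed
  hence "N\<^sup>2 * (\<Sum>l\<in>lrange j. 2 * (chaos_weight b C j z l)\<^sup>2 * ((C l)\<^sup>2 * (2 * real l + 1))) =
      (\<Sum>l\<in>lrange j. (\<zeta>\<^sup>2 * q 1 0 l + \<zeta> / A * q 3 1 l + 1 / (4 * A\<^sup>2) * q 5 2 l) / B\<^sup>2 / N)"
    by (simp add: sum_distrib_left)
  also have "\<dots> = (\<zeta>\<^sup>2 * (sum (q 1 0) (lrange j) / N) + \<zeta> / A * (sum (q 3 1) (lrange j) / N)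
      + 1 / (4 * A\<^sup>2) * (sum (q 5 2) (lrange j) / N)) / B\<^sup>2"
    unfolding sum_divide_distrib[symmetric] sum.distrib sum_distrib_left[symmetric]
    by (simp add: add_divide_distrib mult_ac)
  finally show ?thesis
    unfolding N_def A_def B_def \<zeta>_def q_def quartic_sum_def dyadic_riemann_def .
qed

lemma limit_var_eq:
  "limit_var b a z = pi ^ 3 * (std_normal_density z)\<^sup>2 * Ma b a / (integral {1/2..2} (profile2 1))\<^sup>2 *
     integral {1/2..2} (\<lambda>x. profile4 1 x * (x\<^sup>2 / Ma b a + z\<^sup>2 - 1)\<^sup>2)"
proof -
  have "continuous_on {1/2..2} (\<lambda>x. profile4 1 x * (x\<^sup>2 / Ma b a + z\<^sup>2 - 1)\<^sup>2)"
    using Ma_pos by (intro continuous_intros continuous_on_profiles) auto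
  from interval_integral_half_two[OF this] interval_integral_half_two[OF continuous_on_profiles(1)[of 1]]
  show ?thesis by (simp add: limit_var_def profile2_def profile4_def)
qed

text \<open>Apart from zeros of b, the integrand vanishes only where x^2 = M_a (1 - z^2), which has
  at most one positive solution. Continuity gives a second point with b nonzero next to x0, and at
  one of the two the integrand is positive.\<close>

lemma limit_var_nonzero: "limit_var b a z \<noteq> 0"
proof -
  have "isCont b x0" using b_cont by (simp add: continuous_on_eq_continuous_at)
  hence "\<forall>\<^sub>F x in at x0. b x \<noteq> 0"
    using b_nz by (intro tendsto_imp_eventually_ne) (auto simp: isCont_def)
  then obtain d where d: "d > 0" "\<And>x. x \<noteq> x0 \<Longrightarrow> dist x x0 < d \<Longrightarrow> b x \<noteq> 0"
    unfolding eventually_at by auto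
  define x1 where "x1 = x0 + d / 2"
  have x1: "x1 \<noteq> x0" "b x1 \<noteq> 0" using d by (auto simp: x1_def dist_real_def)
  have x1_in: "x1 \<in> {1/2..2}" using b_supp x1 by blast
  have "x0\<^sup>2 \<noteq> x1\<^sup>2" using x1(1) x0_in x1_in by (simp add: power2_eq_iff_nonneg)
  hence "x0\<^sup>2 / Ma b a + z\<^sup>2 - 1 \<noteq> x1\<^sup>2 / Ma b a + z\<^sup>2 - 1" using Ma_pos by simp
  then obtain y where y: "y \<in> {1/2..2}" "b y \<noteq> 0" "y\<^sup>2 / Ma b a + z\<^sup>2 - 1 \<noteq> 0"
    using x0_in x1_in b_nz x1(2) by metis
  have "integral {1/2..2} (\<lambda>x. profile4 1 x * (x\<^sup>2 / Ma b a + z\<^sup>2 - 1)\<^sup>2) > 0"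
    using Ma_pos y
    by (intro integral_pos[of _ y] continuous_intros continuous_on_profiles) (auto simp: profile4_def)
  moreover have "std_normal_density z > 0" by (simp add: normal_density_pos)
  ultimately show ?thesis
    unfolding limit_var_eq using Ma_pos integral_profile2_pos[of 1] by simp
qed

text \<open>Positivity is read off from the positive limits, hence only for large j.\<close>

lemma eventually_weights_pos: "\<forall>\<^sub>F j in sequentially. Aw b C j > 0 \<and> Bw b C j > 0 \<and> Aw_rescaled j > 0 \<and> Bw_rescaled j > 0"
proof -
  have "\<forall>\<^sub>F j in sequentially. Aw_rescaled j > 0"
    using order_tendstoD(1)[OF Aw_rescaled_tendsto, of 0] Ma_pos by simp
  moreover have "\<forall>\<^sub>F j in sequentially. Bw_rescaled j > 0"
    using g_pos integral_profile2_pos[of 1] by (intro order_tendstoD(1)[OF Bw_rescaled_tendsto]) simp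
  ultimately show ?thesis
    unfolding Aw_eq Bw_eq Bw_rescaled_def[symmetric] by eventually_elim simp
qed

text \<open>The constants combine as (M_a / 2) (pi / 8) (4 g^2) / (g I / (2 pi))^2 = pi^3 M_a / I^2,
  so g cancels. The three integrals are then reassembled into one containing a square.\<close>

lemma chaos_variance_tendsto:
  "(\<lambda>j. Aw b C j * pi / 8 * (std_normal_density z)\<^sup>2 *
     (\<Sum>l\<in>lrange j. 2 * (chaos_weight b C j z l)\<^sup>2 * ((C l)\<^sup>2 * (2 * real l + 1)))) \<longlonglongrightarrow> limit_var b a z"
proof -
  define \<zeta> where "\<zeta> = z\<^sup>2 - 1"
  define m where "m = Ma b a"
  define I where "I = integral {1/2..2} (profile2 1)"
  define J where "J k = integral {1/2..2} (profile4 k)" for k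
  have pos: "m > 0" "I > 0" using Ma_pos integral_profile2_pos by (simp_all add: m_def I_def)
  have "(\<lambda>j. Aw_rescaled j * pi / 8 * (std_normal_density z)\<^sup>2 *
     ((\<zeta>\<^sup>2 * quartic_sum 1 0 j + \<zeta> / Aw_rescaled j * quartic_sum 3 1 j + 1 / (4 * (Aw_rescaled j)\<^sup>2) * quartic_sum 5 2 j) / (Bw_rescaled j)\<^sup>2))
    \<longlonglongrightarrow> m / 2 * pi / 8 * (std_normal_density z)\<^sup>2 *
     ((\<zeta>\<^sup>2 * (4 * g\<^sup>2 * J 1) + \<zeta> / (m / 2) * (4 * g\<^sup>2 * J 3) + 1 / (4 * (m / 2)\<^sup>2) * (4 * g\<^sup>2 * J 5)) / (g / (2 * pi) * I)\<^sup>2)"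
    unfolding J_def m_def I_def
    using pos g_pos
    by (intro tendsto_intros quartic_sum_tendsto Aw_rescaled_tendsto Bw_rescaled_tendsto) (auto simp: m_def I_def)
  also have "m / 2 * pi / 8 * (std_normal_density z)\<^sup>2 *
     ((\<zeta>\<^sup>2 * (4 * g\<^sup>2 * J 1) + \<zeta> / (m / 2) * (4 * g\<^sup>2 * J 3) + 1 / (4 * (m / 2)\<^sup>2) * (4 * g\<^sup>2 * J 5)) / (g / (2 * pi) * I)\<^sup>2)
     = pi ^ 3 * (std_normal_density z)\<^sup>2 * m / I\<^sup>2 * (\<zeta>\<^sup>2 * J 1 + 2 * \<zeta> / m * J 3 + 1 / m\<^sup>2 * J 5)"
    using pos g_pos by (simp add: field_simps power2_eq_square power3_eq_cube)
  also have "\<zeta>\<^sup>2 * J 1 + 2 * \<zeta> / m * J 3 + 1 / m\<^sup>2 * J 5 =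
      integral {1/2..2} (\<lambda>x. profile4 1 x * (x\<^sup>2 / m + z\<^sup>2 - 1)\<^sup>2)"
  proof -
    have "integral {1/2..2} (\<lambda>x. profile4 1 x * (x\<^sup>2 / m + z\<^sup>2 - 1)\<^sup>2) =
        integral {1/2..2} (\<lambda>x. \<zeta>\<^sup>2 * profile4 1 x + 2 * \<zeta> / m * profile4 3 x + 1 / m\<^sup>2 * profile4 5 x)"
    proof (rule integral_cong)
      fix x :: real assume "x \<in> {1/2..2}"
      hence x: "x > 0" by simp
      have h: "profile4 3 x = x\<^sup>2 * profile4 1 x" "profile4 5 x = x ^ 4 * profile4 1 x"
        using powr_diff_nat(2)[OF x, of 1 a] powr_diff_nat(2)[OF x, of 3 a] powr_diff_nat(2)[OF x, of 5 a]
        by (simp_all add: profile4_def eval_nat_numeral mult_ac)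
      show "profile4 1 x * (x\<^sup>2 / m + z\<^sup>2 - 1)\<^sup>2 = \<zeta>\<^sup>2 * profile4 1 x + 2 * \<zeta> / m * profile4 3 x + 1 / m\<^sup>2 * profile4 5 x"
        unfolding h \<zeta>_def using pos by (simp add: field_simps power2_eq_square power4_eq_xxxx)
    qed
    also have "\<dots> = \<zeta>\<^sup>2 * J 1 + 2 * \<zeta> / m * J 3 + 1 / m\<^sup>2 * J 5"
      unfolding J_def
      by (subst Henstock_Kurzweil_Integration.integral_add
            | intro integrable_continuous_real continuous_intros continuous_on_profiles)+ simp
    finally show ?thesis ..
  qed
  finally have "(\<lambda>j. Aw_rescaled j * pi / 8 * (std_normal_density z)\<^sup>2 *
     ((\<zeta>\<^sup>2 * quartic_sum 1 0 j + \<zeta> / Aw_rescaled j * quartic_sum 3 1 j + 1 / (4 * (Aw_rescaled j)\<^sup>2) * quartic_sum 5 2 j) / (Bw_rescaled j)\<^sup>2))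
    \<longlonglongrightarrow> limit_var b a z"
    unfolding limit_var_eq m_def I_def .
  moreover have "\<forall>\<^sub>F j in sequentially. Aw_rescaled j * pi / 8 * (std_normal_density z)\<^sup>2 *
     ((\<zeta>\<^sup>2 * quartic_sum 1 0 j + \<zeta> / Aw_rescaled j * quartic_sum 3 1 j + 1 / (4 * (Aw_rescaled j)\<^sup>2) * quartic_sum 5 2 j) / (Bw_rescaled j)\<^sup>2) =
     Aw b C j * pi / 8 * (std_normal_density z)\<^sup>2 *
     (\<Sum>l\<in>lrange j. 2 * (chaos_weight b C j z l)\<^sup>2 * ((C l)\<^sup>2 * (2 * real l + 1)))"
    using eventually_weights_pos
  proof eventually_elim
    case (elim j)
    hence E: "(2 ^ j)\<^sup>2 * (\<Sum>l\<in>lrange j. 2 * (chaos_weight b C j z l)\<^sup>2 * ((C l)\<^sup>2 * (2 * real l + 1))) =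
        (\<zeta>\<^sup>2 * quartic_sum 1 0 j + \<zeta> / Aw_rescaled j * quartic_sum 3 1 j + 1 / (4 * (Aw_rescaled j)\<^sup>2) * quartic_sum 5 2 j) / (Bw_rescaled j)\<^sup>2"
      unfolding \<zeta>_def by (intro chaos_sum_eq) auto
    show ?case unfolding E[symmetric] Aw_eq by simp
  qed
  ultimately show ?thesis by (rule Lim_transform_eventually)
qed

end

theorem mainTheorem5:
  fixes M :: "'w measure" and f :: "nat \<Rightarrow> real^3 \<Rightarrow> 'w \<Rightarrow> real"
    and C :: "nat \<Rightarrow> real" and b :: "real \<Rightarrow> real" and a z :: real
    and P Q :: "real poly"
  assumes prob: "prob_space M"
    and a_gt: "a > 4"
    and PQ_deg: "degree P = degree Q"
    and PQ_pos: "\<forall>l::nat. l \<ge> 1 \<longrightarrow> poly P (real l) > 0 \<and> poly Q (real l) > 0"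
    and C_def: "\<forall>l::nat. l \<ge> 1 \<longrightarrow> C l = real l powr (- a) * (poly P (real l) / poly Q (real l))"
    and b_nonneg: "\<forall>x. b x \<ge> 0"
    and b_smooth: "\<forall>n x. ((deriv ^^ n) b) differentiable (at x)"
    and b_supp: "\<forall>x. x \<notin> {1/2..2} \<longrightarrow> b x = 0"
    and b_part: "\<forall>l::nat. l > 2 \<longrightarrow> (\<Sum>j. (b (real l / 2 ^ j))^2) = 1"
    and f_meas: "\<forall>l p. f l p \<in> borel_measurable M"
    and f_gauss: "\<forall>(S :: (nat \<times> (real^3)) set) (c :: nat \<times> (real^3) \<Rightarrow> real).
        finite S \<longrightarrow> S \<subseteq> {1..} \<times> sphere 0 1 \<longrightarrow>
        (\<integral>\<omega>. cis (\<Sum>(l, p)\<in>S. c (l, p) * f l p \<omega>) \<partial>M) =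
        complex_of_real (exp (- (\<Sum>(l, p)\<in>S. \<Sum>(l', q)\<in>S.
            (if l = l' then c (l, p) * c (l', q) * C l * (2 * real l + 1) / (4 * pi)
                 * legendre l (p \<bullet> q) else 0)) / 2))"
    and f_C1: "\<forall>l \<omega>. l \<ge> 1 \<longrightarrow> (\<exists>F' :: real^3 \<Rightarrow> ((real^3) \<Rightarrow>\<^sub>L real).
        (\<forall>p. ((\<lambda>q. f l q \<omega>) has_derivative blinfun_apply (F' p)) (at p)) \<and> continuous_on UNIV F')"
  shows "(\<forall>j. (\<integral>\<omega>. (proj_chaos b C f j z 1 \<omega>)^2 \<partial>M) = 0) \<and>
         ((\<lambda>j. \<integral>\<omega>. (proj_chaos b C f j z 2 \<omega>)^2 \<partial>M) \<longlonglongrightarrow> limit_var b a z) \<and>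
         limit_var b a z \<noteq> 0"
proof -
  have PQ: "poly P (real l) > 0" "poly Q (real l) > 0" if "l \<ge> 1" for l :: nat
    using PQ_pos that by auto
  interpret gaussian_harmonics M f C
  proof (rule gaussian_harmonics.intro[OF prob gaussian_harmonics_axioms.intro])
    show "f l p \<in> borel_measurable M" for l p
      using f_meas by blast
    show "(\<lambda>q. f l q \<omega>) differentiable (at p)" if "l \<ge> 1" for l \<omega> p
      using f_C1 that unfolding differentiable_def by blast
  qed (rule f_gauss[rule_format])
  have "P \<noteq> 0" "Q \<noteq> 0" using PQ[of 1] by auto
  define g where "g = lead_coeff P / lead_coeff Q"
  have g: "(\<lambda>l. poly P (real l) / poly Q (real l)) \<longlonglongrightarrow> g"
    unfolding g_def by (rule poly_quotient_tendsto[OF PQ_deg \<open>Q \<noteq> 0\<close>])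
  \<comment> \<open>A limit of positive quotients is only nonnegative; the leading coefficients
    exclude 0.\<close>
  have "g \<ge> 0"
    using PQ by (intro LIMSEQ_le_const[OF g] exI[of _ 1]) (auto intro!: divide_nonneg_nonneg less_imp_le)
  moreover have "g \<noteq> 0"
    using \<open>P \<noteq> 0\<close> \<open>Q \<noteq> 0\<close> by (simp add: g_def)
  ultimately have "g > 0" by simp
  obtain x0 where x0: "b x0 \<noteq> 0"
  proof (rule ccontr)
    assume "\<not> thesis"
    hence "b x = 0" for x using that by blast
    \<comment> \<open>At l = 3 the partition of unity would read 0 = 1.\<close>
    thus False using b_part[rule_format, of 3] by simp
  qed
  interpret needlet_asymptotics b C "\<lambda>l. poly P (real l) / poly Q (real l)" a g x0
  proof
    show "continuous_on UNIV b"
      using b_smooth[rule_format, of 0]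
      by (intro continuous_at_imp_continuous_on ballI differentiable_imp_continuous_within) simp
    show "C l = real l powr (- a) * (poly P (real l) / poly Q (real l))" if "l \<ge> 1" for l
      using C_def that by blast
    show "b x = 0" if "x \<notin> {1/2..2}" for x using b_supp that by blast
  qed (fact g \<open>g > 0\<close> x0)+
  have "\<forall>\<^sub>F j in sequentially. Aw b C j * pi / 8 * (std_normal_density z)\<^sup>2 *
      (\<Sum>l\<in>lrange j. 2 * (chaos_weight b C j z l)\<^sup>2 * ((C l)\<^sup>2 * (2 * real l + 1))) =
      (\<integral>\<omega>. (proj_chaos b C f j z 2 \<omega>)\<^sup>2 \<partial>M)"
    using eventually_weights_pos by eventually_elim (simp add: expectation_proj_chaos_two)
  from Lim_transform_eventually[OF chaos_variance_tendsto this]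
  have "(\<lambda>j. \<integral>\<omega>. (proj_chaos b C f j z 2 \<omega>)\<^sup>2 \<partial>M) \<longlonglongrightarrow> limit_var b a z" .
  thus ?thesis
    using expectation_proj_chaos_one limit_var_nonzero by blast
qed

end
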